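(* Let $\{H_n\}_{n\ge0}$ and $\{V_n\}_{n\ge0}$ be two independent random walks on $\mathbb Z$ (with i.i.d. increments) starting from the origin, the second one being symmetric. Then $$\mathbb P(H_{n+1}=0,\ V_nV_{n+1}\le0\ \text{ for infinitely many } n)=1\iff\sum_{n=0}^\infty\mathbb P(H_{n+1}=0)\,\mathbb P(0\le V_n\le V_{n+1}-V_n)=\infty.$$ Furthermore, if the two-dimensional random walk $\{(H_n,V_n)\}_{n\ge0}$ is transient, this criterion is equivalent to $$\lim_{r\uparrow1}\int_{\mathcal V}\int_{\mathcal V}\operatorname{Re}\left(\frac{\Phi_V(r,s)}{1-\varphi_H(t)\varphi_V(s)}\right)ds\,dt=\infty,$$ where $\mathcal V\subset\mathbb T^1=\mathbb R/2\pi\mathbb Z$ is any sufficiently small neighbourhood of the origin, $\varphi_H$ and $\varphi_V$ are the characteristic functions of the jumps of $H$ and $V$ respectively, and $$\Phi_V(r,s)=\sum_{n=0}^\infty r^n\,\mathcal T_V(n)\cos(ns),$$ with $\mathcal T_V(n)$ the two-sided tail distribution of the symmetric jumps of $V$.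
   Context: The two-sided tail is $\mathcal T_V(n)=\mathbb P(|V_1|\ge n)$, $n\ge0$. A random walk is symmetric if its jump distribution is symmetric (invariant under $x\mapsto -x$). *)

theory Defs
  imports "HOL-Probability.Probability"
begin

definition jump_distr :: "'a measure \<Rightarrow> (nat \<Rightarrow> 'a \<Rightarrow> int) \<Rightarrow> int measure" where
  "jump_distr M S = distr M (count_space UNIV) (\<lambda>\<omega>. S 1 \<omega> - S 0 \<omega>)"

definition random_walk :: "'a measure \<Rightarrow> (nat \<Rightarrow> 'a \<Rightarrow> int) \<Rightarrow> bool" where
  "random_walk M S \<longleftrightarrow>
     prob_space M \<and>
     (\<forall>\<omega>\<in>space M. S 0 \<omega> = 0) \<and>
     prob_space.indep_vars M (\<lambda>_. count_space UNIV) (\<lambda>n \<omega>. S (Suc n) \<omega> - S n \<omega>) UNIV \<and>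
     (\<forall>n. distr M (count_space UNIV) (\<lambda>\<omega>. S (Suc n) \<omega> - S n \<omega>) = jump_distr M S)"

definition symmetric_walk :: "'a measure \<Rightarrow> (nat \<Rightarrow> 'a \<Rightarrow> int) \<Rightarrow> bool" where
  "symmetric_walk M S \<longleftrightarrow> distr (jump_distr M S) (count_space UNIV) uminus = jump_distr M S"

text \<open>Independence of the two processes as random elements of the sequence space,
  not merely of \<open>H n\<close> and \<open>V n\<close> for each fixed \<open>n\<close>.\<close>

definition indep_walks :: "'a measure \<Rightarrow> (nat \<Rightarrow> 'a \<Rightarrow> int) \<Rightarrow> (nat \<Rightarrow> 'a \<Rightarrow> int) \<Rightarrow> bool" where
  "indep_walks M H V \<longleftrightarrow>
     prob_space.indep_var M
       (Pi\<^sub>M UNIV (\<lambda>_. count_space UNIV)) (\<lambda>\<omega> n. H n \<omega>)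
       (Pi\<^sub>M UNIV (\<lambda>_. count_space UNIV)) (\<lambda>\<omega> n. V n \<omega>)"

text \<open>For walks started at the origin: the probability of ever returning there is less than 1.\<close>

definition transient_walk :: "'a measure \<Rightarrow> (nat \<Rightarrow> 'a \<Rightarrow> 'b::zero) \<Rightarrow> bool" where
  "transient_walk M S \<longleftrightarrow> \<P>(\<omega> in M. \<exists>n\<ge>1. S n \<omega> = 0) < 1"

definition jump_char :: "'a measure \<Rightarrow> (nat \<Rightarrow> 'a \<Rightarrow> int) \<Rightarrow> real \<Rightarrow> complex" where
  "jump_char M S = char (distr (jump_distr M S) borel real_of_int)"

definition two_sided_tail :: "'a measure \<Rightarrow> (nat \<Rightarrow> 'a \<Rightarrow> int) \<Rightarrow> nat \<Rightarrow> real" where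
  "two_sided_tail M S n = \<P>(\<omega> in M. \<bar>S 1 \<omega>\<bar> \<ge> int n)"

definition tail_series :: "'a measure \<Rightarrow> (nat \<Rightarrow> 'a \<Rightarrow> int) \<Rightarrow> real \<Rightarrow> real \<Rightarrow> real" where
  "tail_series M S r s = (\<Sum>n. r ^ n * two_sided_tail M S n * cos (real n * s))"

text \<open>The circle \<open>\<real>/2\<pi>\<int>\<close> is represented by \<open>(-\<pi>, \<pi>)\<close> (the point \<open>\<pi>\<close>
  is irrelevant for small neighbourhoods of 0), so neighbourhoods of the origin contained in a small
  arc are sets \<open>U \<subseteq> (-\<delta>, \<delta>)\<close>, \<open>\<delta> \<le> \<pi>\<close>, having 0 in their interior.
  They need not be open or symmetric; measurability is required for the integral to make sense.\<close>

definition nbhds_within_arc :: "real \<Rightarrow> real set set" where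
  "nbhds_within_arc \<delta> =
     {U. U \<in> sets lebesgue \<and> 0 \<in> interior U \<and> U \<subseteq> {-\<delta><..<\<delta>}}"

definition double_integral ::
    "'a measure \<Rightarrow> (nat \<Rightarrow> 'a \<Rightarrow> int) \<Rightarrow> (nat \<Rightarrow> 'a \<Rightarrow> int) \<Rightarrow> real set \<Rightarrow> real \<Rightarrow> real" where
  "double_integral M H V U r =
     (LINT t:U|lebesgue. LINT s:U|lebesgue.
        Re (complex_of_real (tail_series M V r s) / (1 - jump_char M H t * jump_char M V s)))"

end

theory Submission
  imports Defs
begin

text \<open>
  Write \<open>h(n) = P(H\<^sub>n = 0)\<close> and let \<open>q(n)\<close> be the probability that \<open>\<bar>V\<^sub>n\<bar>\<close> is at most the size of the
  next jump; by symmetry \<open>q(n)\<close>, the crossing probability and \<open>P(0 \<le> V\<^sub>n \<le> V\<^sub>n\<^sub>+\<^sub>1 - V\<^sub>n)\<close> agree up to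
  constants. At even times a symmetric walk is a difference of two independent copies, so no interval
  is much more likely than the one of the same length centred at \<open>0\<close>; hence \<open>q(n + k) \<le> 16 q(n)\<close>, and
  a crossing starting from anywhere is at most a constant times as likely as one starting from the
  origin. This makes the crossing events quasi-independent, so a divergent sum gives infinitely many
  of them with positive probability (Paley-Zygmund), and then with probability one since
  exchangeable events are trivial (Hewitt-Savage).

  For the second criterion, \<open>\<integral> \<Phi>\<^sub>V(r, s) \<phi>\<^sub>V(s)\<^sup>n ds\<close> is, up to a constant, the Abel version of the
  crossing probability. Weight the integral over \<open>t\<close> by a function \<open>\<psi>\<close>: since \<open>V\<close> is symmetric,
  transience makes \<open>\<Sum>\<^sub>n c(n) \<integral> \<bar>\<phi>\<^sub>V\<bar>\<^sup>n\<close> finite for \<open>c(n) = \<integral> \<psi> Re \<phi>\<^sub>H\<^sup>n\<close>, so the weighted integral over the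
  whole torus is the absolutely convergent sum of \<open>c(n) \<integral> \<Phi>\<^sub>V \<phi>\<^sub>V\<^sup>n\<close>. If the jumps of \<open>H\<close> take two values
  at distance \<open>d\<close>, let \<open>\<psi>\<close> be the Fejer kernel of order \<open>d\<close>: its coefficients \<open>c(n)\<close> are finite
  combinations of the \<open>P(H\<^sub>n = x)\<close>, comparable to \<open>h(n)\<close> after summation by a maximum principle, and
  \<open>\<psi> - 1\<^sub>U = O(1 - \<bar>\<phi>\<^sub>H\<bar>)\<close>. Away from \<open>s = 0\<close> the function \<open>\<Phi>\<^sub>V\<close> is bounded, and near \<open>s = 0\<close> its
  oscillation bounds the integral in \<open>s\<close> by a multiple of \<open>1 / (1 - \<bar>\<phi>\<^sub>H(t)\<bar>)\<close>, so replacing \<open>\<psi>\<close> by \<open>1\<^sub>U\<close>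
  costs a bounded error. Deterministic jumps of \<open>H\<close> are treated with other weights.
\<close>

section \<open>Convolution powers and concentration\<close>

text \<open>Two obstacles shape the Fourier half. Near \<open>s = 0\<close> the function
  \<open>tail_fun\<close> oscillates and may be unbounded as \<open>r\<close> tends to 1, so neither
  monotone nor dominated convergence applies to the double integral itself. It is compared, with an
  error bounded uniformly in \<open>r\<close>, to a series whose terms are nonnegative and increase
  with \<open>r\<close>; hence the weight in \<open>t\<close> must have nonnegative coefficients.
  The error is controlled by \<open>1 - norm (pmf_char p t)\<close>, not by
  \<open>norm (1 - pmf_char p t)\<close>, because the kernel is expanded in powers of both
  characteristic functions and every power of that of \<open>V\<close> costs the same constant. So
  the weight must agree with the indicator of \<open>U\<close> wherever
  \<open>norm (pmf_char p t)\<close> can reach 1. The Fejer kernel does: it is 1 at 0 and 0 at the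
  other multiples of \<open>2 * pi / d\<close>, and the difference vanishes there to second order.
  If \<open>H\<close> has deterministic jumps, that norm is identically 1 and the argument breaks
  down. For \<open>H = 0\<close> a constant weight of equal mass makes the error vanish; for a
  drift, the indicator of one period of \<open>pmf_char p\<close> has a single nonzero
  coefficient.\<close>

fun walk_pmf :: "'a::comm_monoid_add pmf \<Rightarrow> nat \<Rightarrow> 'a pmf" where
  "walk_pmf p 0 = return_pmf 0"
| "walk_pmf p (Suc n) = bind_pmf (walk_pmf p n) (\<lambda>x. map_pmf ((+) x) p)"

lemma walk_pmf_add:
  "walk_pmf p (m + n) = bind_pmf (walk_pmf p m) (\<lambda>x. map_pmf ((+) x) (walk_pmf p n))"
proof (induction n)
  case 0
  show ?case by (simp add: bind_return_pmf')
next
  case (Suc n)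
  have "(+) (x + y) = (\<lambda>z. x + (y + z))" for x y :: 'a
    by (simp add: fun_eq_iff add.assoc)
  then show ?case
    by (simp add: Suc bind_assoc_pmf bind_map_pmf map_bind_pmf pmf.map_comp o_def)
qed

lemma walk_pmf_one: "walk_pmf p (Suc 0) = p"
  by (simp add: bind_return_pmf map_pmf_idI)

text \<open>Independent coordinates stay independent at each time, so a return of the planar walk
  has the product of the two return probabilities, and transience becomes a statement about two
  walks on the integers.\<close>

lemma walk_pmf_pair:
  "walk_pmf (pair_pmf p q) n = pair_pmf (walk_pmf p n) (walk_pmf q n)"
proof (induction n)
  case 0
  show ?case by (simp add: zero_prod_def)
next
  case (Suc n)
  show ?case
    unfolding walk_pmf.simps Suc
    by (simp add: pair_pmf_def bind_assoc_pmf bind_return_pmf map_pmf_def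
        bind_commute_pmf[of "walk_pmf q n" p])
qed

lemma walk_pmf_uminus:
  fixes q :: "'a::ab_group_add pmf"
  assumes "map_pmf uminus q = q"
  shows "map_pmf uminus (walk_pmf q n) = walk_pmf q n"
proof (induction n)
  case (Suc n)
  have "map_pmf uminus (walk_pmf q (Suc n)) =
      bind_pmf (map_pmf uminus (walk_pmf q n)) (\<lambda>x. map_pmf ((+) x) (map_pmf uminus q))"
    by (simp add: map_bind_pmf bind_map_pmf pmf.map_comp o_def)
  then show ?case by (simp only: Suc assms walk_pmf.simps)
qed simp

lemma nn_integral_count_space_shift:
  fixes f :: "int \<Rightarrow> ennreal"
  shows "(\<integral>\<^sup>+x. f (x + k) \<partial>count_space UNIV) = (\<integral>\<^sup>+x. f x \<partial>count_space UNIV)"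
proof -
  have "bij_betw (\<lambda>x. x + k) (UNIV::int set) UNIV"
    by (rule bij_betwI[where g = "\<lambda>x. x - k"]) auto
  from nn_integral_bij_count_space[OF this] show ?thesis by simp
qed

lemma emeasure_pair_pmf:
  "emeasure (pair_pmf p q) A = (\<integral>\<^sup>+x. emeasure q {y. (x, y) \<in> A} \<partial>p)"
proof -
  have "emeasure (pair_pmf p q) A = (\<integral>\<^sup>+z. indicator A z \<partial>pair_pmf p q)"
    by simp
  also have "\<dots> = (\<integral>\<^sup>+x. \<integral>\<^sup>+y. indicator {y. (x, y) \<in> A} y \<partial>q \<partial>p)"
    unfolding nn_integral_pair_pmf' by (simp add: indicator_def)
  finally show ?thesis by simp
qed

text \<open>The autocorrelation of a law is largest at lag 0: each product
  \<open>pmf B x * pmf B (x + k)\<close> is at most the mean of the two squares, and shifting does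
  not change the sum of the squares.\<close>

lemma pair_pmf_coincidence:
  fixes B :: "int pmf"
  shows "(\<integral>\<^sup>+x. ennreal (pmf B (x + k)) \<partial>B) \<le> (\<integral>\<^sup>+x. ennreal (pmf B x) \<partial>B)"
proof -
  define S where "S = (\<integral>\<^sup>+x. ennreal (pmf B x * pmf B x) \<partial>count_space UNIV)"
  have S: "S = (\<integral>\<^sup>+x. ennreal (pmf B x) \<partial>B)"
    by (simp add: S_def nn_integral_measure_pmf ennreal_mult')
  have am_gm: "pmf B x * pmf B (x + k) \<le> (pmf B x * pmf B x + pmf B (x + k) * pmf B (x + k)) / 2"
    for x using sum_squares_bound[of "pmf B x" "pmf B (x + k)"] by (simp add: power2_eq_square)
  have "2 * (\<integral>\<^sup>+x. ennreal (pmf B (x + k)) \<partial>B) =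
      (\<integral>\<^sup>+x. ennreal (2 * (pmf B x * pmf B (x + k))) \<partial>count_space UNIV)"
    unfolding nn_integral_measure_pmf by (subst nn_integral_cmult[symmetric]) (auto simp: ennreal_mult')
  also have "\<dots> \<le> (\<integral>\<^sup>+x. ennreal (pmf B x * pmf B x) + ennreal (pmf B (x + k) * pmf B (x + k)) \<partial>count_space UNIV)"
  proof (intro nn_integral_mono)
    fix x
    have "2 * (pmf B x * pmf B (x + k)) \<le> pmf B x * pmf B x + pmf B (x + k) * pmf B (x + k)"
      using am_gm[of x] by simp
    then show "ennreal (2 * (pmf B x * pmf B (x + k)))
        \<le> ennreal (pmf B x * pmf B x) + ennreal (pmf B (x + k) * pmf B (x + k))"
      by (subst ennreal_plus[symmetric]) (auto intro: ennreal_leI simp del: ennreal_plus)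
  qed
  also have "\<dots> = S + S"
    using nn_integral_count_space_shift[of "\<lambda>x. ennreal (pmf B x * pmf B x)" k]
    by (subst nn_integral_add) (auto simp: S_def)
  also have "\<dots> = 2 * S" by (simp add: mult_2)
  finally show ?thesis unfolding S
    by (simp add: ennreal_mult_le_mult_iff)
qed

text \<open>Cut the line into blocks of length \<open>l + 1\<close>: if \<open>\<bar>v + x - y\<bar> \<le> l\<close>, the block of \<open>x\<close>
  is one of four translates of the block of \<open>y\<close>, and coincidence of blocks is the most likely
  translate.\<close>

lemma pair_pmf_difference_concentration:
  fixes r :: "int pmf"
  assumes l: "l \<ge> 0"
  shows "emeasure (pair_pmf r r) {(x, y). \<bar>v + x - y\<bar> \<le> l}
      \<le> 4 * emeasure (pair_pmf r r) {(x, y). \<bar>x - y\<bar> \<le> l}"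
proof -
  define b where "b = (\<lambda>x::int. x div (l + 1))"
  define B where "B = map_pmf b r"
  define D where "D k = {(x, y). b x = b y + k}" for k
  \<comment> \<open>\<open>w\<close> is the block of \<open>- v\<close>. Rounding \<open>x\<close>,
    \<open>y\<close> and \<open>- v\<close> down to block ends, together with the slack
    \<open>l\<close>, moves the difference of block numbers away from \<open>w\<close> by more than
    -2 and less than 3, which leaves four integers.\<close>
  define w where "w = - v div (l + 1)"
  have diff: "b (x::int) - b y \<in> {w - 1, w, w + 1, w + 2}" if "\<bar>v + x - y\<bar> \<le> l" for x y
  proof -
    define m where "m = l + 1"
    have m: "m > 0" using l by (simp add: m_def)
    have 1: "x = m * b x + x mod m" "y = m * b y + y mod m" "- v = m * w + (- v) mod m"
      unfolding b_def w_def m_def by simp_all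
    have 2: "0 \<le> x mod m" "x mod m < m" "0 \<le> y mod m" "y mod m < m" "0 \<le> (-v) mod m" "(-v) mod m < m"
      using m by auto
    have 3: "x - y \<le> m - 1 - v" "x - y \<ge> - v - (m - 1)" using that by (auto simp: m_def)
    have e: "m * (b x - b y - w) = (x - y + v) - x mod m + y mod m + (-v) mod m"
      using 1 by (simp add: algebra_simps)
    have "m * (b x - b y - w) < m * 3" using e 2 3 by linarith
    moreover have "m * (-2) < m * (b x - b y - w)" using e 2 3 by linarith
    ultimately have "b x - b y - w < 3" "-2 < b x - b y - w"
      using m by (auto simp only: mult_less_cancel_left_pos)
    then show ?thesis by auto
  qed
  have D: "emeasure (pair_pmf r r) (D k) \<le> emeasure (pair_pmf r r) (D 0)" for k
  proof -
    have eq: "emeasure (pair_pmf r r) (D k) = (\<integral>\<^sup>+y. ennreal (pmf B (y + k)) \<partial>B)" for k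
    proof -
      have "emeasure (pair_pmf r r) (D k) = emeasure (pair_pmf r r) {(y, x). b x = b y + k}"
        by (subst pair_commute_pmf) (simp add: D_def vimage_def split_beta')
      also have "\<dots> = (\<integral>\<^sup>+y. emeasure r {x. b x = b y + k} \<partial>r)"
        by (simp add: emeasure_pair_pmf)
      also have "\<dots> = (\<integral>\<^sup>+y. ennreal (pmf B (b y + k)) \<partial>r)"
        by (simp add: B_def pmf_map vimage_def measure_pmf.emeasure_eq_measure)
      also have "\<dots> = (\<integral>\<^sup>+y. ennreal (pmf B (y + k)) \<partial>B)"
        unfolding B_def by simp
      finally show ?thesis .
    qed
    show ?thesis unfolding eq using pair_pmf_coincidence[of B k] by simp
  qed
  have "emeasure (pair_pmf r r) {(x, y). \<bar>v + x - y\<bar> \<le> l}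
      \<le> emeasure (pair_pmf r r) (\<Union>k\<in>{w - 1, w, w + 1, w + 2}. D k)"
    using diff by (intro emeasure_mono) (fastforce simp: D_def)+
  also have "\<dots> \<le> (\<Sum>k\<in>{w - 1, w, w + 1, w + 2}. emeasure (pair_pmf r r) (D k))"
    by (intro emeasure_subadditive_finite) auto
  also have "\<dots> \<le> (\<Sum>k\<in>{w - 1, w, w + 1, w + 2}. emeasure (pair_pmf r r) (D 0))"
    by (intro sum_mono D)
  also have "\<dots> = 4 * emeasure (pair_pmf r r) (D 0)" by simp
  also have "emeasure (pair_pmf r r) (D 0) \<le> emeasure (pair_pmf r r) {(x, y). \<bar>x - y\<bar> \<le> l}"
  proof (intro emeasure_mono)
    show "D 0 \<subseteq> {(x, y). \<bar>x - y\<bar> \<le> l}"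
    proof (clarsimp simp: D_def b_def)
      fix x y :: int assume "x div (l + 1) = y div (l + 1)"
      then have "x - y = x mod (l + 1) - y mod (l + 1)"
        by (metis add_diff_cancel_left div_mult_mod_eq)
      moreover have "0 \<le> x mod (l+1)" "x mod (l+1) < l + 1" "0 \<le> y mod (l+1)" "y mod (l+1) < l + 1"
        using l by (auto simp del: zle_add1_eq_le)
      ultimately show "\<bar>x - y\<bar> \<le> l" by linarith
    qed
  qed simp
  finally show ?thesis by (simp add: mult_left_mono)
qed

section \<open>Crossing probabilities at successive times\<close>

definition conc :: "int pmf \<Rightarrow> nat \<Rightarrow> int \<Rightarrow> ennreal" where
  "conc q n l = emeasure (walk_pmf q n) {x. \<bar>x\<bar> \<le> l}"

text \<open>The \<open>q(n)\<close> of the overview. Averaging over the jump last lets every bound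
  on \<open>conc\<close> that is uniform in \<open>l\<close> pass to crossings.\<close>

definition cross :: "int pmf \<Rightarrow> nat \<Rightarrow> ennreal" where
  "cross q n = (\<integral>\<^sup>+x. conc q n \<bar>x\<bar> \<partial>q)"

lemma conc_mono: "l \<le> l' \<Longrightarrow> conc q n l \<le> conc q n l'"
  unfolding conc_def by (intro emeasure_mono) auto

text \<open>By symmetry the second half of the steps may be negated, so at time \<open>2 * m\<close>
  the walk is a difference of two independent copies of itself at time \<open>m\<close>.\<close>

lemma conc_double:
  assumes sym: "map_pmf uminus q = q" and l: "l \<ge> 0"
  shows "emeasure (walk_pmf q (2 * m)) {x. \<bar>v + x\<bar> \<le> l} \<le> 4 * conc q (2 * m) l"
proof -
  have "walk_pmf q (2 * m) = bind_pmf (walk_pmf q m) (\<lambda>x. map_pmf ((+) x) (map_pmf uminus (walk_pmf q m)))"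
    unfolding mult_2 walk_pmf_add walk_pmf_uminus[OF sym] ..
  also have "\<dots> = map_pmf (\<lambda>(x, y). x - y) (pair_pmf (walk_pmf q m) (walk_pmf q m))"
    by (simp add: pair_pmf_def map_bind_pmf pmf.map_comp o_def map_pmf_def[symmetric])
  finally have eq: "walk_pmf q (2 * m) = map_pmf (\<lambda>(x, y). x - y) (pair_pmf (walk_pmf q m) (walk_pmf q m))" .
  show ?thesis
    using pair_pmf_difference_concentration[OF l, of "walk_pmf q m" v]
    unfolding conc_def eq by (simp add: vimage_def split_beta' algebra_simps)
qed

lemma emeasure_walk_add:
  "emeasure (walk_pmf q (m + n)) A = (\<integral>\<^sup>+x. emeasure (walk_pmf q n) {y. x + y \<in> A} \<partial>walk_pmf q m)"
  unfolding walk_pmf_add by (simp add: vimage_def)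

lemma nn_integral_pmf_le_const:
  assumes "\<And>x. f x \<le> (c::ennreal)"
  shows "(\<integral>\<^sup>+x. f x \<partial>measure_pmf p) \<le> c"
proof -
  have "(\<integral>\<^sup>+x. f x \<partial>measure_pmf p) \<le> (\<integral>\<^sup>+x. c \<partial>measure_pmf p)"
    by (intro nn_integral_mono assms)
  then show ?thesis by simp
qed

text \<open>The first \<open>k\<close> steps only move the centre, and the bound at time
  \<open>2 * m\<close> is the same for all centres.\<close>

lemma conc_shift:
  assumes sym: "map_pmf uminus q = q" and l: "l \<ge> 0"
  shows "emeasure (walk_pmf q (2 * m + k)) {x. \<bar>v + x\<bar> \<le> l} \<le> 4 * conc q (2 * m) l"
proof -
  have "emeasure (walk_pmf q (2 * m + k)) {x. \<bar>v + x\<bar> \<le> l} =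
      (\<integral>\<^sup>+x. emeasure (walk_pmf q (2 * m)) {y. \<bar>(v + x) + y\<bar> \<le> l} \<partial>walk_pmf q k)"
    by (subst add.commute, subst emeasure_walk_add) (simp add: add.assoc)
  also have "\<dots> \<le> 4 * conc q (2 * m) l"
    by (intro nn_integral_pmf_le_const conc_double sym l)
  finally show ?thesis .
qed

text \<open>If \<open>x\<close> and \<open>y\<close> lie in \<open>{- l..l}\<close>, so does
  \<open>x + y\<close> or \<open>x - y\<close>: one of them has absolute value
  \<open>\<bar>\<bar>x\<bar> - \<bar>y\<bar>\<bar>\<close>. Symmetry of the last jump gives both
  events the same probability, whence the factor 2.\<close>

lemma conc_Suc_ge:
  assumes sym: "map_pmf uminus q = q"
  shows "emeasure q {x. \<bar>x\<bar> \<le> l} * conc q n l \<le> 2 * conc q (Suc n) l"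
proof -
  let ?P = "pair_pmf (walk_pmf q n) q"
  have 1: "conc q (Suc n) l = emeasure ?P {(x, y). \<bar>x + y\<bar> \<le> l}"
    unfolding conc_def emeasure_pair_pmf by (simp add: vimage_def)
  have "emeasure ?P {(x, y). \<bar>x + y\<bar> \<le> l} = (\<integral>\<^sup>+x. emeasure (map_pmf uminus q) {y. \<bar>x + y\<bar> \<le> l} \<partial>walk_pmf q n)"
    unfolding emeasure_pair_pmf by (simp add: sym)
  also have "\<dots> = emeasure ?P {(x, y). \<bar>x - y\<bar> \<le> l}"
    unfolding emeasure_pair_pmf by (simp add: vimage_def)
  finally have 2: "conc q (Suc n) l = emeasure ?P {(x, y). \<bar>x - y\<bar> \<le> l}" using 1 by simp
  have "emeasure q {x. \<bar>x\<bar> \<le> l} * conc q n l = (\<integral>\<^sup>+x. emeasure q {y. \<bar>y\<bar> \<le> l} * indicator {x. \<bar>x\<bar> \<le> l} x \<partial>walk_pmf q n)"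
    by (simp add: conc_def nn_integral_cmult)
  also have "\<dots> = (\<integral>\<^sup>+x. emeasure q {y. \<bar>x\<bar> \<le> l \<and> \<bar>y\<bar> \<le> l} \<partial>walk_pmf q n)"
    by (intro nn_integral_cong) (simp add: indicator_def)
  also have "\<dots> = emeasure ?P {(x, y). \<bar>x\<bar> \<le> l \<and> \<bar>y\<bar> \<le> l}"
    unfolding emeasure_pair_pmf by simp
  also have "\<dots> \<le> emeasure ?P ({(x, y). \<bar>x + y\<bar> \<le> l} \<union> {(x, y). \<bar>x - y\<bar> \<le> l})"
    by (intro emeasure_mono) auto
  also have "\<dots> \<le> conc q (Suc n) l + conc q (Suc n) l"
    by (subst (2) 2, subst 1, intro emeasure_subadditive) auto
  finally show ?thesis by (simp add: mult_2)
qed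

text \<open>\<open>conc_Suc_ge\<close> loses a factor
  \<open>emeasure q {y. \<bar>y\<bar> \<le> l}\<close>, which has no lower bound uniform in
  \<open>l\<close>. A second independent jump repairs this: requiring that the jump that sets the
  level be the larger of the two in absolute value keeps at least half of \<open>cross q n\<close>,
  because \<open>conc\<close> increases with the level.\<close>

lemma cross_le_Suc:
  assumes sym: "map_pmf uminus q = q"
  shows "cross q n \<le> 4 * cross q (Suc n)"
proof -
  let ?c = "conc q n"
  define I where "I = (\<integral>\<^sup>+x. \<integral>\<^sup>+y. indicator {y. \<bar>y\<bar> \<le> \<bar>x\<bar>} y * ?c \<bar>x\<bar> \<partial>q \<partial>q)"
  have I1: "I = (\<integral>\<^sup>+x. emeasure q {y. \<bar>y\<bar> \<le> \<bar>x\<bar>} * ?c \<bar>x\<bar> \<partial>q)"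
    unfolding I_def by (simp add: nn_integral_multc)
  have "I \<le> (\<integral>\<^sup>+x. 2 * conc q (Suc n) \<bar>x\<bar> \<partial>q)"
    unfolding I1 by (intro nn_integral_mono conc_Suc_ge sym)
  also have "\<dots> = 2 * cross q (Suc n)"
    by (simp add: cross_def nn_integral_cmult)
  finally have I2: "I \<le> 2 * cross q (Suc n)" .
  have comm: "(\<integral>\<^sup>+x. \<integral>\<^sup>+y. f x y \<partial>q \<partial>q) = (\<integral>\<^sup>+x. \<integral>\<^sup>+y. f y x \<partial>q \<partial>q)" for f :: "int \<Rightarrow> int \<Rightarrow> ennreal"
    using nn_integral_pair_pmf'[of q q "\<lambda>(x, y). f x y"] nn_integral_pair_pmf'[of q q "\<lambda>(x, y). f y x"]
    by (subst (asm) pair_commute_pmf) (simp add: split_beta')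
  have I3: "I = (\<integral>\<^sup>+x. \<integral>\<^sup>+y. indicator {y. \<bar>x\<bar> \<le> \<bar>y\<bar>} y * ?c \<bar>y\<bar> \<partial>q \<partial>q)"
    unfolding I_def by (subst comm) (simp add: indicator_def)
  have "cross q n = (\<integral>\<^sup>+x. \<integral>\<^sup>+y. ?c \<bar>x\<bar> \<partial>q \<partial>q)"
    by (simp add: cross_def)
  also have "\<dots> \<le> (\<integral>\<^sup>+x. \<integral>\<^sup>+y. indicator {y. \<bar>y\<bar> \<le> \<bar>x\<bar>} y * ?c \<bar>x\<bar> + indicator {y. \<bar>x\<bar> \<le> \<bar>y\<bar>} y * ?c \<bar>y\<bar> \<partial>q \<partial>q)"
    by (intro nn_integral_mono) (auto simp: indicator_def intro: conc_mono)
  also have "\<dots> = I + I"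
    by (subst (2) I3, simp add: I_def nn_integral_add)
  also have "\<dots> \<le> 2 * cross q (Suc n) + 2 * cross q (Suc n)"
    by (intro add_mono I2)
  also have "\<dots> = 4 * cross q (Suc n)" by (simp add: distrib_right[symmetric])
  finally show ?thesis .
qed

text \<open>The constant is 4 for an arbitrary centre at an even time, times 4 for returning from
  that even time to \<open>n\<close>. The surplus steps \<open>k\<close> cost nothing.\<close>

lemma crossing_from_anywhere:
  assumes sym: "map_pmf uminus q = q"
  shows "(\<integral>\<^sup>+x. emeasure (walk_pmf q (n + k)) {y. \<bar>v + y\<bar> \<le> \<bar>x\<bar>} \<partial>q) \<le> 16 * cross q n"
proof -
  \<comment> \<open>\<open>2 * m\<close> is \<open>n\<close> or \<open>n - 1\<close>; the
    concentration bound is available at even times only.\<close>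
  define m where "m = n div 2"
  obtain j where j: "n + k = 2 * m + j"
    using m_def by (metis add.assoc mult_div_mod_eq)
  have "(\<integral>\<^sup>+x. emeasure (walk_pmf q (n + k)) {y. \<bar>v + y\<bar> \<le> \<bar>x\<bar>} \<partial>q) \<le> (\<integral>\<^sup>+x. 4 * conc q (2 * m) \<bar>x\<bar> \<partial>q)"
    unfolding j by (intro nn_integral_mono conc_shift sym) auto
  also have "\<dots> = 4 * cross q (2 * m)"
    by (simp add: cross_def nn_integral_cmult)
  also have "cross q (2 * m) \<le> 4 * cross q n"
  proof (cases "even n")
    case True
    then show ?thesis
      by (simp add: m_def) (metis mult_1 mult_right_mono one_le_numeral zero_le)
  next
    case False
    then have "n = Suc (2 * m)" by (simp add: m_def)
    then show ?thesis using cross_le_Suc[OF sym, of "2 * m"] by simp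
  qed
  also have "4 * (4 * cross q n) = 16 * cross q n"
    by (simp add: mult.assoc[symmetric])
  finally show ?thesis by (simp add: mult_left_mono)
qed

text \<open>Parity rules out true monotonicity: for jumps \<open>1\<close> and \<open>- 1\<close>
  with equal probability, \<open>cross\<close> is 1/2 at time 2 and 3/4 at time 3.\<close>

lemma cross_add_le:
  assumes sym: "map_pmf uminus q = q"
  shows "cross q (n + k) \<le> 16 * cross q n"
  using crossing_from_anywhere[OF sym, of n k 0] by (simp add: cross_def conc_def)

lemma cross_le_one: "cross q n \<le> 1"
  unfolding cross_def conc_def by (intro nn_integral_pmf_le_const) (simp add: measure_pmf.emeasure_le_1)

lemma cross_alt:
  "cross q n = emeasure (pair_pmf (walk_pmf q n) q) {(v, x). \<bar>v\<bar> \<le> \<bar>x\<bar>}"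
  by (subst pair_commute_pmf) (simp add: cross_def conc_def vimage_def split_beta' emeasure_pair_pmf)

definition pos_cross :: "int pmf \<Rightarrow> nat \<Rightarrow> ennreal" where
  "pos_cross q n = emeasure (pair_pmf (walk_pmf q n) q) {(v, x). 0 \<le> v \<and> v \<le> x}"

text \<open>The form that Fourier analysis produces: the position is restricted to
  \<open>0 \<le> v\<close> because the tail series runs over nonnegative indices, while the jump
  enters through its two-sided tail.\<close>

definition half_cross :: "int pmf \<Rightarrow> nat \<Rightarrow> ennreal" where
  "half_cross q n = emeasure (pair_pmf (walk_pmf q n) q) {(v, x). 0 \<le> v \<and> v \<le> \<bar>x\<bar>}"

lemma pos_cross_le_half_cross: "pos_cross q n \<le> half_cross q n"
  unfolding pos_cross_def half_cross_def by (intro emeasure_mono) auto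

lemma half_cross_le_cross: "half_cross q n \<le> cross q n"
  unfolding cross_alt half_cross_def by (intro emeasure_mono) auto

lemma pair_pmf_uminus:
  assumes "map_pmf uminus (p :: int pmf) = p" "map_pmf uminus (q :: int pmf) = q"
  shows "emeasure (pair_pmf p q) {(x, y). P (- x) y} = emeasure (pair_pmf p q) {(x, y). P x y}"
    and "emeasure (pair_pmf p q) {(x, y). P x (- y)} = emeasure (pair_pmf p q) {(x, y). P x y}"
proof -
  have "emeasure (pair_pmf (map_pmf uminus p) q) {(x, y). P x y} = emeasure (pair_pmf p q) {(x, y). P (- x) y}"
    by (simp add: emeasure_pair_pmf)
  then show "emeasure (pair_pmf p q) {(x, y). P (- x) y} = emeasure (pair_pmf p q) {(x, y). P x y}"
    by (simp add: assms)
  have "emeasure (pair_pmf p (map_pmf uminus q)) {(x, y). P x y} = emeasure (pair_pmf p q) {(x, y). P x (- y)}"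
    unfolding emeasure_pair_pmf by (simp add: vimage_def)
  then show "emeasure (pair_pmf p q) {(x, y). P x (- y)} = emeasure (pair_pmf p q) {(x, y). P x y}"
    by (simp add: assms)
qed

text \<open>Four choices of signs for \<open>v\<close> and \<open>x\<close> cover the event
  \<open>\<bar>v\<bar> \<le> \<bar>x\<bar>\<close>, and symmetry makes them equally likely.\<close>

lemma cross_le_pos_cross:
  assumes sym: "map_pmf uminus q = q"
  shows "cross q n \<le> 4 * pos_cross q n"
proof -
  let ?P = "pair_pmf (walk_pmf q n) q"
  note flip = pair_pmf_uminus[OF walk_pmf_uminus[OF sym, of n] sym]
  let ?R = "\<lambda>v x :: int. 0 \<le> v \<and> v \<le> x"
  have a: "emeasure ?P {(v, x). ?R (- v) x} = pos_cross q n" "emeasure ?P {(v, x). ?R v (- x)} = pos_cross q n"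
    unfolding pos_cross_def by (rule flip)+
  have "emeasure ?P {(v, x). ?R (- v) (- x)} = emeasure ?P {(v, x). ?R v (- x)}"
    by (rule flip(1)[where P = "\<lambda>v x. ?R v (- x)"])
  then have b: "emeasure ?P {(v, x). ?R (- v) (- x)} = pos_cross q n" using a by simp
  let ?A = "{{(v, x). ?R v x}, {(v, x). ?R (- v) x}, {(v, x). ?R v (- x)}, {(v, x). ?R (- v) (- x)}}"
  have "cross q n \<le> emeasure ?P ({(v, x). ?R v x} \<union> {(v, x). ?R (- v) x} \<union> {(v, x). ?R v (- x)} \<union> {(v, x). ?R (- v) (- x)})"
    unfolding cross_alt by (intro emeasure_mono) auto
  also have "\<dots> \<le> emeasure ?P {(v, x). ?R v x} + emeasure ?P {(v, x). ?R (- v) x}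
      + emeasure ?P {(v, x). ?R v (- x)} + emeasure ?P {(v, x). ?R (- v) (- x)}"
    by (intro order.trans[OF emeasure_subadditive] add_mono order_refl) auto
  also have "\<dots> = pos_cross q n + pos_cross q n + pos_cross q n + pos_cross q n"
    by (simp only: a b) (simp add: pos_cross_def)
  also have "\<dots> = 4 * pos_cross q n"
    using distrib_right[of 2 2 "pos_cross q n"] by (simp add: mult_2 add.assoc)
  finally show ?thesis .
qed

lemma suminf_ennreal_le_cmult:
  fixes f g :: "nat \<Rightarrow> ennreal"
  assumes "\<And>n. f n \<le> c * g n"
  shows "suminf f \<le> c * suminf g"
  using suminf_le[OF assms] by simp

lemma suminf_ennreal_top_iff:
  fixes f g :: "nat \<Rightarrow> ennreal"
  assumes "suminf f \<le> b + c * suminf g" "b < top" "c < top"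
    and "suminf g \<le> b' + c' * suminf f" "b' < top" "c' < top"
  shows "suminf f = \<infinity> \<longleftrightarrow> suminf g = \<infinity>"
proof
  assume "suminf f = \<infinity>"
  then have "b + c * suminf g = top" using assms(1) by (simp add: top_unique)
  then show "suminf g = \<infinity>" using assms(2,3) by (auto simp: ennreal_add_eq_top ennreal_mult_eq_top_iff)
next
  assume "suminf g = \<infinity>"
  then have "b' + c' * suminf f = top" using assms(4) by (simp add: top_unique)
  then show "suminf f = \<infinity>" using assms(5,6) by (auto simp: ennreal_add_eq_top ennreal_mult_eq_top_iff)
qed

text \<open>The series of the theorem pairs a return at time \<open>n + 1\<close> with a crossing at
  time \<open>n\<close>. Moving the index costs 4 in one direction and \<open>16 * 4\<close> in the
  other; the leftover term at time 0 is at most 1.\<close>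

lemma suminf_pos_cross_iff_cross:
  fixes h :: "nat \<Rightarrow> ennreal"
  assumes sym: "map_pmf uminus q = q" and h0: "h 0 \<le> 1"
  shows "(\<Sum>n. h (Suc n) * pos_cross q n) = \<infinity> \<longleftrightarrow> (\<Sum>n. h n * cross q n) = \<infinity>"
proof (rule suminf_ennreal_top_iff[where b = 0 and c = 4 and b' = 1 and c' = 64])
  have "(\<Sum>n. h (Suc n) * pos_cross q n) \<le> 4 * (\<Sum>n. h (Suc n) * cross q (Suc n))"
  proof (rule suminf_ennreal_le_cmult)
    fix n
    have "pos_cross q n \<le> 4 * cross q (Suc n)"
      by (rule order.trans[OF pos_cross_le_half_cross order.trans[OF half_cross_le_cross cross_le_Suc[OF sym]]])
    from mult_left_mono[OF this, of "h (Suc n)"]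
    show "h (Suc n) * pos_cross q n \<le> 4 * (h (Suc n) * cross q (Suc n))"
      by (simp add: ac_simps)
  qed
  also have "\<dots> \<le> 4 * (\<Sum>n. h n * cross q n)"
    using suminf_offset[of "\<lambda>n. h n * cross q n" 1] by (intro mult_left_mono) auto
  finally show "(\<Sum>n. h (Suc n) * pos_cross q n) \<le> 0 + 4 * (\<Sum>n. h n * cross q n)" by simp
  have "(\<Sum>n. h (Suc n) * cross q (Suc n)) \<le> 64 * (\<Sum>n. h (Suc n) * pos_cross q n)"
  proof (rule suminf_ennreal_le_cmult)
    fix n
    have "cross q (Suc n) \<le> 16 * cross q n" using cross_add_le[OF sym, of n 1] by simp
    also have "\<dots> \<le> 16 * (4 * pos_cross q n)" by (intro mult_left_mono cross_le_pos_cross sym) auto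
    also have "\<dots> = 64 * pos_cross q n" by (simp add: mult.assoc[symmetric])
    finally show "h (Suc n) * cross q (Suc n) \<le> 64 * (h (Suc n) * pos_cross q n)"
      using mult_left_mono[of "cross q (Suc n)" "64 * pos_cross q n" "h (Suc n)"] by (simp add: ac_simps)
  qed
  moreover have "h 0 * cross q 0 \<le> 1 * 1"
    by (intro mult_mono h0 cross_le_one) auto
  ultimately show "(\<Sum>n. h n * cross q n) \<le> 1 + 64 * (\<Sum>n. h (Suc n) * pos_cross q n)"
    using suminf_offset[of "\<lambda>n. h n * cross q n" 1] by (simp add: add.commute[of _ "h 0 * cross q 0"] add_mono)
qed auto

lemma suminf_half_cross_iff_cross:
  fixes h :: "nat \<Rightarrow> ennreal"
  assumes sym: "map_pmf uminus q = q"
  shows "(\<Sum>n. h n * half_cross q n) = \<infinity> \<longleftrightarrow> (\<Sum>n. h n * cross q n) = \<infinity>"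
proof (rule suminf_ennreal_top_iff[where b = 0 and c = 1 and b' = 0 and c' = 4])
  show "(\<Sum>n. h n * half_cross q n) \<le> 0 + 1 * (\<Sum>n. h n * cross q n)"
    by (auto intro!: suminf_le mult_left_mono half_cross_le_cross)
  have "(\<Sum>n. h n * cross q n) \<le> 4 * (\<Sum>n. h n * half_cross q n)"
  proof (rule suminf_ennreal_le_cmult)
    fix n
    have "cross q n \<le> 4 * half_cross q n"
      by (rule order.trans[OF cross_le_pos_cross[OF sym] mult_left_mono[OF pos_cross_le_half_cross]]) simp
    then show "h n * cross q n \<le> 4 * (h n * half_cross q n)"
      using mult_left_mono[of "cross q n" "4 * half_cross q n" "h n"] by (simp add: ac_simps)
  qed
  then show "(\<Sum>n. h n * cross q n) \<le> 0 + 4 * (\<Sum>n. h n * half_cross q n)" by simp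
qed auto

section \<open>Visits to a point compared with returns to the origin\<close>

lemma pmf_walk_add:
  fixes p :: "'a::ab_group_add pmf"
  shows "ennreal (pmf (walk_pmf p (m + n)) x) = (\<integral>\<^sup>+y. ennreal (pmf (walk_pmf p n) (x - y)) \<partial>walk_pmf p m)"
  unfolding walk_pmf_add
proof (subst ennreal_pmf_bind, rule nn_integral_cong)
  fix y
  have "(+) y -` {x} = {x - y}" by (auto simp: algebra_simps)
  then show "ennreal (pmf (map_pmf ((+) y) (walk_pmf p n)) x) = ennreal (pmf (walk_pmf p n) (x - y))"
    by (simp add: pmf_map measure_pmf_single)
qed

text \<open>Conditioning on the first jump, the sum at \<open>x \<noteq> 0\<close> is at most an average of sums with one term less.\<close>

lemma walk_pmf_visits_le:
  fixes p :: "'a::ab_group_add pmf" and b :: "nat \<Rightarrow> ennreal"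
  assumes dec: "\<And>n. b (Suc n) \<le> b n"
  shows "(\<Sum>n\<le>N. ennreal (pmf (walk_pmf p n) x) * b n) \<le> (\<Sum>n\<le>N. ennreal (pmf (walk_pmf p n) 0) * b n)"
proof (induction N arbitrary: x)
  case 0
  show ?case by (auto intro!: mult_right_mono ennreal_leI simp: indicator_def)
next
  case (Suc N)
  show ?case
  proof (cases "x = 0")
    case False
    then have "(\<Sum>n\<le>Suc N. ennreal (pmf (walk_pmf p n) x) * b n) =
        (\<Sum>n\<le>N. ennreal (pmf (walk_pmf p (Suc n)) x) * b (Suc n))"
      by (subst sum.atMost_Suc_shift) (simp add: indicator_def)
    also have "\<dots> = (\<Sum>n\<le>N. (\<integral>\<^sup>+y. ennreal (pmf (walk_pmf p n) (x - y)) \<partial>p) * b (Suc n))"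
      using pmf_walk_add[of p "Suc 0", unfolded walk_pmf_one] by simp
    also have "\<dots> \<le> (\<Sum>n\<le>N. (\<integral>\<^sup>+y. ennreal (pmf (walk_pmf p n) (x - y)) \<partial>p) * b n)"
      by (intro sum_mono mult_left_mono dec) auto
    also have "\<dots> = (\<integral>\<^sup>+y. (\<Sum>n\<le>N. ennreal (pmf (walk_pmf p n) (x - y)) * b n) \<partial>p)"
      by (subst nn_integral_sum) (auto simp: nn_integral_multc)
    also have "\<dots> \<le> (\<Sum>n\<le>N. ennreal (pmf (walk_pmf p n) 0) * b n)"
      by (intro nn_integral_pmf_le_const Suc.IH)
    also have "\<dots> \<le> (\<Sum>n\<le>Suc N. ennreal (pmf (walk_pmf p n) 0) * b n)"
      by simp
    finally show ?thesis .
  qed simp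
qed

lemma walk_pmf_suminf_visits_le:
  fixes p :: "'a::ab_group_add pmf" and b :: "nat \<Rightarrow> ennreal"
  assumes dec: "\<And>n. b (Suc n) \<le> b n"
  shows "(\<Sum>n. ennreal (pmf (walk_pmf p n) x) * b n) \<le> (\<Sum>n. ennreal (pmf (walk_pmf p n) 0) * b n)"
proof (rule suminf_le_const)
  fix N
  have "(\<Sum>n<N. ennreal (pmf (walk_pmf p n) x) * b n) \<le> (\<Sum>n\<le>N. ennreal (pmf (walk_pmf p n) x) * b n)"
    by (intro sum_mono2) auto
  also have "\<dots> \<le> (\<Sum>n\<le>N. ennreal (pmf (walk_pmf p n) 0) * b n)"
    by (intro walk_pmf_visits_le dec)
  also have "\<dots> \<le> (\<Sum>n. ennreal (pmf (walk_pmf p n) 0) * b n)"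
    by (intro sum_le_suminf) auto
  finally show "(\<Sum>n<N. ennreal (pmf (walk_pmf p n) x) * b n) \<le> (\<Sum>n. ennreal (pmf (walk_pmf p n) 0) * b n)" .
qed auto

lemma suminf_cross_visits_le:
  assumes sym: "map_pmf uminus q = q"
  shows "(\<Sum>n. ennreal (pmf (walk_pmf p n) x) * cross q n) \<le> 16 * (\<Sum>n. ennreal (pmf (walk_pmf p n) (0::int)) * cross q n)"
proof -
  \<comment> \<open>The maximum principle needs weights that really decrease. \<open>b\<close> is
    the least decreasing majorant of \<open>cross q\<close>, and \<open>cross_add_le\<close> keeps
    it within the factor 16.\<close>
  define b where "b n = (SUP k. cross q (n + k))" for n
  have b1: "cross q n \<le> b n" for n
    unfolding b_def using SUP_upper[of 0 UNIV "\<lambda>k. cross q (n + k)"] by simp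
  have b2: "b n \<le> 16 * cross q n" for n
    unfolding b_def by (intro SUP_least cross_add_le sym)
  have b3: "b (Suc n) \<le> b n" for n
    unfolding b_def
  proof (rule SUP_least)
    fix k show "cross q (Suc n + k) \<le> (SUP k. cross q (n + k))"
      using SUP_upper[of "Suc k" UNIV "\<lambda>k. cross q (n + k)"] by simp
  qed
  have "(\<Sum>n. ennreal (pmf (walk_pmf p n) x) * cross q n) \<le> (\<Sum>n. ennreal (pmf (walk_pmf p n) x) * b n)"
    by (intro suminf_le mult_left_mono b1) auto
  also have "\<dots> \<le> (\<Sum>n. ennreal (pmf (walk_pmf p n) 0) * b n)"
    by (intro walk_pmf_suminf_visits_le b3)
  also have "\<dots> \<le> 16 * (\<Sum>n. ennreal (pmf (walk_pmf p n) 0) * cross q n)"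
  proof (rule suminf_ennreal_le_cmult)
    fix n show "ennreal (pmf (walk_pmf p n) 0) * b n \<le> 16 * (ennreal (pmf (walk_pmf p n) 0) * cross q n)"
      using mult_left_mono[OF b2, of "ennreal (pmf (walk_pmf p n) 0)"] by (simp add: ac_simps)
  qed
  finally show ?thesis .
qed

lemma pmf_walk_add_ge:
  fixes p :: "'a::ab_group_add pmf"
  shows "pmf (walk_pmf p m) 0 * pmf (walk_pmf p n) 0 \<le> pmf (walk_pmf p (m + n)) 0"
proof -
  have "ennreal (pmf (walk_pmf p m) 0 * pmf (walk_pmf p n) 0) =
      (\<integral>\<^sup>+y. ennreal (pmf (walk_pmf p n) (0 - y)) * indicator {0} y \<partial>walk_pmf p m)"
    by (subst nn_integral_indicator_singleton) (auto simp: ennreal_mult' emeasure_pmf_single mult.commute)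
  also have "\<dots> \<le> (\<integral>\<^sup>+y. ennreal (pmf (walk_pmf p n) (0 - y)) \<partial>walk_pmf p m)"
    by (intro nn_integral_mono) (auto simp: indicator_def)
  also have "\<dots> = ennreal (pmf (walk_pmf p (m + n)) 0)"
    by (rule pmf_walk_add[symmetric])
  finally show ?thesis by simp
qed

text \<open>Some \<open>x\<close> is reached at time \<open>m\<close>, and by symmetry the next
  \<open>m\<close> steps lead back by \<open>- x\<close> with positive probability.\<close>

lemma pmf_walk_double_pos:
  assumes sym: "map_pmf uminus (q :: int pmf) = q"
  shows "pmf (walk_pmf q (2 * m)) 0 > 0"
proof -
  obtain x where x: "x \<in> set_pmf (walk_pmf q m)" using set_pmf_not_empty[of "walk_pmf q m"] by blast
  then have "- x \<in> set_pmf (map_pmf uminus (walk_pmf q m))" by simp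
  then have "- x \<in> set_pmf (walk_pmf q m)" by (simp only: walk_pmf_uminus[OF sym])
  then have "0 \<in> set_pmf (walk_pmf q (m + m))"
    unfolding walk_pmf_add using x by (force simp: image_iff)
  then show ?thesis by (simp add: mult_2 pmf_positive)
qed

text \<open>At odd times the return probability of \<open>q\<close> may vanish; an odd return time of \<open>p\<close>, if there
  is any, moves these terms to even times.\<close>

lemma suminf_dominated_returns_finite:
  fixes p q :: "int pmf" and \<beta> :: "nat \<Rightarrow> ennreal"
  assumes sym: "map_pmf uminus q = q"
    and dec: "\<And>n. \<beta> (Suc n) \<le> \<beta> n"
    and even: "\<And>m. \<beta> (2 * m) = pmf (walk_pmf q (2 * m)) 0"
    and fin: "(\<Sum>n. ennreal (pmf (walk_pmf p n) 0) * ennreal (pmf (walk_pmf q n) 0)) < \<infinity>"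
  shows "(\<Sum>n. ennreal (pmf (walk_pmf p n) 0) * \<beta> n) < \<infinity>"
proof -
  define h where "h n = ennreal (pmf (walk_pmf p n) 0)" for n
  define v where "v n = ennreal (pmf (walk_pmf q n) 0)" for n
  have hadd: "h m * h n \<le> h (m + n)" for m n
    unfolding h_def using pmf_walk_add_ge[of p m n] by (simp add: ennreal_mult'[symmetric] ennreal_leI)
  have vadd: "v m * v n \<le> v (m + n)" for m n
    unfolding v_def using pmf_walk_add_ge[of q m n] by (simp add: ennreal_mult'[symmetric] ennreal_leI)
  have fin': "(\<Sum>n. h n * v n) < \<infinity>" using fin by (simp add: h_def v_def)
  have E: "(\<Sum>n. of_bool (even n) * (h n * \<beta> n)) < \<infinity>"
  proof -
    have "(\<Sum>n. of_bool (even n) * (h n * \<beta> n)) \<le> (\<Sum>n. h n * v n)"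
      by (intro suminf_le) (auto simp: even v_def elim!: evenE)
    with fin' show ?thesis by (rule le_less_trans[rotated])
  qed
  have O: "(\<Sum>n. of_bool (odd n) * (h n * \<beta> n)) < \<infinity>"
  proof (cases "\<exists>k. odd k \<and> h k > 0")
    case False
    then have "of_bool (odd n) * (h n * \<beta> n) = 0" for n by (cases "odd n") auto
    then have "(\<lambda>n. of_bool (odd n) * (h n * \<beta> n)) = (\<lambda>_. 0)" by (rule ext)
    then show ?thesis by (simp only: suminf_zero) simp
  next
    case True
    then obtain k where k: "odd k" "h k > 0" by auto
    \<comment> \<open>For \<open>n = 2 * m + 1\<close> the time \<open>n + k\<close> is the sum of
      the even times \<open>Suc k\<close> and \<open>2 * m\<close>. Multiplying by the return of
      \<open>p\<close> at time \<open>k\<close> and of \<open>q\<close> at time \<open>Suc k\<close>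
      therefore turns an odd term into a genuine term of the finite sum.\<close>
    define c where "c = h k * v (Suc k)"
    have "v (Suc k) > 0"
      using k(1) pmf_walk_double_pos[OF sym, of "Suc k div 2"] by (simp add: v_def)
    then have c: "c > 0" "c < top"
      using k by (auto simp: c_def v_def h_def ennreal_mult_less_top ennreal_zero_less_mult_iff)
    have "c * (\<Sum>n. of_bool (odd n) * (h n * \<beta> n)) = (\<Sum>n. c * (of_bool (odd n) * (h n * \<beta> n)))"
      by simp
    also have "\<dots> \<le> (\<Sum>n. h (n + k) * v (n + k))"
    proof (intro suminf_le)
      fix n
      show "c * (of_bool (odd n) * (h n * \<beta> n)) \<le> h (n + k) * v (n + k)"
      proof (cases "odd n")
        case True
        then obtain m where n: "n = Suc (2 * m)" by (auto elim: oddE)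
        have "\<beta> n \<le> v (2 * m)" using dec[of "2 * m"] even[of m] by (simp add: n v_def)
        then have "v (Suc k) * \<beta> n \<le> v (Suc k) * v (2 * m)" by (intro mult_left_mono) auto
        also have "\<dots> \<le> v (n + k)" using vadd[of "Suc k" "2 * m"] by (simp add: n ac_simps)
        finally have "(h n * h k) * (v (Suc k) * \<beta> n) \<le> h (n + k) * v (n + k)"
          using hadd[of n k] by (intro mult_mono) auto
        then show ?thesis using True by (simp add: c_def ac_simps)
      qed simp
    qed auto
    also have "\<dots> \<le> (\<Sum>n. h n * v n)"
      using suminf_offset[of "\<lambda>n. h n * v n" k] by simp
    finally have "c * (\<Sum>n. of_bool (odd n) * (h n * \<beta> n)) < top" using fin' by simp
    then show ?thesis using c(1) by (auto simp: ennreal_mult_less_top)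
  qed
  have "(\<Sum>n. h n * \<beta> n) = (\<Sum>n. of_bool (even n) * (h n * \<beta> n) + of_bool (odd n) * (h n * \<beta> n))"
    by (intro suminf_cong) auto
  also have "\<dots> = (\<Sum>n. of_bool (even n) * (h n * \<beta> n)) + (\<Sum>n. of_bool (odd n) * (h n * \<beta> n))"
    by (intro suminf_add[symmetric]) auto
  also have "\<dots> < \<infinity>" using E O by simp
  finally show ?thesis unfolding h_def .
qed

section \<open>The sequence of jumps\<close>

definition seq_meas :: "'a pmf \<Rightarrow> (nat \<Rightarrow> 'a) measure" where
  "seq_meas D = PiM UNIV (\<lambda>_. measure_pmf D)"

abbreviation seq_alg :: "(nat \<Rightarrow> 'a) measure" where
  "seq_alg \<equiv> PiM UNIV (\<lambda>_. count_space UNIV)"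

lemma space_seq_meas [simp]: "space (seq_meas D) = UNIV"
  by (simp add: seq_meas_def space_PiM)

lemma sets_seq_meas [measurable_cong]: "sets (seq_meas D) = sets seq_alg"
  unfolding seq_meas_def by (intro sets_PiM_cong) auto

lemma product_prob_space_pmf: "product_prob_space (\<lambda>_. measure_pmf D)"
  by (intro product_prob_space.intro product_sigma_finite.intro product_prob_space_axioms.intro
      measure_pmf.sigma_finite_measure_axioms measure_pmf.prob_space_axioms)

lemma sequence_space_pmf: "sequence_space (measure_pmf D)"
  by (intro sequence_space.intro product_prob_space_pmf)

lemma prob_space_seq_meas: "prob_space (seq_meas D)"
  unfolding seq_meas_def by (intro prob_space_PiM measure_pmf.prob_space_axioms)

lemma emeasure_seq_box:
  assumes "finite J"
  shows "emeasure (seq_meas D) {\<omega>. \<forall>j\<in>J. \<omega> j \<in> F j} = (\<Prod>j\<in>J. emeasure (measure_pmf D) (F j))"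
proof -
  have "{\<omega>. \<forall>j\<in>J. \<omega> j \<in> F j} = prod_emb UNIV (\<lambda>_. measure_pmf D) J (Pi\<^sub>E J F)"
    by (auto simp: prod_emb_def PiE_iff)
  then show ?thesis
    unfolding seq_meas_def using assms
    by (simp only:) (intro emeasure_PiM_emb, auto simp: measure_pmf.prob_space_axioms)
qed

lemma sets_seq_box [measurable]: "finite J \<Longrightarrow> {\<omega>. \<forall>j\<in>J. \<omega> j \<in> F j} \<in> sets seq_alg"
proof -
  assume J: "finite J"
  have "{\<omega>. \<forall>j\<in>J. \<omega> j \<in> F j} = prod_emb UNIV (\<lambda>_. count_space UNIV) J (Pi\<^sub>E J F)"
    by (auto simp: prod_emb_def PiE_iff)
  then show ?thesis using J by (simp only:) (intro sets_PiM_I, auto)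
qed

lemma seq_meas_eqI:
  assumes sets: "sets N = sets seq_alg"
    and "\<And>J F. finite J \<Longrightarrow> emeasure N {\<omega>. \<forall>j\<in>J. \<omega> j \<in> F j} = (\<Prod>j\<in>J. emeasure (measure_pmf D) (F j))"
  shows "N = seq_meas D"
unfolding seq_meas_def
proof (rule product_prob_space.PiM_eq[OF product_prob_space_pmf])
  show "sets N = sets (PiM UNIV (\<lambda>_. measure_pmf D))" using sets sets_seq_meas unfolding seq_meas_def by metis
  fix J :: "nat set" and F :: "nat \<Rightarrow> 'a set"
  assume J: "finite J"
  have "{\<omega>. \<forall>j\<in>J. \<omega> j \<in> F j} = prod_emb UNIV (\<lambda>_. measure_pmf D) J (Pi\<^sub>E J F)"
    by (auto simp: prod_emb_def PiE_iff)
  with assms(2)[OF J, of F]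
  show "emeasure N (prod_emb UNIV (\<lambda>_. measure_pmf D) J (Pi\<^sub>E J F)) = (\<Prod>j\<in>J. emeasure (measure_pmf D) (F j))"
    by simp
qed

lemma nn_integral_seq_prod:
  assumes J: "finite J"
  shows "(\<integral>\<^sup>+\<omega>. (\<Prod>j\<in>J. g j (\<omega> j)) \<partial>seq_meas D) = (\<Prod>j\<in>J. \<integral>\<^sup>+x. g j x \<partial>measure_pmf D)"
proof -
  have *: "distr (seq_meas D) (PiM J (\<lambda>_. measure_pmf D)) (\<lambda>\<omega>. restrict \<omega> J) = PiM J (\<lambda>_. measure_pmf D)"
    unfolding seq_meas_def using J by (intro product_prob_space.distr_PiM_restrict_finite[OF product_prob_space_pmf]) auto
  have meas: "(\<lambda>x. \<Prod>j\<in>J. g j (x j)) \<in> borel_measurable (PiM J (\<lambda>_. measure_pmf D))"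
  proof (intro borel_measurable_prod_ennreal)
    fix j assume j: "j \<in> J"
    have "(\<lambda>x. x j) \<in> PiM J (\<lambda>_. measure_pmf D) \<rightarrow>\<^sub>M measure_pmf D"
      using j by (rule measurable_component_singleton)
    then show "(\<lambda>x. g j (x j)) \<in> borel_measurable (PiM J (\<lambda>_. measure_pmf D))"
      by (rule measurable_compose) simp
  qed
  have "(\<Prod>j\<in>J. \<integral>\<^sup>+x. g j x \<partial>measure_pmf D) = (\<integral>\<^sup>+\<omega>. (\<Prod>j\<in>J. g j (\<omega> j)) \<partial>PiM J (\<lambda>_. measure_pmf D))"
    by (rule product_sigma_finite.product_nn_integral_prod[OF product_prob_space.axioms(1)[OF product_prob_space_pmf], symmetric]) (auto simp: J)
  also have "\<dots> = (\<integral>\<^sup>+\<omega>. (\<Prod>j\<in>J. g j (restrict \<omega> J j)) \<partial>seq_meas D)"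
    by (subst *[symmetric], subst nn_integral_distr)
       (auto simp: meas intro!: measurable_restrict_subset[of J UNIV "\<lambda>_. measure_pmf D", unfolded seq_meas_def[symmetric]])
  also have "\<dots> = (\<integral>\<^sup>+\<omega>. (\<Prod>j\<in>J. g j (\<omega> j)) \<partial>seq_meas D)"
    by (intro nn_integral_cong prod.cong) auto
  finally show ?thesis ..
qed

lemma measurable_countable_fun2:
  fixes X :: "'a \<Rightarrow> 'b::countable" and Y :: "'a \<Rightarrow> 'c::countable"
  assumes [measurable]: "X \<in> measurable N (count_space UNIV)" "Y \<in> measurable N (count_space UNIV)"
  shows "(\<lambda>\<omega>. f (X \<omega>) (Y \<omega>)) \<in> measurable N (count_space UNIV)"
proof (rule measurable_compose_countable[where g = X and f = "\<lambda>i \<omega>. f i (Y \<omega>)"])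
  show "(\<lambda>\<omega>. f i (Y \<omega>)) \<in> measurable N (count_space UNIV)" for i
    by (rule measurable_compose[of Y N "count_space UNIV"]) auto
qed auto

lemma measurable_partial_sum [measurable]:
  "(\<lambda>\<omega>. \<Sum>i<n. \<omega> i) \<in> measurable seq_alg (count_space (UNIV :: 'a::{countable,comm_monoid_add} set))"
proof (induction n)
  case (Suc n)
  have "(\<lambda>\<omega>::nat \<Rightarrow> 'a. \<omega> n) \<in> measurable seq_alg (count_space UNIV)"
    by (rule measurable_component_singleton) auto
  from measurable_countable_fun2[OF Suc this, of "(+)"] show ?case by simp
qed simp

text \<open>The Markov property at a fixed time: gluing an independent copy after the first
  \<open>n\<close> coordinates does not change the law.\<close>

lemma emeasure_seq_split:
  assumes A: "A \<in> sets seq_alg"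
  shows "emeasure (seq_meas D) A = (\<integral>\<^sup>+\<omega>. emeasure (seq_meas D) {\<omega>'. comb_seq n \<omega> \<omega>' \<in> A} \<partial>seq_meas D)"
proof -
  let ?f = "\<lambda>(\<omega>, \<omega>'). comb_seq n \<omega> \<omega>'"
  have A': "A \<in> sets (seq_meas D)" using A sets_seq_meas by metis
  have m: "?f \<in> measurable (seq_meas D \<Otimes>\<^sub>M seq_meas D) (seq_meas D)"
    using measurable_comb_seq[of n "measure_pmf D"] unfolding seq_meas_def .
  have "emeasure (seq_meas D) A = emeasure (distr (seq_meas D \<Otimes>\<^sub>M seq_meas D) (seq_meas D) ?f) A"
    by (simp add: sequence_space.PiM_comb_seq[OF sequence_space_pmf, folded seq_meas_def])
  also have "\<dots> = emeasure (seq_meas D \<Otimes>\<^sub>M seq_meas D) (?f -` A \<inter> space (seq_meas D \<Otimes>\<^sub>M seq_meas D))"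
    by (rule emeasure_distr[OF m A'])
  also have "\<dots> = (\<integral>\<^sup>+\<omega>. emeasure (seq_meas D) {\<omega>'. comb_seq n \<omega> \<omega>' \<in> A} \<partial>seq_meas D)"
    by (subst sigma_finite_measure.emeasure_pair_measure_alt[OF prob_space_imp_sigma_finite[OF prob_space_seq_meas] measurable_sets[OF m A']])
       (simp add: space_pair_measure vimage_def)
  finally show ?thesis .
qed

lemma psum_comb_seq:
  "(\<Sum>i<n + k. comb_seq n \<omega> \<omega>' i) = (\<Sum>i<n. \<omega> i) + (\<Sum>i<k. \<omega>' i :: 'a::comm_monoid_add)"
proof (induction k)
  case 0
  show ?case by (auto intro!: sum.cong simp: comb_seq_less)
next
  case (Suc k)
  then show ?case by (simp add: comb_seq_def ac_simps)
qed

lemma psum_comb_seq_le: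
  "k \<le> n \<Longrightarrow> (\<Sum>i<k. comb_seq n \<omega> \<omega>' i) = (\<Sum>i<k. \<omega> i :: 'a::comm_monoid_add)"
  by (intro sum.cong) (auto simp: comb_seq_less)

lemma measurable_seq_nth [measurable]: "(\<lambda>\<omega>. \<omega> n) \<in> measurable seq_alg (count_space UNIV)"
  by (rule measurable_component_singleton) auto

lemma distr_seq_nth: "distr (seq_meas D) (count_space UNIV) (\<lambda>\<omega>. \<omega> n) = measure_pmf D"
proof -
  have "distr (seq_meas D) (count_space UNIV) (\<lambda>\<omega>. \<omega> n) = distr (seq_meas D) (measure_pmf D) (\<lambda>\<omega>. \<omega> n)"
    by (rule distr_cong) auto
  also have "\<dots> = measure_pmf D" unfolding seq_meas_def by (intro product_prob_space.PiM_component[OF product_prob_space_pmf]) auto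
  finally show ?thesis .
qed

lemma emeasure_seq_nth: "emeasure (seq_meas D) {\<omega>. P (\<omega> n)} = emeasure (measure_pmf D) {x. P x}"
  unfolding distr_seq_nth[of D n, symmetric] by (subst emeasure_distr) (auto simp: vimage_def)

lemma distr_seq_psum:
  fixes D :: "'a::{countable,ab_group_add} pmf"
  shows "distr (seq_meas D) (count_space UNIV) (\<lambda>\<omega>. \<Sum>i<n. \<omega> i) = measure_pmf (walk_pmf D n)"
proof (induction n)
  case 0
  show ?case using prob_space.emeasure_space_1[OF prob_space_seq_meas[of D]]
    by (intro measure_eqI) (auto simp: emeasure_distr indicator_def)
next
  case (Suc n)
  have m: "(\<lambda>\<omega>. \<Sum>i<n. \<omega> i) \<in> measurable (seq_meas D) (count_space (UNIV :: 'a set))" for n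
    by measurable
  show ?case
  proof (rule measure_eqI)
    fix A :: "'a set"
    have mA: "{\<omega>. (\<Sum>i<Suc n. \<omega> i) \<in> A} \<in> sets seq_alg"
      using measurable_sets[OF measurable_partial_sum[of "Suc n"], of A] by (simp add: vimage_def space_PiM)
    have "emeasure (distr (seq_meas D) (count_space UNIV) (\<lambda>\<omega>. \<Sum>i<Suc n. \<omega> i)) A
        = emeasure (seq_meas D) {\<omega>. (\<Sum>i<Suc n. \<omega> i) \<in> A}"
      by (subst emeasure_distr[OF m]) (auto simp: vimage_def)
    also have "\<dots> = (\<integral>\<^sup>+\<omega>. emeasure (seq_meas D) {\<omega>'. (\<Sum>i<n. \<omega> i) + \<omega>' 0 \<in> A} \<partial>seq_meas D)"
      by (subst emeasure_seq_split[OF mA, of D n])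
         (simp add: psum_comb_seq_le comb_seq_add[of n _ _ 0, simplified])
    also have "\<dots> = (\<integral>\<^sup>+\<omega>. emeasure (measure_pmf D) {y. (\<Sum>i<n. \<omega> i) + y \<in> A} \<partial>seq_meas D)"
    proof (intro nn_integral_cong)
      fix \<omega> :: "nat \<Rightarrow> 'a"
      show "emeasure (seq_meas D) {\<omega>'. (\<Sum>i<n. \<omega> i) + \<omega>' 0 \<in> A} = emeasure (measure_pmf D) {y. (\<Sum>i<n. \<omega> i) + y \<in> A}"
        by (rule emeasure_seq_nth)
    qed
    also have "\<dots> = (\<integral>\<^sup>+x. emeasure (measure_pmf D) {y. x + y \<in> A} \<partial>walk_pmf D n)"
      by (subst Suc[symmetric], subst nn_integral_distr[OF m]) auto
    finally show "emeasure (distr (seq_meas D) (count_space UNIV) (\<lambda>\<omega>. \<Sum>i<Suc n. \<omega> i)) A =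
        emeasure (walk_pmf D (Suc n)) A"
      by (simp add: vimage_def)
  qed simp
qed

lemma emeasure_seq_psum:
  fixes D :: "'a::{countable,ab_group_add} pmf"
  shows "emeasure (seq_meas D) {\<omega>. P (\<Sum>i<n. \<omega> i)} = emeasure (walk_pmf D n) {x. P x}"
  unfolding distr_seq_psum[symmetric] by (subst emeasure_distr) (auto simp: vimage_def)

lemma emeasure_seq_psum_step:
  fixes D :: "'a::{countable,ab_group_add} pmf"
  shows "emeasure (seq_meas D) {\<omega>. P (\<Sum>i<n. \<omega> i) (\<omega> n)} = emeasure (pair_pmf (walk_pmf D n) D) {(x, y). P x y}"
proof -
  have m: "{\<omega>. P (\<Sum>i<n. \<omega> i) (\<omega> n)} \<in> sets seq_alg"
    using measurable_sets[OF measurable_countable_fun2[OF measurable_partial_sum[of n] measurable_seq_nth[of n], of P], of "{True}"]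
    by (simp add: vimage_def space_PiM)
  have "emeasure (seq_meas D) {\<omega>. P (\<Sum>i<n. \<omega> i) (\<omega> n)} =
      (\<integral>\<^sup>+\<omega>. emeasure (seq_meas D) {\<omega>'. P (\<Sum>i<n. \<omega> i) (\<omega>' 0)} \<partial>seq_meas D)"
    by (subst emeasure_seq_split[OF m, of D n])
       (simp add: psum_comb_seq_le comb_seq_add[of n _ _ 0, simplified])
  also have "\<dots> = (\<integral>\<^sup>+\<omega>. emeasure (measure_pmf D) {y. P (\<Sum>i<n. \<omega> i) y} \<partial>seq_meas D)"
  proof (intro nn_integral_cong)
    fix \<omega> :: "nat \<Rightarrow> 'a"
    show "emeasure (seq_meas D) {\<omega>'. P (\<Sum>i<n. \<omega> i) (\<omega>' 0)} = emeasure (measure_pmf D) {y. P (\<Sum>i<n. \<omega> i) y}"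
      by (rule emeasure_seq_nth)
  qed
  also have "\<dots> = (\<integral>\<^sup>+x. emeasure (measure_pmf D) {y. P x y} \<partial>walk_pmf D n)"
    by (subst distr_seq_psum[symmetric], subst nn_integral_distr) auto
  finally show ?thesis by (simp add: emeasure_pair_pmf)
qed

lemma distr_seq_zip:
  fixes p :: "'a::countable pmf" and q :: "'b::countable pmf"
  shows "distr (seq_meas p \<Otimes>\<^sub>M seq_meas q) seq_alg (\<lambda>(x, y) n. (x n, y n)) = seq_meas (pair_pmf p q)"
proof (rule seq_meas_eqI)
  fix J :: "nat set" and F :: "nat \<Rightarrow> ('a \<times> 'b) set"
  assume J: "finite J"
  let ?f = "\<lambda>(x, y) n. (x n, y n)"
  have m: "?f \<in> measurable (seq_meas p \<Otimes>\<^sub>M seq_meas q) seq_alg"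
  proof (rule measurable_PiM_single')
    fix n
    have 1: "(\<lambda>z. fst z n) \<in> measurable (seq_meas p \<Otimes>\<^sub>M seq_meas q) (count_space UNIV)"
      by (rule measurable_compose[OF measurable_fst]) measurable
    have 2: "(\<lambda>z. snd z n) \<in> measurable (seq_meas p \<Otimes>\<^sub>M seq_meas q) (count_space UNIV)"
      by (rule measurable_compose[OF measurable_snd]) measurable
    show "(\<lambda>z. (case z of (x, y) \<Rightarrow> \<lambda>n. (x n, y n)) n) \<in> measurable (seq_meas p \<Otimes>\<^sub>M seq_meas q) (count_space UNIV)"
      using measurable_countable_fun2[OF 1 2, of Pair] by (simp add: split_beta')
  qed (auto simp: space_PiM)
  let ?B = "{\<omega>. \<forall>j\<in>J. \<omega> j \<in> F j}"
  have "emeasure (distr (seq_meas p \<Otimes>\<^sub>M seq_meas q) seq_alg ?f) ?B =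
      emeasure (seq_meas p \<Otimes>\<^sub>M seq_meas q) (?f -` ?B \<inter> space (seq_meas p \<Otimes>\<^sub>M seq_meas q))"
    by (rule emeasure_distr[OF m sets_seq_box[OF J]])
  also have "\<dots> = (\<integral>\<^sup>+x. emeasure (seq_meas q) {y. \<forall>j\<in>J. y j \<in> {b. (x j, b) \<in> F j}} \<partial>seq_meas p)"
    by (subst sigma_finite_measure.emeasure_pair_measure_alt[OF prob_space_imp_sigma_finite[OF prob_space_seq_meas] measurable_sets[OF m sets_seq_box[OF J]]])
       (simp add: space_pair_measure vimage_def)
  also have "\<dots> = (\<integral>\<^sup>+x. (\<Prod>j\<in>J. emeasure (measure_pmf q) {b. (x j, b) \<in> F j}) \<partial>seq_meas p)"
    by (subst emeasure_seq_box[OF J]) simp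
  also have "\<dots> = (\<Prod>j\<in>J. \<integral>\<^sup>+a. emeasure (measure_pmf q) {b. (a, b) \<in> F j} \<partial>p)"
    by (rule nn_integral_seq_prod[OF J])
  finally show "emeasure (distr (seq_meas p \<Otimes>\<^sub>M seq_meas q) seq_alg ?f) ?B = (\<Prod>j\<in>J. emeasure (pair_pmf p q) (F j))"
    by (simp add: emeasure_pair_pmf)
qed simp

section \<open>From a walk to its sequence of jumps\<close>

lemma jump_distr_pmf:
  assumes "random_walk M S"
  shows "\<exists>p. jump_distr M S = measure_pmf p"
proof -
  interpret prob_space M using assms by (simp add: random_walk_def)
  have rv: "(\<lambda>\<omega>. S (Suc n) \<omega> - S n \<omega>) \<in> measurable M (count_space UNIV)" for n
    using assms by (auto simp: random_walk_def indep_vars_def)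
  interpret J: prob_space "jump_distr M S"
    unfolding jump_distr_def using rv[of 0] by (intro prob_space_distr) simp
  have "sets (jump_distr M S) = UNIV" by (simp add: jump_distr_def)
  moreover have "AE x in jump_distr M S. measure (jump_distr M S) {x} \<noteq> 0"
  proof (rule J.AE_support_countable[THEN iffD2])
    show "sets (jump_distr M S) = UNIV" by (simp add: jump_distr_def)
  qed (auto intro!: exI[of _ UNIV])
  ultimately have "measure_pmf (Abs_pmf (jump_distr M S)) = jump_distr M S"
    by (intro Abs_pmf_inverse) (auto intro: J.prob_space_axioms)
  then show ?thesis by metis
qed

lemma distr_jumps:
  assumes S: "random_walk M S" and p: "jump_distr M S = measure_pmf p"
  shows "distr M seq_alg (\<lambda>\<omega> n. S (Suc n) \<omega> - S n \<omega>) = seq_meas p"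
proof -
  interpret prob_space M using S by (simp add: random_walk_def)
  have ind: "indep_vars (\<lambda>_. count_space UNIV) (\<lambda>n \<omega>. S (Suc n) \<omega> - S n \<omega>) UNIV"
    using S by (simp add: random_walk_def)
  have rv: "(\<lambda>\<omega>. S (Suc n) \<omega> - S n \<omega>) \<in> measurable M (count_space UNIV)" for n
    using ind by (auto simp: indep_vars_def)
  have "distr M seq_alg (\<lambda>\<omega> n. S (Suc n) \<omega> - S n \<omega>) =
      PiM UNIV (\<lambda>n. distr M (count_space UNIV) (\<lambda>\<omega>. S (Suc n) \<omega> - S n \<omega>))"
    using indep_vars_iff_distr_eq_PiM[of UNIV "\<lambda>n \<omega>. S (Suc n) \<omega> - S n \<omega>" "\<lambda>_. count_space UNIV"] ind rv
    by (simp add: restrict_def)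
  also have "\<dots> = seq_meas p"
    using S p by (simp add: random_walk_def seq_meas_def)
  finally show ?thesis .
qed

text \<open>Each jump sequence is a measurable function of its whole path, so independence of the
  two processes gives independence of the two jump sequences. From here on every event is computed
  on the canonical space of pairs of jumps.\<close>

lemma distr_joint_jumps:
  assumes M: "prob_space M" and H: "random_walk M H" and V: "random_walk M V" and ind: "indep_walks M H V"
    and p: "jump_distr M H = measure_pmf p" and q: "jump_distr M V = measure_pmf q"
  shows "(\<lambda>\<omega> n. (H (Suc n) \<omega> - H n \<omega>, V (Suc n) \<omega> - V n \<omega>)) \<in> measurable M seq_alg"
    and "distr M seq_alg (\<lambda>\<omega> n. (H (Suc n) \<omega> - H n \<omega>, V (Suc n) \<omega> - V n \<omega>)) = seq_meas (pair_pmf p q)"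
proof -
  interpret prob_space M by fact
  let ?J = "\<lambda>(x :: nat \<Rightarrow> int) n. x (Suc n) - x n"
  have mJ: "?J \<in> measurable seq_alg seq_alg"
    by (rule measurable_PiM_single') (auto simp: space_PiM intro!: measurable_countable_fun2)
  have "indep_var seq_alg (?J \<circ> (\<lambda>\<omega> n. H n \<omega>)) seq_alg (?J \<circ> (\<lambda>\<omega> n. V n \<omega>))"
    using ind unfolding indep_walks_def by (rule indep_var_compose) (rule mJ)+
  then have ind': "indep_var seq_alg (\<lambda>\<omega> n. H (Suc n) \<omega> - H n \<omega>) seq_alg (\<lambda>\<omega> n. V (Suc n) \<omega> - V n \<omega>)"
    by (simp add: o_def)
  let ?X = "\<lambda>\<omega> n. H (Suc n) \<omega> - H n \<omega>" and ?Y = "\<lambda>\<omega> n. V (Suc n) \<omega> - V n \<omega>"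
  have mX: "?X \<in> measurable M seq_alg" and mY: "?Y \<in> measurable M seq_alg"
    and joint: "distr M seq_alg ?X \<Otimes>\<^sub>M distr M seq_alg ?Y = distr M (seq_alg \<Otimes>\<^sub>M seq_alg) (\<lambda>\<omega>. (?X \<omega>, ?Y \<omega>))"
    using ind' unfolding indep_var_distribution_eq by auto
  show mZ: "(\<lambda>\<omega> n. (?X \<omega> n, ?Y \<omega> n)) \<in> measurable M seq_alg"
  proof (rule measurable_PiM_single')
    fix n
    have "(\<lambda>\<omega>. ?X \<omega> n) \<in> measurable M (count_space UNIV)" "(\<lambda>\<omega>. ?Y \<omega> n) \<in> measurable M (count_space UNIV)"
      using measurable_compose[OF mX measurable_seq_nth[of n]] measurable_compose[OF mY measurable_seq_nth[of n]] by auto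
    then show "(\<lambda>\<omega>. (?X \<omega> n, ?Y \<omega> n)) \<in> measurable M (count_space UNIV)"
      by (rule measurable_countable_fun2)
  qed (auto simp: space_PiM)
  let ?f = "\<lambda>(x, y) n. (x n :: int, y n :: int)"
  have m: "?f \<in> measurable (seq_alg \<Otimes>\<^sub>M seq_alg) seq_alg"
  proof (rule measurable_PiM_single')
    fix n
    have 1: "(\<lambda>z. fst z n :: int) \<in> measurable (seq_alg \<Otimes>\<^sub>M seq_alg) (count_space UNIV)"
      by (rule measurable_compose[OF measurable_fst measurable_seq_nth])
    have 2: "(\<lambda>z. snd z n :: int) \<in> measurable (seq_alg \<Otimes>\<^sub>M seq_alg) (count_space UNIV)"
      by (rule measurable_compose[OF measurable_snd measurable_seq_nth])
    show "(\<lambda>z. ?f z n) \<in> measurable (seq_alg \<Otimes>\<^sub>M seq_alg) (count_space UNIV)"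
      using measurable_countable_fun2[OF 1 2, of Pair] by (simp add: split_beta')
  qed (auto simp: space_PiM)
  have "seq_meas (pair_pmf p q) = distr (distr M seq_alg ?X \<Otimes>\<^sub>M distr M seq_alg ?Y) seq_alg ?f"
    by (simp only: distr_seq_zip[symmetric] distr_jumps[OF H p] distr_jumps[OF V q])
  also have "\<dots> = distr M seq_alg (\<lambda>\<omega> n. (?X \<omega> n, ?Y \<omega> n))"
    unfolding joint
    by (subst distr_distr[OF m]) (auto simp: o_def intro!: measurable_Pair mX mY)
  finally show "distr M seq_alg (\<lambda>\<omega> n. (?X \<omega> n, ?Y \<omega> n)) = seq_meas (pair_pmf p q)" ..
qed

section \<open>A second moment argument and a zero-one law\<close>

text \<open>Quasi-independence bounds the second moment of the count by \<open>w * s^2\<close>.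
  Instead of the Cauchy-Schwarz inequality, a pointwise bound is integrated: outside
  \<open>B\<close> the count is less than \<open>s / 2\<close>, and on \<open>B\<close> it is at
  most \<open>(l * (X x)^2 + 1 / l) / 2\<close>.\<close>

lemma (in prob_space) paley_zygmund_count:
  fixes A :: "nat \<Rightarrow> 'a set"
  assumes A [measurable]: "\<And>n. A n \<in> events" and C: "C \<ge> 0"
    and quasi: "\<And>j k. j < k \<Longrightarrow> prob (A j \<inter> A k) \<le> C * prob (A j) * prob (A (k - Suc j))"
    and s: "(\<Sum>i<n. prob (A i)) \<ge> 1"
  shows "prob {x \<in> space M. (\<Sum>i<n. indicator (A i) x) \<ge> (\<Sum>i<n. prob (A i)) / 2} \<ge> 1 / (4 * (1 + 2 * C))"
proof -
  define s where "s = (\<Sum>i<n. prob (A i))"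
  define X :: "'a \<Rightarrow> real" where "X x = (\<Sum>i<n. indicator (A i) x)" for x
  define B where "B = {x \<in> space M. X x \<ge> s / 2}"
  define w where "w = 1 + 2 * C"
  have w: "w > 0" using C by (simp add: w_def)
  \<comment> \<open>With this \<open>l\<close> the second moment contributes \<open>s / 4\<close>.
    Together with the \<open>s / 2\<close> from outside \<open>B\<close> this leaves
    \<open>s / 4\<close> to be carried by \<open>B\<close>, whose contribution is
    \<open>prob B * w * s\<close>.\<close>
  define l where "l = 1 / (2 * w * s)"
  have s1: "s \<ge> 1" using s by (simp add: s_def)
  have l: "l > 0" using s1 w by (simp add: l_def)
  have Xm [measurable]: "X \<in> borel_measurable M" unfolding X_def by measurable
  have Bm [measurable]: "B \<in> events" unfolding B_def by measurable
  have X0: "X x \<ge> 0" for x unfolding X_def by (intro sum_nonneg) auto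
  have XE: "expectation X = s" and Xi: "integrable M X"
    unfolding X_def s_def by (auto intro!: Bochner_Integration.integral_sum Bochner_Integration.integrable_sum simp: less_top[symmetric])
  have X2: "(X x)^2 = (\<Sum>i<n. \<Sum>j<n. indicator (A i \<inter> A j) x)" for x
    by (simp add: X_def power2_eq_square sum_product indicator_inter_arith)
  have X2i: "integrable M (\<lambda>x. (X x)^2)"
    unfolding X2 by (intro Bochner_Integration.integrable_sum) (auto simp: less_top[symmetric])
  \<comment> \<open>The hypothesis pairs \<open>A i\<close> with \<open>A (j - Suc i)\<close> rather
    than with \<open>A j\<close>, but for fixed \<open>i\<close> these are distinct summands of
    \<open>s\<close>, so the mixed terms still sum to at most \<open>s\<close> for each
    \<open>i\<close>.\<close>
  have a_le: "(\<Sum>j<n. of_bool (i < j) * prob (A (j - Suc i))) \<le> s" for i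
  proof -
    have "(\<Sum>j<n. of_bool (i < j) * prob (A (j - Suc i))) = (\<Sum>j\<in>{i<..<n}. prob (A (j - Suc i)))"
      by (intro sum.mono_neutral_cong_right) auto
    also have "\<dots> = (\<Sum>m\<in>(\<lambda>j. j - Suc i) ` {i<..<n}. prob (A m))"
      by (subst sum.reindex) (auto simp: inj_on_def)
    also have "\<dots> \<le> s" unfolding s_def by (intro sum_mono2) auto
    finally show ?thesis .
  qed
  have E2: "expectation (\<lambda>x. (X x)^2) = (\<Sum>i<n. \<Sum>j<n. prob (A i \<inter> A j))"
    unfolding X2 by (subst Bochner_Integration.integral_sum Bochner_Integration.integrable_sum,
        auto intro!: Bochner_Integration.integrable_sum simp: less_top[symmetric])
  also have "\<dots> \<le> (\<Sum>i<n. \<Sum>j<n. of_bool (i = j) * prob (A i)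
      + C * prob (A i) * (of_bool (i < j) * prob (A (j - Suc i)))
      + C * prob (A j) * (of_bool (j < i) * prob (A (i - Suc j))))"
  proof (intro sum_mono)
    fix i j
    show "prob (A i \<inter> A j) \<le> of_bool (i = j) * prob (A i)
      + C * prob (A i) * (of_bool (i < j) * prob (A (j - Suc i)))
      + C * prob (A j) * (of_bool (j < i) * prob (A (i - Suc j)))"
      using quasi[of i j] quasi[of j i] by (cases i j rule: linorder_cases) (auto simp: Int_commute)
  qed
  also have "\<dots> = s + (\<Sum>i<n. C * prob (A i) * (\<Sum>j<n. of_bool (i < j) * prob (A (j - Suc i))))
      + (\<Sum>j<n. C * prob (A j) * (\<Sum>i<n. of_bool (j < i) * prob (A (i - Suc j))))"
  proof -
    have "(\<Sum>i<n. \<Sum>j<n. of_bool (i = j) * prob (A i)) = s"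
      unfolding s_def by (intro sum.cong) (auto simp: of_bool_def if_distrib if_distribR sum.If_cases Int_def Collect_conv_if cong: if_cong)
    moreover have "(\<Sum>i<n. \<Sum>j<n. C * prob (A j) * (of_bool (j < i) * prob (A (i - Suc j)))) =
       (\<Sum>j<n. \<Sum>i<n. C * prob (A j) * (of_bool (j < i) * prob (A (i - Suc j))))"
      by (rule sum.swap)
    ultimately show ?thesis by (simp only: sum.distrib sum_distrib_left)
  qed
  also have "\<dots> \<le> s + (\<Sum>i<n. C * prob (A i) * s) + (\<Sum>i<n. C * prob (A i) * s)"
    using C by (intro add_mono order_refl sum_mono mult_left_mono a_le) auto
  also have "\<dots> = s + 2 * C * s^2"
    unfolding s_def by (simp add: sum_distrib_left[symmetric] sum_distrib_right[symmetric] power2_eq_square)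
  also have "\<dots> \<le> w * s^2"
    using s1 by (simp add: w_def distrib_right power2_eq_square)
  finally have E2le: "expectation (\<lambda>x. (X x)^2) \<le> w * s^2" .
  have "s \<le> expectation (\<lambda>x. s / 2 + (l * (X x)^2 / 2 + indicator B x * (1 / l / 2)))"
    unfolding XE[symmetric]
  proof (intro integral_mono)
    fix x assume x: "x \<in> space M"
    have amgm: "2 * X x \<le> l * (X x)^2 + 1 / l"
    proof -
      have "0 \<le> (sqrt l * X x - 1 / sqrt l)^2" by simp
      also have "\<dots> = l * (X x)^2 + 1 / l - 2 * X x"
        using l by (simp add: power2_diff power_mult_distrib power_divide)
      finally show ?thesis by simp
    qed
    show "X x \<le> expectation X / 2 + (l * (X x)^2 / 2 + indicator B x * (1 / l / 2))"
    proof (cases "x \<in> B")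
      case True
      then show ?thesis using amgm s1 by (simp add: XE)
    next
      case False
      moreover have "0 \<le> l * (X x)^2 / 2" using l by simp
      ultimately show ?thesis using x by (simp add: B_def XE)
    qed
  qed (use Xi X2i in \<open>auto simp: less_top[symmetric] simp del: times_divide_eq_right intro!: Bochner_Integration.integrable_add\<close>)
  also have "\<dots> = s / 2 + (l * expectation (\<lambda>x. (X x)^2) / 2 + prob B * (1 / l / 2))"
    using X2i by (simp add: less_top[symmetric] prob_space)
  also have "\<dots> \<le> s / 2 + (l * (w * s^2) / 2 + prob B * (1 / l / 2))"
    using l by (intro add_mono order_refl divide_right_mono mult_left_mono E2le) auto
  also have "l * (w * s^2) / 2 = s / 4"
    using s1 w by (simp add: l_def power2_eq_square)
  also have "prob B * (1 / l / 2) = prob B * w * s"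
    using s1 w by (simp add: l_def)
  finally have "s * (1 / 4) \<le> s * (prob B * w)" by (simp add: mult.commute mult.left_commute)
  then have "1 / 4 \<le> prob B * w" using s1 by simp
  then have "1 / (4 * (1 + 2 * C)) \<le> prob B"
    using w unfolding w_def[symmetric] by (simp add: divide_simps ac_simps)
  then show ?thesis by (simp add: B_def X_def s_def)
qed

text \<open>Let \<open>G m\<close> be the event that the count never exceeds \<open>m\<close>. Once
  \<open>s n\<close> exceeds \<open>2 * m + 1\<close>, the count at \<open>n\<close> is larger than
  \<open>m\<close> with probability at least \<open>c\<close>, so
  \<open>prob (G m) \<le> 1 - c\<close>. As \<open>c\<close> does not depend on \<open>m\<close>,
  the bound passes to the increasing union, which contains every outcome with finitely many
  events.\<close>

lemma (in prob_space) kochen_stone: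
  fixes A :: "nat \<Rightarrow> 'a set"
  assumes A [measurable]: "\<And>n. A n \<in> events" and C: "C \<ge> 0"
    and quasi: "\<And>j k. j < k \<Longrightarrow> prob (A j \<inter> A k) \<le> C * prob (A j) * prob (A (k - Suc j))"
    and div: "\<not> summable (\<lambda>n. prob (A n))"
  shows "prob {x \<in> space M. \<exists>\<^sub>\<infinity>n. x \<in> A n} > 0"
proof -
  define s where "s n = (\<Sum>i<n. prob (A i))" for n
  define X :: "nat \<Rightarrow> 'a \<Rightarrow> real" where "X n x = (\<Sum>i<n. indicator (A i) x)" for n x
  define c where "c = 1 / (4 * (1 + 2 * C))"
  have c: "c > 0" using C by (simp add: c_def)
  define G where "G m = {x \<in> space M. \<forall>n. X n x \<le> real m}" for m :: nat
  have Gm [measurable]: "G m \<in> events" for m unfolding G_def X_def by measurable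
  have unb: "\<exists>n. s n > K" for K
  proof (rule ccontr)
    assume "\<not> ?thesis"
    then have "\<And>n. (\<Sum>i<n. norm (prob (A i))) \<le> K" by (auto simp: s_def not_less)
    then have "summable (\<lambda>n. norm (prob (A n)))" by (intro bounded_imp_summable[of _ K]) (auto simp: lessThan_Suc_atMost[symmetric] simp del: sum.lessThan_Suc)
    with div show False by simp
  qed
  have Gle: "prob (G m) \<le> 1 - c" for m
  proof -
    obtain n where n: "s n > 2 * real m + 1" using unb by blast
    have "prob {x \<in> space M. X n x \<ge> s n / 2} \<ge> c"
      unfolding X_def s_def c_def using n by (intro paley_zygmund_count assms) (auto simp: s_def)
    moreover have "prob {x \<in> space M. X n x \<ge> s n / 2} \<le> prob (space M - G m)"
    proof (intro finite_measure_mono)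
      show "{x \<in> space M. X n x \<ge> s n / 2} \<subseteq> space M - G m"
      proof clarsimp
        fix x assume "x \<in> G m" "s n \<le> X n x * 2"
        then have "X n x \<le> m" by (simp add: G_def)
        then show False using n \<open>s n \<le> X n x * 2\<close> by simp
      qed
    qed auto
    ultimately show ?thesis using prob_compl[of "G m"] by simp
  qed
  have "incseq G" 
  proof (rule incseq_SucI, rule subsetI)
    fix m x assume "x \<in> G m"
    then have "x \<in> space M" and x: "X n x \<le> real m" for n by (auto simp: G_def)
    moreover have "X n x \<le> real (Suc m)" for n using x[of n] by simp
    ultimately show "x \<in> G (Suc m)" by (simp add: G_def)
  qed
  then have "(\<lambda>m. prob (G m)) \<longlonglongrightarrow> prob (\<Union>m. G m)"
    by (intro finite_Lim_measure_incseq) auto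
  then have U: "prob (\<Union>m. G m) \<le> 1 - c"
    by (rule LIMSEQ_le_const2) (use Gle in auto)
  have Im [measurable]: "{x \<in> space M. \<exists>\<^sub>\<infinity>n. x \<in> A n} \<in> events"
    unfolding INFM_nat by measurable
  have "space M - {x \<in> space M. \<exists>\<^sub>\<infinity>n. x \<in> A n} \<subseteq> (\<Union>m. G m)"
  proof
    fix x assume "x \<in> space M - {x \<in> space M. \<exists>\<^sub>\<infinity>n. x \<in> A n}"
    then have x: "x \<in> space M" and fin: "finite {n. x \<in> A n}"
      by (auto simp: frequently_cofinite)
    have "X n x \<le> real (card {n. x \<in> A n})" for n
    proof -
      have "X n x = real (card {i. i < n \<and> x \<in> A i})"
        by (simp add: X_def indicator_def sum.If_cases Int_def)
      also have "\<dots> \<le> real (card {n. x \<in> A n})"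
        using fin by (intro of_nat_mono card_mono) auto
      finally show ?thesis .
    qed
    then show "x \<in> (\<Union>m. G m)" using x by (auto simp: G_def)
  qed
  then have "prob (space M - {x \<in> space M. \<exists>\<^sub>\<infinity>n. x \<in> A n}) \<le> prob (\<Union>m. G m)"
    by (intro finite_measure_mono) auto
  also note U
  finally show ?thesis using prob_compl[OF Im] c by simp
qed

section \<open>Exchangeable events\<close>

text \<open>Exchanging the first \<open>N\<close> coordinates with the next \<open>N\<close> makes
  an event on the first coordinates independent of its image once \<open>N\<close> is large, yet
  leaves all partial sums from \<open>2 * N\<close> on unchanged.\<close>

definition block_swap :: "nat \<Rightarrow> nat \<Rightarrow> nat" where
  "block_swap N n = (if n < N then n + N else if n < 2 * N then n - N else n)"

lemma block_swap_involution [simp]: "block_swap N (block_swap N n) = n"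
  by (auto simp: block_swap_def)

lemma inj_block_swap: "inj (block_swap N)"
  by (metis block_swap_involution injI)

definition swap_seq :: "nat \<Rightarrow> (nat \<Rightarrow> 'a) \<Rightarrow> nat \<Rightarrow> 'a" where
  "swap_seq N \<omega> = (\<lambda>n. \<omega> (block_swap N n))"

lemma swap_seq_swap_seq [simp]: "swap_seq N (swap_seq N \<omega>) = \<omega>"
  by (simp add: swap_seq_def)

lemma psum_swap_seq:
  assumes "n \<ge> 2 * N"
  shows "(\<Sum>i<n. swap_seq N \<omega> i) = (\<Sum>i<n. \<omega> i :: 'a::comm_monoid_add)"
  unfolding swap_seq_def
proof (rule sum.reindex_bij_betw)
  show "bij_betw (block_swap N) {..<n} {..<n}"
    by (rule bij_betwI[where g = "block_swap N"]) (use assms in \<open>auto simp: block_swap_def\<close>)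
qed

lemma measurable_swap_seq [measurable]: "swap_seq N \<in> measurable seq_alg seq_alg"
  by (rule measurable_PiM_single') (auto simp: swap_seq_def space_PiM)

lemma distr_swap_seq: "distr (seq_meas D) seq_alg (swap_seq N) = seq_meas D"
proof (rule seq_meas_eqI)
  fix J :: "nat set" and F :: "nat \<Rightarrow> 'a set" assume J: "finite J"
  have "swap_seq N -` {\<omega>. \<forall>j\<in>J. \<omega> j \<in> F j} = {\<omega>. \<forall>j\<in>block_swap N ` J. \<omega> j \<in> F (block_swap N j)}"
    by (auto simp: swap_seq_def)
  then have "emeasure (distr (seq_meas D) seq_alg (swap_seq N)) {\<omega>. \<forall>j\<in>J. \<omega> j \<in> F j} =
      emeasure (seq_meas D) {\<omega>. \<forall>j\<in>block_swap N ` J. \<omega> j \<in> F (block_swap N j)}"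
    using J by (subst emeasure_distr) (simp_all only: space_seq_meas Int_UNIV_right measurable_swap_seq sets_seq_box measurable_cong_sets[OF sets_seq_meas refl])
  also have "\<dots> = (\<Prod>j\<in>block_swap N ` J. emeasure (measure_pmf D) (F (block_swap N j)))"
    using J by (intro emeasure_seq_box) auto
  also have "\<dots> = (\<Prod>j\<in>J. emeasure (measure_pmf D) (F j))"
    by (subst prod.reindex) (auto intro: inj_on_subset[OF inj_block_swap])
  finally show "emeasure (distr (seq_meas D) seq_alg (swap_seq N)) {\<omega>. \<forall>j\<in>J. \<omega> j \<in> F j} = \<dots>" .
qed simp

lemma measure_swap_seq:
  assumes "A \<in> sets seq_alg"
  shows "measure (seq_meas D) (swap_seq N -` A) = measure (seq_meas D) A"
  using assms by (subst (2) distr_swap_seq[symmetric, of _ N], subst measure_distr) auto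

text \<open>Asymptotic independence of \<open>A\<close> from swapped copies of \<open>B\<close>. As
  a limit it survives complements and disjoint unions in \<open>B\<close>, which exact independence
  for large \<open>N\<close> would not.\<close>

definition mixes :: "'a pmf \<Rightarrow> (nat \<Rightarrow> 'a) set \<Rightarrow> (nat \<Rightarrow> 'a) set \<Rightarrow> bool" where
  "mixes D A B \<longleftrightarrow> (\<lambda>N. measure (seq_meas D) (A \<inter> swap_seq N -` B)) \<longlonglongrightarrow> measure (seq_meas D) A * measure (seq_meas D) B"

lemma swap_seq_vimage_sets:
  "A \<in> sets seq_alg \<Longrightarrow> swap_seq N -` A \<in> sets (seq_meas D)"
  using measurable_sets[OF measurable_swap_seq, of A N] by (simp add: sets_seq_meas space_PiM)

lemma mixes_commute:
  assumes A: "A \<in> sets seq_alg" and B: "B \<in> sets seq_alg" and AB: "mixes D A B"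
  shows "mixes D B A"
proof -
  have "measure (seq_meas D) (B \<inter> swap_seq N -` A) = measure (seq_meas D) (A \<inter> swap_seq N -` B)" for N
  proof -
    have "swap_seq N -` (A \<inter> swap_seq N -` B) = B \<inter> swap_seq N -` A" by auto
    moreover have "A \<inter> swap_seq N -` B \<in> sets seq_alg"
      using A swap_seq_vimage_sets[OF B, of N D] by (simp add: sets_seq_meas)
    ultimately show ?thesis using measure_swap_seq[of "A \<inter> swap_seq N -` B" D N] by simp
  qed
  then show ?thesis using AB by (simp add: mixes_def mult.commute)
qed

text \<open>Once \<open>N\<close> exceeds all indices involved, the two boxes constrain disjoint
  sets of coordinates, and the sequence is eventually constant.\<close>

lemma mixes_boxes:
  assumes J: "finite J" and K: "finite K"
  shows "mixes D {\<omega>. \<forall>j\<in>J. \<omega> j \<in> F j} {\<omega>. \<forall>j\<in>K. \<omega> j \<in> G j}"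
proof -
  let ?A = "{\<omega>. \<forall>j\<in>J. \<omega> j \<in> F j}" and ?B = "{\<omega>. \<forall>j\<in>K. \<omega> j \<in> G j}"
  obtain m where m: "\<forall>j\<in>J \<union> K. j < m"
    using finite_nat_set_iff_bounded[of "J \<union> K"] J K by auto
  have "measure (seq_meas D) (?A \<inter> swap_seq N -` ?B) = measure (seq_meas D) ?A * measure (seq_meas D) ?B" if N: "N \<ge> m" for N
  proof -
    have K_lt: "k < N" if "k \<in> K" for k using m N that by (meson UnI2 order_less_le_trans)
    have J_lt: "j < N" if "j \<in> J" for j using m N that by (meson UnI1 order_less_le_trans)
    have disj: "J \<inter> (\<lambda>k. k + N) ` K = {}" using J_lt by fastforce
    define L where "L j = (if j < N then F j else G (j - N))" for j
    have "?A \<inter> swap_seq N -` ?B = {\<omega>. (\<forall>j\<in>J. \<omega> j \<in> L j) \<and> (\<forall>k\<in>K. \<omega> (k + N) \<in> L (k + N))}"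
      using K_lt J_lt by (auto simp: swap_seq_def block_swap_def L_def)
    also have "\<dots> = {\<omega>. \<forall>j\<in>J \<union> (\<lambda>k. k + N) ` K. \<omega> j \<in> L j}"
      by auto
    finally have "emeasure (seq_meas D) (?A \<inter> swap_seq N -` ?B) =
        (\<Prod>j\<in>J \<union> (\<lambda>k. k + N) ` K. emeasure (measure_pmf D) (L j))"
      using J K by (simp only: emeasure_seq_box finite_UnI finite_imageI)
    also have "\<dots> = (\<Prod>j\<in>J. emeasure (measure_pmf D) (L j)) * (\<Prod>j\<in>(\<lambda>k. k + N) ` K. emeasure (measure_pmf D) (L j))"
      using J K disj by (intro prod.union_disjoint) auto
    also have "(\<Prod>j\<in>(\<lambda>k. k + N) ` K. emeasure (measure_pmf D) (L j)) = (\<Prod>k\<in>K. emeasure (measure_pmf D) (G k))"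
      by (subst prod.reindex) (auto simp: inj_on_def L_def)
    also have "(\<Prod>j\<in>J. emeasure (measure_pmf D) (L j)) = (\<Prod>j\<in>J. emeasure (measure_pmf D) (F j))"
      using J_lt by (intro prod.cong) (auto simp: L_def)
    finally have "emeasure (seq_meas D) (?A \<inter> swap_seq N -` ?B) = emeasure (seq_meas D) ?A * emeasure (seq_meas D) ?B"
      using J K by (simp add: emeasure_seq_box)
    then show ?thesis by (simp add: measure_def enn2real_mult)
  qed
  then show ?thesis unfolding mixes_def
    by (intro tendsto_eventually) (auto simp: eventually_at_top_linorder)
qed

text \<open>Boxes are stable under intersection, so the sets \<open>B\<close> mixing with
  \<open>A\<close> only have to be closed under complements and disjoint unions. In a union the
  limit passes through the sum by Tannery's theorem: swaps preserve the measure, so the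
  \<open>i\<close>-th term is dominated by the measure of \<open>X i\<close>.\<close>

lemma mixes_generate:
  assumes A: "A \<in> sets seq_alg"
    and box: "\<And>J F. finite J \<Longrightarrow> mixes D A {\<omega>. \<forall>j\<in>J. \<omega> j \<in> F j}"
    and B: "B \<in> sets seq_alg"
  shows "mixes D A B"
proof -
  interpret prob_space "seq_meas D" by (rule prob_space_seq_meas)
  let ?alg = "prod_algebra UNIV (\<lambda>_::nat. count_space (UNIV :: 'a set))"
  note vi = swap_seq_vimage_sets[where D = D]
  have A' [simp]: "A \<in> events" using A by (simp add: sets_seq_meas)
  have sets: "sets (seq_alg :: (nat \<Rightarrow> 'a) measure) = sigma_sets UNIV ?alg"
    by (simp add: sets_PiM)
  have "B \<in> sigma_sets UNIV ?alg" using B by (simp add: sets)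
  from Int_stable_prod_algebra subset_UNIV[of ?alg, folded Pow_UNIV] this show ?thesis
  proof (induction rule: sigma_sets_induct_disjoint)
    case (basic X)
    then obtain J E where "X = prod_emb UNIV (\<lambda>_::nat. count_space (UNIV :: 'a set)) J (\<Pi>\<^sub>E j\<in>J. E j)" "finite J"
      by (rule prod_algebraE)
    moreover from this have "X = {\<omega>. \<forall>j\<in>J. \<omega> j \<in> E j}"
      by (auto simp: prod_emb_def PiE_iff)
    ultimately show ?case using box[of J E] by simp
  next
    case empty show ?case by (simp add: mixes_def)
  next
    case (compl X)
    then have X: "X \<in> sets seq_alg" by (simp only: sets)
    have "measure (seq_meas D) (A \<inter> swap_seq N -` (UNIV - X)) = measure (seq_meas D) A - measure (seq_meas D) (A \<inter> swap_seq N -` X)" for N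
    proof -
      have "A \<inter> swap_seq N -` (UNIV - X) = A - (A \<inter> swap_seq N -` X)" by auto
      then show ?thesis using vi[OF X, of N] by (simp only:) (subst finite_measure_Diff, auto)
    qed
    moreover have "measure (seq_meas D) (UNIV - X) = 1 - measure (seq_meas D) X"
      using prob_compl[of X] X by (simp add: sets_seq_meas)
    moreover have "(\<lambda>N. measure (seq_meas D) A - measure (seq_meas D) (A \<inter> swap_seq N -` X)) \<longlonglongrightarrow>
        measure (seq_meas D) A - measure (seq_meas D) A * measure (seq_meas D) X"
      using compl.IH unfolding mixes_def by (intro tendsto_intros)
    ultimately show ?case by (simp add: mixes_def right_diff_distrib)
  next
    case (union X)
    have X: "X i \<in> sets seq_alg" for i using union(2) by (auto simp: sets)
    have X' [simp]: "X i \<in> events" for i using X by (simp add: sets_seq_meas)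
    have sum: "(\<lambda>i. measure (seq_meas D) (X i)) sums measure (seq_meas D) (\<Union>i. X i)"
      using union(1) by (intro finite_measure_UNION) auto
    have sum_N: "(\<lambda>i. measure (seq_meas D) (A \<inter> swap_seq N -` X i)) sums measure (seq_meas D) (\<Union>i. A \<inter> swap_seq N -` X i)" for N
      using union(1) vi[OF X] by (intro finite_measure_UNION) (fastforce simp: disjoint_family_on_def)+
    have eq: "measure (seq_meas D) (A \<inter> swap_seq N -` (\<Union>i. X i)) = (\<Sum>i. measure (seq_meas D) (A \<inter> swap_seq N -` X i))" for N
    proof -
      have "A \<inter> swap_seq N -` (\<Union>i. X i) = (\<Union>i. A \<inter> swap_seq N -` X i)" by auto
      then show ?thesis using sums_unique[OF sum_N] by simp
    qed
    have "(\<lambda>N. \<Sum>i. measure (seq_meas D) (A \<inter> swap_seq N -` X i)) \<longlonglongrightarrow> (\<Sum>i. measure (seq_meas D) A * measure (seq_meas D) (X i))"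
    proof (rule tannerys_theorem[THEN conjunct2, THEN conjunct2])
      show "(\<lambda>N. measure (seq_meas D) (A \<inter> swap_seq N -` X i)) \<longlonglongrightarrow> measure (seq_meas D) A * measure (seq_meas D) (X i)" for i
        using union(3)[of i] by (simp add: mixes_def)
      have "norm (measure (seq_meas D) (A \<inter> swap_seq N -` X i)) \<le> measure (seq_meas D) (X i)" for N i
      proof -
        have "measure (seq_meas D) (A \<inter> swap_seq N -` X i) \<le> measure (seq_meas D) (swap_seq N -` X i)"
          using vi[OF X] by (intro finite_measure_mono) auto
        then show ?thesis by (simp add: measure_swap_seq[OF X])
      qed
      then show "\<forall>\<^sub>F (k, n) in sequentially \<times>\<^sub>F sequentially. norm (measure (seq_meas D) (A \<inter> swap_seq n -` X k)) \<le> measure (seq_meas D) (X k)"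
        by (intro always_eventually) auto
      show "summable (\<lambda>i. measure (seq_meas D) (X i))" using sum by (rule sums_summable)
    qed simp
    moreover have "(\<Sum>i. measure (seq_meas D) A * measure (seq_meas D) (X i)) = measure (seq_meas D) A * measure (seq_meas D) (\<Union>i. X i)"
      using sums_mult[OF sum, of "measure (seq_meas D) A"] by (simp add: sums_iff)
    ultimately show ?case by (simp add: mixes_def eq)
  qed
qed

text \<open>Extending from boxes in one argument, commuting, and extending in the other gives
  \<open>mixes D E E\<close>. Invariance makes the left side constant, so the probability of
  \<open>E\<close> equals its own square.\<close>

lemma hewitt_savage_seq:
  assumes E: "E \<in> sets seq_alg" and inv: "\<And>N. swap_seq N -` E = E"
  shows "measure (seq_meas D) E = 0 \<or> measure (seq_meas D) E = 1"
proof -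
  have box_sets: "finite J \<Longrightarrow> {\<omega>. \<forall>j\<in>J. \<omega> j \<in> F j} \<in> sets seq_alg" for J and F :: "nat \<Rightarrow> 'a set"
    by (rule sets_seq_box)
  have "mixes D {\<omega>. \<forall>j\<in>J. \<omega> j \<in> F j} E" if "finite J" for J F
    using that by (intro mixes_generate[OF box_sets mixes_boxes E])
  then have "mixes D E {\<omega>. \<forall>j\<in>J. \<omega> j \<in> F j}" if "finite J" for J F
    using that by (intro mixes_commute[OF box_sets E]) auto
  then have "mixes D E E" by (intro mixes_generate[OF E _ E])
  then have "(\<lambda>N::nat. measure (seq_meas D) E) \<longlonglongrightarrow> measure (seq_meas D) E * measure (seq_meas D) E"
    by (simp add: mixes_def inv)
  then have "measure (seq_meas D) E = measure (seq_meas D) E * measure (seq_meas D) E"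
    by (simp add: tendsto_const_iff)
  then show ?thesis by simp
qed

section \<open>Crossings and returns\<close>

text \<open>Decomposition at the last visit to 0: \<open>B n\<close> says that this visit happens at
  time \<open>n\<close>. These events are disjoint, and by the Markov property \<open>B n\<close>
  has the return probability at \<open>n\<close> times the escape probability \<open>e > 0\<close>,
  so the return probabilities sum to at most \<open>1 / e\<close>.\<close>

lemma transient_green_finite:
  fixes D :: "'a::{countable,ab_group_add} pmf"
  assumes tr: "measure (seq_meas D) {\<omega>. \<exists>n\<ge>1. (\<Sum>i<n. \<omega> i) = 0} < 1"
  shows "(\<Sum>n. ennreal (pmf (walk_pmf D n) 0)) < \<infinity>"
proof -
  interpret prob_space "seq_meas D" by (rule prob_space_seq_meas)
  have ms [measurable]: "(\<lambda>\<omega>. \<Sum>i<n. \<omega> i) \<in> measurable (seq_meas D) (count_space UNIV)" for n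
    by measurable
  define E where "E = {\<omega>::nat \<Rightarrow> 'a. \<forall>m\<ge>1. (\<Sum>i<m. \<omega> i) \<noteq> 0}"
  define e where "e = emeasure (seq_meas D) E"
  define B where "B n = {\<omega>::nat \<Rightarrow> 'a. (\<Sum>i<n. \<omega> i) = 0 \<and> (\<forall>m\<ge>1. (\<Sum>i<n + m. \<omega> i) \<noteq> 0)}" for n
  have mE: "{\<omega>\<in>space (seq_meas D). \<exists>n\<ge>1. (\<Sum>i<n. \<omega> i) = 0} \<in> sets (seq_meas D)"
    by measurable
  have E_eq: "E = space (seq_meas D) - {\<omega>\<in>space (seq_meas D). \<exists>n\<ge>1. (\<Sum>i<n. \<omega> i) = 0}"
    by (auto simp: E_def)
  have e: "e > 0"
  proof -
    have "prob E > 0" unfolding E_eq using prob_compl[OF mE] tr by simp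
    then show ?thesis unfolding e_def by (simp add: emeasure_eq_measure)
  qed
  have mB: "B n \<in> sets (seq_meas D)" for n
  proof -
    have "{\<omega>\<in>space (seq_meas D). (\<Sum>i<n. \<omega> i) = 0 \<and> (\<forall>m\<ge>1. (\<Sum>i<n + m. \<omega> i) \<noteq> 0)} \<in> sets (seq_meas D)"
      by measurable
    then show ?thesis by (simp add: B_def)
  qed
  have eB: "emeasure (seq_meas D) (B n) = ennreal (pmf (walk_pmf D n) 0) * e" for n
  proof -
    have "emeasure (seq_meas D) (B n) = (\<integral>\<^sup>+\<omega>. emeasure (seq_meas D) {\<omega>'. comb_seq n \<omega> \<omega>' \<in> B n} \<partial>seq_meas D)"
      using mB by (intro emeasure_seq_split) (simp add: sets_seq_meas)
    also have "\<dots> = (\<integral>\<^sup>+\<omega>. e * indicator {\<omega>. (\<Sum>i<n. \<omega> i) = 0} \<omega> \<partial>seq_meas D)"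
      by (intro nn_integral_cong)
         (auto simp: B_def psum_comb_seq psum_comb_seq_le e_def E_def indicator_def)
    also have "\<dots> = e * emeasure (seq_meas D) {\<omega>. (\<Sum>i<n. \<omega> i) = 0}"
      using measurable_sets[OF ms[of n], of "{0}"] by (intro nn_integral_cmult_indicator) (simp add: vimage_def)
    also have "emeasure (seq_meas D) {\<omega>. (\<Sum>i<n. \<omega> i) = 0} = ennreal (pmf (walk_pmf D n) 0)"
      by (subst emeasure_seq_psum) (simp add: emeasure_pmf_single[symmetric])
    finally show ?thesis by (simp add: mult.commute)
  qed
  have disj: "disjoint_family B"
  proof (unfold disjoint_family_on_def, intro ballI impI, rule ccontr)
    fix i j :: nat assume "i \<noteq> j" "B i \<inter> B j \<noteq> {}"
    then obtain \<omega> a b where ab: "a < b" "\<omega> \<in> B a" "\<omega> \<in> B b"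
      by (cases i j rule: linorder_cases) blast+
    then have "\<forall>m\<ge>1. (\<Sum>i<a + m. \<omega> i) \<noteq> 0" "(\<Sum>i<b. \<omega> i) = 0" by (auto simp: B_def)
    moreover have "1 \<le> b - a" using ab by simp
    ultimately have "(\<Sum>i<a + (b - a). \<omega> i) \<noteq> 0" by blast
    with \<open>(\<Sum>i<b. \<omega> i) = 0\<close> show False using ab by simp
  qed
  have "(\<Sum>n. ennreal (pmf (walk_pmf D n) 0)) * e = (\<Sum>n. emeasure (seq_meas D) (B n))"
    by (simp add: eB)
  also have "\<dots> = emeasure (seq_meas D) (\<Union>n. B n)"
    using mB disj by (intro suminf_emeasure) auto
  also have "\<dots> \<le> 1" by (rule emeasure_le_1)
  finally have "(\<Sum>n. ennreal (pmf (walk_pmf D n) 0)) * e < top"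
    by (rule le_less_trans) simp
  with e show ?thesis by (auto simp: ennreal_mult_less_top)
qed

lemma emeasure_pair_pair_pmf:
  "emeasure (pair_pmf (pair_pmf A B) (pair_pmf C E)) {((a, b), (x, y)). P a x \<and> Q b y} =
    emeasure (pair_pmf A C) {(a, x). P a x} * emeasure (pair_pmf B E) {(b, y). Q b y}"
proof -
  have ind: "emeasure (pair_pmf C E) {(x, y). P' x \<and> Q' y} = emeasure (measure_pmf C) {x. P' x} * emeasure (measure_pmf E) {y. Q' y}"
    for P' Q'
  proof -
    have "emeasure (pair_pmf C E) {(x, y). P' x \<and> Q' y} = (\<integral>\<^sup>+x. emeasure (measure_pmf E) {y. Q' y} * indicator {x. P' x} x \<partial>C)"
      unfolding emeasure_pair_pmf by (intro nn_integral_cong) (auto simp: indicator_def)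
    then show ?thesis by (simp add: nn_integral_cmult nn_integral_multc mult.commute)
  qed
  have "emeasure (pair_pmf (pair_pmf A B) (pair_pmf C E)) {((a, b), (x, y)). P a x \<and> Q b y} =
     (\<integral>\<^sup>+z. emeasure (pair_pmf C E) {(x, y). P (fst z) x \<and> Q (snd z) y} \<partial>pair_pmf A B)"
    by (subst emeasure_pair_pmf) (auto intro!: nn_integral_cong arg_cong2[where f = emeasure])
  also have "\<dots> = (\<integral>\<^sup>+a. \<integral>\<^sup>+b. emeasure (measure_pmf C) {x. P a x} * emeasure (measure_pmf E) {y. Q b y} \<partial>B \<partial>A)"
    unfolding ind nn_integral_pair_pmf' by simp
  also have "\<dots> = emeasure (pair_pmf A C) {(a, x). P a x} * emeasure (pair_pmf B E) {(b, y). Q b y}"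
    by (simp add: emeasure_pair_pmf nn_integral_cmult nn_integral_multc)
  finally show ?thesis .
qed

lemma emeasure_return_and_step:
  fixes p q :: "int pmf"
  shows "emeasure (seq_meas (pair_pmf p q))
      {\<omega>. fst (\<Sum>i<n. \<omega> i) + fst (\<omega> n) = 0 \<and> Q (snd (\<Sum>i<n. \<omega> i)) (snd (\<omega> n))} =
    ennreal (pmf (walk_pmf p (Suc n)) 0) * emeasure (pair_pmf (walk_pmf q n) q) {(v, x). Q v x}"
proof -
  have "emeasure (seq_meas (pair_pmf p q))
      {\<omega>. fst (\<Sum>i<n. \<omega> i) + fst (\<omega> n) = 0 \<and> Q (snd (\<Sum>i<n. \<omega> i)) (snd (\<omega> n))} =
    emeasure (pair_pmf (pair_pmf (walk_pmf p n) (walk_pmf q n)) (pair_pmf p q)) {((a, b), (x, y)). a + x = 0 \<and> Q b y}"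
    using emeasure_seq_psum_step[of "pair_pmf p q" "\<lambda>s z. fst s + fst z = 0 \<and> Q (snd s) (snd z)" n]
    unfolding walk_pmf_pair by (simp add: split_beta')
  also have "\<dots> = emeasure (pair_pmf (walk_pmf p n) p) {(a, x). a + x = 0} * emeasure (pair_pmf (walk_pmf q n) q) {(v, x). Q v x}"
    by (rule emeasure_pair_pair_pmf)
  also have "emeasure (pair_pmf (walk_pmf p n) p) {(a, x). a + x = 0} = ennreal (pmf (walk_pmf p (Suc n)) 0)"
    by (simp add: emeasure_pair_pmf emeasure_pmf_single[symmetric] vimage_def)
  finally show ?thesis .
qed

section \<open>Crossing events and their recurrence\<close>

definition cross_event :: "nat \<Rightarrow> (nat \<Rightarrow> int \<times> int) set" where
  "cross_event n = {\<omega>. fst (\<Sum>i<Suc n. \<omega> i) = 0 \<and> snd (\<Sum>i<n. \<omega> i) * snd (\<Sum>i<Suc n. \<omega> i) \<le> 0}"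

lemma measurable_psum_fst [measurable]:
  "(\<lambda>\<omega> :: nat \<Rightarrow> int \<times> int. fst (\<Sum>i<n. \<omega> i)) \<in> measurable seq_alg (count_space (UNIV :: int set))"
  "(\<lambda>\<omega> :: nat \<Rightarrow> int \<times> int. snd (\<Sum>i<n. \<omega> i)) \<in> measurable seq_alg (count_space (UNIV :: int set))"
  using measurable_compose[OF measurable_partial_sum[of n], of fst "count_space (UNIV :: int set)"]
    measurable_compose[OF measurable_partial_sum[of n], of snd "count_space (UNIV :: int set)"] by simp_all

lemma sets_cross_event [measurable]: "cross_event n \<in> sets seq_alg"
proof -
  have 1: "(\<lambda>\<omega> :: nat \<Rightarrow> int \<times> int. (fst (\<Sum>i<Suc n. \<omega> i) :: int) = 0) \<in> measurable seq_alg (count_space UNIV)"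
    by (rule measurable_compose[OF measurable_psum_fst(1)]) simp
  have 2: "(\<lambda>\<omega> :: nat \<Rightarrow> int \<times> int. (snd (\<Sum>i<n. \<omega> i) :: int) * snd (\<Sum>i<Suc n. \<omega> i) \<le> 0) \<in> measurable seq_alg (count_space UNIV)"
    by (rule measurable_countable_fun2[OF measurable_psum_fst(2) measurable_psum_fst(2), of "\<lambda>a b. a * b \<le> 0"])
  have "{\<omega> \<in> space (seq_alg :: (nat \<Rightarrow> int \<times> int) measure). fst (\<Sum>i<Suc n. \<omega> i) = (0::int) \<and> snd (\<Sum>i<n. \<omega> i) * snd (\<Sum>i<Suc n. \<omega> i) \<le> (0::int)} \<in> sets seq_alg"
    using 1 2 by (intro sets.sets_Collect_conj) (simp_all add: pred_def)
  then show ?thesis by (simp add: cross_event_def space_PiM)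
qed

lemma emeasure_cross_event:
  "emeasure (seq_meas (pair_pmf p q)) (cross_event n) =
    ennreal (pmf (walk_pmf p (Suc n)) 0) * emeasure (pair_pmf (walk_pmf q n) q) {(v, x). v * (v + x) \<le> 0}"
  using emeasure_return_and_step[of p q n "\<lambda>v x. v * (v + x) \<le> 0"] by (simp add: cross_event_def)

lemma crossing_imp_abs_le:
  fixes v x :: int
  assumes "v * (v + x) \<le> 0" shows "\<bar>v\<bar> \<le> \<bar>x\<bar>"
  using assms by (auto simp: mult_le_0_iff)

text \<open>Reflecting the jump turns \<open>0 \<le> v \<and> v \<le> x\<close> into
  \<open>0 \<le> v \<and> v \<le> - x\<close>, on which the vertical walk changes sign or touches
  zero.\<close>

lemma emeasure_cross_event_ge:
  assumes sym: "map_pmf uminus q = q"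
  shows "ennreal (pmf (walk_pmf p (Suc n)) 0) * pos_cross q n \<le> emeasure (seq_meas (pair_pmf p q)) (cross_event n)"
proof -
  have "pos_cross q n = emeasure (pair_pmf (walk_pmf q n) q) {(v, x). 0 \<le> v \<and> v \<le> - x}"
    unfolding pos_cross_def
    using pair_pmf_uminus(2)[OF walk_pmf_uminus[OF sym, of n] sym, of "\<lambda>v x. 0 \<le> v \<and> v \<le> x"] by simp
  also have "\<dots> \<le> emeasure (pair_pmf (walk_pmf q n) q) {(v, x). v * (v + x) \<le> 0}"
    by (intro emeasure_mono) (auto simp: mult_le_0_iff)
  finally show ?thesis unfolding emeasure_cross_event by (intro mult_left_mono) auto
qed

lemma emeasure_cross_event_le:
  assumes sym: "map_pmf uminus q = q"
  shows "emeasure (seq_meas (pair_pmf p q)) (cross_event n) \<le> 4 * (ennreal (pmf (walk_pmf p (Suc n)) 0) * pos_cross q n)"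
proof -
  have "emeasure (pair_pmf (walk_pmf q n) q) {(v, x). v * (v + x) \<le> 0} \<le> cross q n"
    unfolding cross_alt by (intro emeasure_mono) (auto dest: crossing_imp_abs_le)
  also have "\<dots> \<le> 4 * pos_cross q n" by (rule cross_le_pos_cross[OF sym])
  finally have "emeasure (pair_pmf (walk_pmf q n) q) {(v, x). v * (v + x) \<le> 0} \<le> 4 * pos_cross q n" .
  from mult_left_mono[OF this, of "ennreal (pmf (walk_pmf p (Suc n)) 0)"] show ?thesis
    unfolding emeasure_cross_event by (simp add: mult.left_commute)
qed

text \<open>Restarting at time \<open>j + 1\<close>, where the vertical coordinate \<open>v\<close> is arbitrary, makes later
  crossings at most a constant factor more likely than restarting at the origin.\<close>

lemma emeasure_cross_event_Int:
  assumes sym: "map_pmf uminus q = q" and jk: "j < k"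
  shows "emeasure (seq_meas (pair_pmf p q)) (cross_event j \<inter> cross_event k)
    \<le> 64 * (emeasure (seq_meas (pair_pmf p q)) (cross_event j) * emeasure (seq_meas (pair_pmf p q)) (cross_event (k - Suc j)))"
proof -
  let ?S = "seq_meas (pair_pmf p q)"
  define m where "m = k - Suc j"
  have k: "k = Suc j + m" using jk by (simp add: m_def)
  \<comment> \<open>64 is 16 for starting the crossing at an arbitrary height times 4 for passing
    from \<open>cross\<close> to \<open>pos_cross\<close>, which bounds the crossing event from
    below.\<close>
  define c where "c = 64 * emeasure ?S (cross_event m)"
  have A: "cross_event j \<inter> cross_event k \<in> sets seq_alg" by measurable
  have Jset: "cross_event j \<in> sets ?S" by (simp add: sets_seq_meas)
  have inner: "emeasure ?S {\<omega>'. comb_seq (Suc j) \<omega> \<omega>' \<in> cross_event j \<inter> cross_event k} \<le> c * indicator (cross_event j) \<omega>" for \<omega>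
  proof (cases "\<omega> \<in> cross_event j")
    case False
    have "comb_seq (Suc j) \<omega> \<omega>' \<notin> cross_event j" for \<omega>'
      using False psum_comb_seq_le[of "Suc j" "Suc j" \<omega> \<omega>'] psum_comb_seq_le[of j "Suc j" \<omega> \<omega>']
      by (simp add: cross_event_def)
    then show ?thesis by simp
  next
    case True
    define v where "v = snd (\<Sum>i<Suc j. \<omega> i)"
    have f0: "fst (\<Sum>i<Suc j. \<omega> i) = 0" using True by (simp add: cross_event_def)
    have "{\<omega>'. comb_seq (Suc j) \<omega> \<omega>' \<in> cross_event j \<inter> cross_event k} \<subseteq>
       {\<omega>'. fst (\<Sum>i<m. \<omega>' i) + fst (\<omega>' m) = 0 \<and> \<bar>v + snd (\<Sum>i<m. \<omega>' i)\<bar> \<le> \<bar>snd (\<omega>' m)\<bar>}"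
    proof clarify
      fix \<omega>' assume "comb_seq (Suc j) \<omega> \<omega>' \<in> cross_event k"
      then have "fst (\<Sum>i<Suc j + Suc m. comb_seq (Suc j) \<omega> \<omega>' i) = 0"
        "snd (\<Sum>i<Suc j + m. comb_seq (Suc j) \<omega> \<omega>' i) * snd (\<Sum>i<Suc j + Suc m. comb_seq (Suc j) \<omega> \<omega>' i) \<le> 0"
        by (simp_all add: cross_event_def k)
      moreover have "(\<Sum>i<Suc m. \<omega>' i) = (\<Sum>i<m. \<omega>' i) + \<omega>' m" by simp
      ultimately have "fst (\<Sum>i<m. \<omega>' i) + fst (\<omega>' m) = 0"
        and "(v + snd (\<Sum>i<m. \<omega>' i)) * ((v + snd (\<Sum>i<m. \<omega>' i)) + snd (\<omega>' m)) \<le> 0"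
        unfolding psum_comb_seq fst_add snd_add f0 v_def[symmetric] by (simp_all add: add.assoc)
      then show "fst (\<Sum>i<m. \<omega>' i) + fst (\<omega>' m) = 0 \<and> \<bar>v + snd (\<Sum>i<m. \<omega>' i)\<bar> \<le> \<bar>snd (\<omega>' m)\<bar>"
        by (auto dest: crossing_imp_abs_le)
    qed
    moreover have msets: "{\<omega>'. fst (\<Sum>i<m. \<omega>' i) + fst (\<omega>' m) = 0 \<and> \<bar>v + snd (\<Sum>i<m. \<omega>' i)\<bar> \<le> \<bar>snd (\<omega>' m)\<bar>} \<in> sets ?S"
    proof -
      have "(\<lambda>\<omega>'. fst (\<Sum>i<m. \<omega>' i) + fst (\<omega>' m) = (0::int) \<and> \<bar>v + snd (\<Sum>i<m. \<omega>' i)\<bar> \<le> \<bar>snd (\<omega>' m)\<bar>) \<in> measurable seq_alg (count_space UNIV)"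
        by (rule measurable_countable_fun2[OF measurable_partial_sum[of m] measurable_seq_nth[of m],
            of "\<lambda>s z. fst s + fst z = 0 \<and> \<bar>v + snd s\<bar> \<le> \<bar>snd z\<bar>"])
      from measurable_sets[OF this, of "{True}"] show ?thesis by (simp add: vimage_def sets_seq_meas space_PiM)
    qed
    ultimately have "emeasure ?S {\<omega>'. comb_seq (Suc j) \<omega> \<omega>' \<in> cross_event j \<inter> cross_event k} \<le>
        emeasure ?S {\<omega>'. fst (\<Sum>i<m. \<omega>' i) + fst (\<omega>' m) = 0 \<and> \<bar>v + snd (\<Sum>i<m. \<omega>' i)\<bar> \<le> \<bar>snd (\<omega>' m)\<bar>}"
      by (rule emeasure_mono)
    also have "\<dots> = ennreal (pmf (walk_pmf p (Suc m)) 0) * emeasure (pair_pmf (walk_pmf q m) q) {(w, x). \<bar>v + w\<bar> \<le> \<bar>x\<bar>}"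
      by (rule emeasure_return_and_step)
    also have "emeasure (pair_pmf (walk_pmf q m) q) {(w, x). \<bar>v + w\<bar> \<le> \<bar>x\<bar>} =
        (\<integral>\<^sup>+x. emeasure (walk_pmf q m) {w. \<bar>v + w\<bar> \<le> \<bar>x\<bar>} \<partial>q)"
      by (subst pair_commute_pmf) (simp add: vimage_def split_beta' emeasure_pair_pmf)
    also have "\<dots> \<le> 16 * cross q m"
      using crossing_from_anywhere[OF sym, of m 0 v] by simp
    also have "\<dots> \<le> 16 * (4 * pos_cross q m)"
      by (intro mult_left_mono cross_le_pos_cross sym) auto
    also have "\<dots> = 64 * pos_cross q m" by (simp add: mult.assoc[symmetric])
    also have "ennreal (pmf (walk_pmf p (Suc m)) 0) * (64 * pos_cross q m) \<le> c"
      unfolding c_def using emeasure_cross_event_ge[OF sym, of p m] by (simp add: mult.left_commute mult_left_mono)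
    finally show ?thesis using True by (simp add: mult_left_mono)
  qed
  have "emeasure ?S (cross_event j \<inter> cross_event k) = (\<integral>\<^sup>+\<omega>. emeasure ?S {\<omega>'. comb_seq (Suc j) \<omega> \<omega>' \<in> cross_event j \<inter> cross_event k} \<partial>?S)"
    by (rule emeasure_seq_split[OF A])
  also have "\<dots> \<le> (\<integral>\<^sup>+\<omega>. c * indicator (cross_event j) \<omega> \<partial>?S)"
    by (intro nn_integral_mono inner)
  also have "\<dots> = c * emeasure ?S (cross_event j)"
    by (rule nn_integral_cmult_indicator[OF Jset])
  finally show ?thesis by (simp add: c_def m_def ac_simps)
qed

lemma cross_event_io_iff:
  assumes sym: "map_pmf uminus q = q"
  shows "measure (seq_meas (pair_pmf p q)) {\<omega>. \<exists>\<^sub>\<infinity>n. \<omega> \<in> cross_event n} = 1 \<longleftrightarrow>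
    (\<Sum>n. ennreal (pmf (walk_pmf p (Suc n)) 0) * pos_cross q n) = \<infinity>"
proof -
  let ?S = "seq_meas (pair_pmf p q)"
  interpret prob_space ?S by (rule prob_space_seq_meas)
  let ?E = "{\<omega>. \<exists>\<^sub>\<infinity>n. \<omega> \<in> cross_event n}"
  let ?a = "\<lambda>n. ennreal (pmf (walk_pmf p (Suc n)) 0) * pos_cross q n"
  have ms [measurable]: "cross_event n \<in> events" for n by (simp add: sets_seq_meas)
  have mE: "?E \<in> events"
  proof -
    have "{\<omega> \<in> space ?S. \<exists>\<^sub>\<infinity>n. \<omega> \<in> cross_event n} \<in> events" unfolding INFM_nat by measurable
    then show ?thesis by simp
  qed
  show ?thesis
  proof
    assume E1: "measure ?S ?E = 1"
    show "(\<Sum>n. ?a n) = \<infinity>"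
    proof (rule ccontr)
      assume "(\<Sum>n. ?a n) \<noteq> \<infinity>"
      have "(\<Sum>n. emeasure ?S (cross_event n)) \<le> 4 * (\<Sum>n. ?a n)"
        by (intro suminf_ennreal_le_cmult emeasure_cross_event_le sym)
      also have "\<dots> < top" using \<open>(\<Sum>n. ?a n) \<noteq> \<infinity>\<close> by (simp add: ennreal_mult_less_top less_top)
      finally have "(\<Sum>n. emeasure ?S (cross_event n)) < \<infinity>" by simp
      then have "summable (\<lambda>n. measure ?S (cross_event n))"
        by (intro summable_suminf_not_top) (auto simp: emeasure_eq_measure)
      then have "AE \<omega> in ?S. eventually (\<lambda>n. \<omega> \<in> space ?S - cross_event n) sequentially"
        by (intro borel_cantelli_AE1) (auto simp: less_top[symmetric])
      then have "AE \<omega> in ?S. \<not> \<omega> \<in> ?E"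
        by (auto simp: frequently_def cofinite_eq_sequentially)
      then have "measure ?S ?E = 0"
        using mE by (subst (asm) AE_iff_measurable[of ?E]) (auto simp: measure_def)
      with E1 show False by simp
    qed
  next
    assume inf: "(\<Sum>n. ?a n) = \<infinity>"
    have "(\<Sum>n. ?a n) \<le> (\<Sum>n. emeasure ?S (cross_event n))"
      by (intro suminf_le emeasure_cross_event_ge sym) auto
    then have "(\<Sum>n. ennreal (prob (cross_event n))) = \<infinity>"
      using inf by (simp add: emeasure_eq_measure top_unique)
    then have ns: "\<not> summable (\<lambda>n. prob (cross_event n))"
      using suminf_ennreal2[of "\<lambda>n. prob (cross_event n)"] by auto
    have q: "prob (cross_event j \<inter> cross_event k) \<le> 64 * prob (cross_event j) * prob (cross_event (k - Suc j))"
      if "j < k" for j k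
      using emeasure_cross_event_Int[OF sym that, of p]
      by (simp add: emeasure_eq_measure ennreal_mult'[symmetric] mult.assoc ennreal_numeral[symmetric] del: ennreal_numeral)
    have pos: "measure ?S ?E > 0"
      using kochen_stone[of cross_event 64, OF ms _ q ns] by simp
    \<comment> \<open>The swap alters only the first \<open>2 * N\<close> coordinates and preserves
      their sum, so it changes at most finitely many crossing events.\<close>
    have inv: "swap_seq N -` ?E = ?E" for N
    proof -
      have "(\<exists>\<^sub>\<infinity>n. swap_seq N \<omega> \<in> cross_event n) \<longleftrightarrow> (\<exists>\<^sub>\<infinity>n. \<omega> \<in> cross_event n)" for \<omega>
      proof (rule frequently_cong)
        show "eventually (\<lambda>n. n \<ge> 2 * N) (cofinite :: nat filter)"
          by (simp add: cofinite_eq_sequentially eventually_ge_at_top)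
        show "swap_seq N \<omega> \<in> cross_event n \<longleftrightarrow> \<omega> \<in> cross_event n" if "n \<ge> 2 * N" for n
          using that by (simp add: cross_event_def psum_swap_seq del: sum.lessThan_Suc)
      qed
      then show ?thesis by auto
    qed
    show "measure ?S ?E = 1"
      using hewitt_savage_seq[of ?E "pair_pmf p q", OF _ inv] mE pos by (auto simp: sets_seq_meas)
  qed
qed

section \<open>Characteristic functions\<close>

definition pmf_char :: "int pmf \<Rightarrow> real \<Rightarrow> complex" where
  "pmf_char p = char (distr (measure_pmf p) borel real_of_int)"

lemma pmf_char_alt: "pmf_char p t = (\<integral>x. iexp (t * real_of_int x) \<partial>measure_pmf p)"
  unfolding pmf_char_def char_def by (subst integral_distr) auto

lemma real_distribution_int_pmf: "real_distribution (distr (measure_pmf p) borel real_of_int)"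
proof -
  interpret prob_space "distr (measure_pmf p) borel real_of_int"
    by (rule measure_pmf.prob_space_distr) simp
  show ?thesis by unfold_locales auto
qed

lemma norm_pmf_char_le: "norm (pmf_char p t) \<le> 1"
  unfolding pmf_char_def by (rule real_distribution.cmod_char_le_1[OF real_distribution_int_pmf])

lemma continuous_on_pmf_char: "continuous_on A (pmf_char p)"
  unfolding pmf_char_def
  by (intro continuous_at_imp_continuous_on ballI real_distribution.isCont_char real_distribution_int_pmf)

lemma measurable_pmf_char [measurable]: "pmf_char p \<in> borel_measurable borel"
  by (intro borel_measurable_continuous_onI continuous_on_pmf_char)

lemma integrable_iexp_pmf: "integrable (measure_pmf p) (\<lambda>x. iexp (t * real_of_int x))"
  by (intro measure_pmf.integrable_const_bound[of _ 1]) (auto simp: norm_exp_i_times)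

lemma Re_iexp: "Re (iexp x) = cos x" and Im_iexp: "Im (iexp x) = sin x"
  by (simp_all flip: cis_conv_exp)

lemma Re_pmf_char: "Re (pmf_char p t) = (\<integral>x. cos (t * real_of_int x) \<partial>measure_pmf p)"
  and Im_pmf_char: "Im (pmf_char p t) = (\<integral>x. sin (t * real_of_int x) \<partial>measure_pmf p)"
proof -
  show "Re (pmf_char p t) = (\<integral>x. cos (t * real_of_int x) \<partial>measure_pmf p)"
    unfolding pmf_char_alt using integral_Re[OF integrable_iexp_pmf[of p t]] by (simp only: Re_iexp)
  show "Im (pmf_char p t) = (\<integral>x. sin (t * real_of_int x) \<partial>measure_pmf p)"
    unfolding pmf_char_alt using integral_Im[OF integrable_iexp_pmf[of p t]] by (simp only: Im_iexp)
qed

lemma measure_pair_pmf_eq: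
  fixes p :: "'a::countable pmf" and q :: "'b::countable pmf"
  shows "measure_pmf (pair_pmf p q) = measure_pmf p \<Otimes>\<^sub>M measure_pmf q"
proof (rule measure_eqI)
  have "sets (measure_pmf p \<Otimes>\<^sub>M measure_pmf q) = sets (count_space UNIV \<Otimes>\<^sub>M count_space UNIV)"
    by (intro sets_pair_measure_cong) auto
  also have "\<dots> = UNIV"
    by (subst pair_measure_countable) auto
  finally have s: "sets (measure_pmf p \<Otimes>\<^sub>M measure_pmf q) = UNIV" .
  then show "sets (measure_pmf (pair_pmf p q)) = sets (measure_pmf p \<Otimes>\<^sub>M measure_pmf q)" by simp
  fix A show "emeasure (measure_pmf (pair_pmf p q)) A = emeasure (measure_pmf p \<Otimes>\<^sub>M measure_pmf q) A"
    by (subst measure_pmf.emeasure_pair_measure_alt) (auto simp: s emeasure_pair_pmf vimage_def)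
qed

lemma pmf_char_add:
  "pmf_char (bind_pmf p (\<lambda>x. map_pmf ((+) x) q)) t = pmf_char p t * pmf_char q t"
proof -
  interpret pair_sigma_finite "measure_pmf p" "measure_pmf q" ..
  have "bind_pmf p (\<lambda>x. map_pmf ((+) x) q) = map_pmf (\<lambda>(x, y). x + y) (pair_pmf p q)"
    by (simp add: pair_pmf_def map_bind_pmf map_pmf_def bind_assoc_pmf bind_return_pmf)
  then have "pmf_char (bind_pmf p (\<lambda>x. map_pmf ((+) x) q)) t =
      (\<integral>z. iexp (t * real_of_int (fst z)) * iexp (t * real_of_int (snd z)) \<partial>(measure_pmf p \<Otimes>\<^sub>M measure_pmf q))"
    unfolding measure_pair_pmf_eq[symmetric]
    by (simp add: pmf_char_alt split_beta' exp_add[symmetric] distrib_left)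
  also have "\<dots> = (\<integral>x. \<integral>y. iexp (t * real_of_int x) * iexp (t * real_of_int y) \<partial>q \<partial>p)"
  proof (subst integral_fst'[symmetric])
    show "integrable (measure_pmf p \<Otimes>\<^sub>M measure_pmf q) (\<lambda>z. iexp (t * real_of_int (fst z)) * iexp (t * real_of_int (snd z)))"
      unfolding measure_pair_pmf_eq[symmetric]
      by (intro measure_pmf.integrable_const_bound[of _ 1]) (auto simp: norm_mult norm_exp_i_times)
  qed simp
  also have "\<dots> = pmf_char p t * pmf_char q t"
    by (simp add: pmf_char_alt)
  finally show ?thesis .
qed

lemma pmf_char_walk: "pmf_char (walk_pmf p n) t = pmf_char p t ^ n"
proof (induction n)
  case 0
  show ?case unfolding pmf_char_alt by (subst integral_measure_pmf[of "{0}"]) auto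
next
  case (Suc n)
  then show ?case by (simp add: pmf_char_add)
qed

definition sym_char :: "int pmf \<Rightarrow> real \<Rightarrow> real" where
  "sym_char q t = Re (pmf_char q t)"

lemma pmf_char_symmetric:
  assumes "map_pmf uminus q = q"
  shows "pmf_char q t = complex_of_real (sym_char q t)"
proof -
  have "(\<integral>x. sin (t * real_of_int x) \<partial>measure_pmf q) = (\<integral>x. sin (t * real_of_int x) \<partial>measure_pmf (map_pmf uminus q))"
    by (simp add: assms)
  also have "\<dots> = - (\<integral>x. sin (t * real_of_int x) \<partial>measure_pmf q)" by simp
  finally have "Im (pmf_char q t) = 0" by (simp add: Im_pmf_char)
  then show ?thesis by (simp add: sym_char_def complex_eq_iff)
qed

lemma sym_char_alt: "sym_char q t = (\<integral>x. cos (t * real_of_int x) \<partial>measure_pmf q)"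
  by (simp add: sym_char_def Re_pmf_char)

lemma abs_sym_char_le: "\<bar>sym_char q t\<bar> \<le> 1"
  unfolding sym_char_def using abs_Re_le_cmod[of "pmf_char q t"] norm_pmf_char_le[of q t] by linarith

lemma continuous_on_sym_char: "continuous_on A (sym_char q)"
  unfolding sym_char_def by (intro continuous_intros continuous_on_pmf_char)

lemma measurable_sym_char [measurable]: "sym_char q \<in> borel_measurable borel"
  by (intro borel_measurable_continuous_onI continuous_on_sym_char)

lemma sym_char_even: "sym_char q (- t) = sym_char q t"
  by (simp add: sym_char_alt)

lemma sym_char_walk:
  assumes "map_pmf uminus q = q"
  shows "sym_char (walk_pmf q n) t = sym_char q t ^ n"
  unfolding sym_char_def[of "walk_pmf q n"] pmf_char_walk pmf_char_symmetric[OF assms]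
  by (simp flip: of_real_power)

text \<open>The squared norm is the characteristic function of the difference of two independent
  jumps, that is, the mean of a cosine. Keeping only the outcomes \<open>(a, b)\<close> and
  \<open>(b, a)\<close> gives the sine, and \<open>1 - norm c\<close> is at least half of
  \<open>1 - (norm c)\<^sup>2\<close>. This measures how far \<open>norm (pmf_char p t)\<close> is
  from 1.\<close>

lemma norm_pmf_char_gap:
  "2 * (pmf p a * pmf p b) * (sin (real_of_int (a - b) * t / 2))\<^sup>2 \<le> 1 - norm (pmf_char p t)"
proof (cases "a = b")
  case True
  then show ?thesis using norm_pmf_char_le[of p t] by simp
next
  case ab: False
  define c where "c = pmf_char p t"
  have cos_le: "(norm c)\<^sup>2 \<le> 1 - 4 * (pmf p a * pmf p b) * (sin (real_of_int (a - b) * t / 2))\<^sup>2"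
  proof -
    let ?P = "measure_pmf (pair_pmf p p)"
    let ?g = "\<lambda>z :: int \<times> int. cos (t * real_of_int (fst z) - t * real_of_int (snd z))"
    interpret pair_sigma_finite "measure_pmf p" "measure_pmf p" ..
    have int: "integrable ?P (\<lambda>z. iexp (t * real_of_int (fst z)) * cnj (iexp (t * real_of_int (snd z))))"
      by (intro measure_pmf.integrable_const_bound[of _ 1]) (auto simp: norm_mult norm_exp_i_times)
    have "c * cnj c = (\<integral>x. \<integral>y. iexp (t * real_of_int x) * cnj (iexp (t * real_of_int y)) \<partial>p \<partial>p)"
      by (simp add: c_def pmf_char_alt integral_cnj[symmetric])
    also have "\<dots> = (\<integral>z. iexp (t * real_of_int (fst z)) * cnj (iexp (t * real_of_int (snd z))) \<partial>?P)"
      using int unfolding measure_pair_pmf_eq by (subst integral_fst'[symmetric]) auto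
    finally have "Re (c * cnj c) = (\<integral>z. Re (iexp (t * real_of_int (fst z)) * cnj (iexp (t * real_of_int (snd z)))) \<partial>?P)"
      using integral_Re[OF int] by simp
    also have "\<dots> = (\<integral>z. ?g z \<partial>?P)"
      by (intro Bochner_Integration.integral_cong refl)
         (simp only: times_complex.sel cnj.sel Re_iexp Im_iexp, simp add: cos_diff)
    also have "Re (c * cnj c) = (norm c)\<^sup>2" by (simp only: complex_norm_square[symmetric] Re_complex_of_real)
    finally have "(norm c)\<^sup>2 = (\<integral>z. ?g z \<partial>?P)" .
    also have "\<dots> \<le> (\<integral>z. 1 - 2 * (sin (real_of_int (a - b) * t / 2))\<^sup>2 * indicator {(a, b), (b, a)} z \<partial>?P)"
    proof (intro integral_mono)
      show "integrable ?P ?g" by (intro measure_pmf.integrable_const_bound[of _ 1]) auto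
      show "integrable ?P (\<lambda>z. 1 - 2 * (sin (real_of_int (a - b) * t / 2))\<^sup>2 * indicator {(a, b), (b, a)} z)"
        by (intro Bochner_Integration.integrable_diff integrable_mult_right) (auto simp: less_top[symmetric])
      fix z
      have cd: "cos x = 1 - 2 * (sin (x / 2))\<^sup>2" for x :: real
        using cos_double_sin[of "x / 2"] by simp
      show "?g z \<le> 1 - 2 * (sin (real_of_int (a - b) * t / 2))\<^sup>2 * indicator {(a, b), (b, a)} z"
      proof (cases "z = (a, b) \<or> z = (b, a)")
        case True
        then have "?g z = cos (real_of_int (a - b) * t)"
        proof
          assume "z = (b, a)"
          then have "?g z = cos (- (real_of_int (a - b) * t))" by (simp add: algebra_simps)
          then show ?thesis by (simp only: cos_minus)
        qed (simp add: algebra_simps)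
        then show ?thesis using cd[of "real_of_int (a - b) * t"] True by auto
      qed auto
    qed
    also have "\<dots> = 1 - 2 * (sin (real_of_int (a - b) * t / 2))\<^sup>2 * measure ?P {(a, b), (b, a)}"
      by (subst Bochner_Integration.integral_diff) (auto simp: less_top[symmetric])
    also have "measure ?P {(a, b), (b, a)} = 2 * (pmf p a * pmf p b)"
      using ab by (subst measure_measure_pmf_finite) (auto simp: pmf_pair)
    finally show ?thesis by (simp add: algebra_simps)
  qed
  have "(1 - norm c) * 2 \<ge> (1 - norm c) * (1 + norm c)"
    using norm_pmf_char_le[of p t] by (intro mult_left_mono) (auto simp: c_def)
  then have "(1 - norm c) * 2 \<ge> 1 - (norm c)\<^sup>2" by (simp add: algebra_simps power2_eq_square)
  with cos_le show ?thesis by (simp add: c_def)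
qed

section \<open>Fourier coefficients on the circle\<close>

abbreviation circ :: "real measure" where
  "circ \<equiv> restrict_space lborel {- pi..pi}"

lemma space_circ [simp]: "space circ = {- pi..pi}"
  by (simp add: space_restrict_space)

lemma finite_measure_circ: "finite_measure circ"
  by (intro finite_measureI) (simp add: emeasure_restrict_space)

lemma measurable_circ: "f \<in> borel_measurable borel \<Longrightarrow> f \<in> borel_measurable circ"
  by (intro measurable_restrict_space1) simp

lemma measurable_ident_circ [measurable]: "(\<lambda>x. x) \<in> measurable circ borel"
  by (intro measurable_restrict_space1) simp

lemma integrable_circ_bounded:
  fixes f :: "real \<Rightarrow> 'b::{banach, second_countable_topology}"
  assumes "f \<in> borel_measurable circ" "\<And>t. t \<in> {- pi..pi} \<Longrightarrow> norm (f t) \<le> K"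
  shows "integrable circ f"
  using assms by (intro finite_measure.integrable_const_bound[OF finite_measure_circ, of _ K]) auto

lemma emeasure_circ: "emeasure circ {- pi..pi} = ennreal (2 * pi)"
  by (simp add: emeasure_restrict_space)

lemma measure_circ: "measure circ {- pi..pi} = 2 * pi"
  by (simp add: measure_def emeasure_circ)

lemma integral_circ:
  fixes f :: "real \<Rightarrow> real"
  shows "integral\<^sup>L circ f = (LINT t:{- pi..pi}|lborel. f t)"
  unfolding set_lebesgue_integral_def using integral_restrict_space[of "{- pi..pi}" lborel f] by simp

lemma integral_circ_cos:
  fixes k :: int
  shows "(\<integral>t. cos (real_of_int k * t) \<partial>circ) = (if k = 0 then 2 * pi else 0)"
proof (cases "k = 0")
  case True
  then show ?thesis by (simp add: measure_circ)
next
  case False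
  have "set_integrable lborel {- pi..pi} (\<lambda>t. cos (real_of_int k * t))"
    by (intro borel_integrable_atLeastAtMost' continuous_intros)
  then have "(\<integral>t. cos (real_of_int k * t) \<partial>circ) = integral {- pi..pi} (\<lambda>t. cos (real_of_int k * t))"
    by (simp add: integral_circ set_borel_integral_eq_integral)
  also have "\<dots> = sin (real_of_int k * pi) / real_of_int k - sin (real_of_int k * (- pi)) / real_of_int k"
    using False
    by (intro integral_unique fundamental_theorem_of_calculus)
       (auto intro!: derivative_eq_intros simp: has_real_derivative_iff_has_vector_derivative[symmetric])
  also have "\<dots> = 0" using sin_int_times_real[of k] by (simp add: sin_times_pi_eq_0 mult.commute)
  finally show ?thesis using False by simp
qed

lemma integral_circ_cos_cos:
  fixes m x :: int
  shows "(\<integral>t. cos (real_of_int m * t) * cos (t * real_of_int x) \<partial>circ) = pi * (of_bool (x = m) + of_bool (x = - m))"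
proof -
  have "(\<integral>t. cos (real_of_int m * t) * cos (t * real_of_int x) \<partial>circ) =
      (\<integral>t. (cos (real_of_int (m - x) * t) + cos (real_of_int (m + x) * t)) / 2 \<partial>circ)"
    by (intro Bochner_Integration.integral_cong) (simp_all add: cos_times_cos algebra_simps)
  also have "\<dots> = ((\<integral>t. cos (real_of_int (m - x) * t) \<partial>circ) + (\<integral>t. cos (real_of_int (m + x) * t) \<partial>circ)) / 2"
  proof -
    have "integrable circ (\<lambda>t. cos (real_of_int k * t))" for k
      by (rule integrable_circ_bounded[of _ 1]) auto
    from this[of "m - x"] this[of "m + x"] show ?thesis by simp
  qed
  also have "\<dots> = pi * (of_bool (x = m) + of_bool (x = - m))"
    unfolding integral_circ_cos by auto
  finally show ?thesis .
qed

text \<open>The set \<open>B\<close> restricts the jumps, so that the same exchange serves both full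
  and truncated characteristic functions.\<close>

lemma integral_circ_char_swap:
  assumes g [measurable]: "g \<in> borel_measurable circ" and bd: "\<And>t. t \<in> {- pi..pi} \<Longrightarrow> \<bar>g t\<bar> \<le> K"
  shows "(\<integral>t. g t * (\<integral>x. indicator B x * cos (t * real_of_int x) \<partial>measure_pmf q) \<partial>circ) =
      (\<integral>x. indicator B x * (\<integral>t. g t * cos (t * real_of_int x) \<partial>circ) \<partial>measure_pmf q)"
proof -
  interpret circ: finite_measure circ by (rule finite_measure_circ)
  interpret pair_sigma_finite circ "measure_pmf q" ..
  have K: "K \<ge> 0" using bd[of 0] by simp
  have fin: "finite_measure (circ \<Otimes>\<^sub>M measure_pmf q)"
    by (intro finite_measure_pair_measure finite_measure_circ measure_pmf.finite_measure)
  have mg [measurable]: "(\<lambda>z. g (fst z)) \<in> borel_measurable (circ \<Otimes>\<^sub>M measure_pmf q)"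
    by (rule measurable_compose[OF measurable_fst g])
  have m0 [measurable]: "(\<lambda>z. fst z) \<in> borel_measurable (circ \<Otimes>\<^sub>M measure_pmf q)"
    by (rule measurable_compose[OF measurable_fst measurable_ident_circ])
  have m1 [measurable]: "(\<lambda>z. real_of_int (snd z)) \<in> borel_measurable (circ \<Otimes>\<^sub>M measure_pmf q)"
    by (rule measurable_compose[OF measurable_snd]) simp
  have m2 [measurable]: "(\<lambda>z. indicator B (snd z) :: real) \<in> borel_measurable (circ \<Otimes>\<^sub>M measure_pmf q)"
    by (rule measurable_compose[OF measurable_snd]) simp
  have int: "integrable (circ \<Otimes>\<^sub>M measure_pmf q) (\<lambda>(t, x). indicator B x * (g t * cos (t * real_of_int x)))"
  proof (rule finite_measure.integrable_const_bound[OF fin, of _ K])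
    show "(\<lambda>(t, x). indicator B x * (g t * cos (t * real_of_int x))) \<in> borel_measurable (circ \<Otimes>\<^sub>M measure_pmf q)"
      unfolding split_beta'
      by (intro borel_measurable_times m2 mg measurable_compose[OF borel_measurable_times[OF m0 m1] borel_measurable_cos])
    have "\<bar>indicator B x * (g t * cos (t * real_of_int x))\<bar> \<le> K" if "t \<in> {- pi..pi}" for t x
      using mult_mono[OF bd[OF that] abs_cos_le_one[of "t * real_of_int x"]] K
      by (auto simp: indicator_def abs_mult)
    then show "AE z in circ \<Otimes>\<^sub>M measure_pmf q. norm (case z of (t, x) \<Rightarrow> indicator B x * (g t * cos (t * real_of_int x))) \<le> K"
      by (intro AE_I2) (auto simp: space_pair_measure)
  qed
  have "(\<integral>t. g t * (\<integral>x. indicator B x * cos (t * real_of_int x) \<partial>measure_pmf q) \<partial>circ) =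
      (\<integral>t. \<integral>x. indicator B x * (g t * cos (t * real_of_int x)) \<partial>measure_pmf q \<partial>circ)"
    by (subst integral_mult_right_zero[symmetric]) (simp add: ac_simps)
  also have "\<dots> = (\<integral>x. \<integral>t. indicator B x * (g t * cos (t * real_of_int x)) \<partial>circ \<partial>measure_pmf q)"
    using Fubini_integral[OF int] by simp
  finally show ?thesis by simp
qed

lemma integral_circ_cos_char:
  "(\<integral>t. cos (real_of_int m * t) * Re (pmf_char p t) \<partial>circ) = pi * (pmf p m + pmf p (- m))"
proof -
  have "(\<integral>t. cos (real_of_int m * t) * Re (pmf_char p t) \<partial>circ) =
      (\<integral>x. \<integral>t. cos (real_of_int m * t) * cos (t * real_of_int x) \<partial>circ \<partial>measure_pmf p)"
    using integral_circ_char_swap[where g = "\<lambda>t. cos (real_of_int m * t)" and K = 1 and B = UNIV and q = p] by (simp add: Re_pmf_char)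
  also have "\<dots> = (\<integral>x. pi * (indicator {m} x + indicator {- m} x) \<partial>measure_pmf p)"
    unfolding integral_circ_cos_cos by (intro Bochner_Integration.integral_cong) (auto simp: indicator_def)
  also have "\<dots> = pi * (pmf p m + pmf p (- m))"
    by (simp add: less_top[symmetric] measure_pmf_single)
  finally show ?thesis .
qed

section \<open>The tail function\<close>

definition tail :: "int pmf \<Rightarrow> nat \<Rightarrow> real" where
  "tail q n = measure_pmf.prob q {x. int n \<le> \<bar>x\<bar>}"

definition tail_fun :: "int pmf \<Rightarrow> real \<Rightarrow> real \<Rightarrow> real" where
  "tail_fun q r s = (\<Sum>n. r ^ n * tail q n * cos (real n * s))"

lemma tail_nonneg: "tail q n \<ge> 0" and tail_le_1: "tail q n \<le> 1"
  by (simp_all add: tail_def)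

lemma tail_Suc_le: "tail q (Suc n) \<le> tail q n"
  unfolding tail_def by (intro measure_pmf.finite_measure_mono) auto

lemma abs_tail_term_le:
  assumes "0 \<le> r"
  shows "\<bar>r ^ n * tail q n * cos (real n * s)\<bar> \<le> r ^ n"
proof -
  have "\<bar>r ^ n * tail q n * cos (real n * s)\<bar> = r ^ n * (tail q n * \<bar>cos (real n * s)\<bar>)"
    using assms tail_nonneg[of q n] by (simp add: abs_mult)
  also have "\<dots> \<le> r ^ n * (1 * 1)"
    using assms tail_nonneg[of q n] tail_le_1[of q n] by (intro mult_left_mono mult_mono) auto
  finally show ?thesis by simp
qed

lemma summable_tail_fun:
  assumes "0 \<le> r" "r < 1"
  shows "summable (\<lambda>n. r ^ n * tail q n * cos (real n * s))"
  by (rule summable_comparison_test'[where g = "\<lambda>n. r ^ n"])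
     (use assms abs_tail_term_le[of r] in auto)

lemma abs_tail_fun_le:
  assumes r: "0 \<le> r" "r < 1"
  shows "\<bar>tail_fun q r s\<bar> \<le> 1 / (1 - r)"
proof -
  have "norm (\<Sum>n. r ^ n * tail q n * cos (real n * s)) \<le> (\<Sum>n. r ^ n)"
    by (rule norm_suminf_le) (use r abs_tail_term_le[of r] in auto)
  then show ?thesis using r by (simp add: tail_fun_def suminf_geometric)
qed

lemma uniform_limit_tail_fun:
  assumes r: "0 \<le> r" "r < 1"
  shows "uniform_limit A (\<lambda>N s. \<Sum>n<N. r ^ n * tail q n * cos (real n * s)) (tail_fun q r) sequentially"
  unfolding tail_fun_def
  by (rule Weierstrass_m_test[where M = "\<lambda>n. r ^ n"]) (use r abs_tail_term_le[of r] in auto)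

lemma continuous_on_tail_fun:
  assumes r: "0 \<le> r" "r < 1"
  shows "continuous_on A (tail_fun q r)"
  by (rule uniform_limit_theorem[OF _ uniform_limit_tail_fun[OF r]])
     (auto intro!: always_eventually continuous_intros)

lemma measurable_tail_fun: "0 \<le> r \<Longrightarrow> r < 1 \<Longrightarrow> tail_fun q r \<in> borel_measurable borel"
  by (intro borel_measurable_continuous_onI continuous_on_tail_fun)

lemma tail_fun_even: "tail_fun q r (- s) = tail_fun q r s"
  by (simp add: tail_fun_def)

section \<open>Summation by parts and trigonometric sums\<close>

lemma abel_bound:
  fixes a b :: "nat \<Rightarrow> real"
  assumes dec: "\<And>n. a (Suc n) \<le> a n" and pos: "\<And>n. a n \<ge> 0" and bd: "\<And>n. \<bar>\<Sum>i<n. b i\<bar> \<le> B"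
  shows "\<bar>\<Sum>i<n. a i * b i\<bar> \<le> a 0 * B"
proof -
  have B: "B \<ge> 0" using bd[of 0] by simp
  have eq: "(\<Sum>i<Suc n. a i * b i) = a n * (\<Sum>i<Suc n. b i) + (\<Sum>i<n. (a i - a (Suc i)) * (\<Sum>j<Suc i. b j))" for n
    by (induction n) (simp_all add: algebra_simps)
  show ?thesis
  proof (cases n)
    case (Suc m)
    have "\<bar>\<Sum>i<Suc m. a i * b i\<bar> \<le> \<bar>a m * (\<Sum>i<Suc m. b i)\<bar> + \<bar>\<Sum>i<m. (a i - a (Suc i)) * (\<Sum>j<Suc i. b j)\<bar>"
      unfolding eq by (rule abs_triangle_ineq)
    also have "\<dots> \<le> a m * B + (\<Sum>i<m. (a i - a (Suc i)) * B)"
    proof (intro add_mono)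
      show "\<bar>a m * (\<Sum>i<Suc m. b i)\<bar> \<le> a m * B"
        unfolding abs_mult using pos[of m] bd[of "Suc m"] by (simp add: mult_left_mono del: sum.lessThan_Suc)
      have "\<bar>\<Sum>i<m. (a i - a (Suc i)) * (\<Sum>j<Suc i. b j)\<bar> \<le> (\<Sum>i<m. \<bar>(a i - a (Suc i)) * (\<Sum>j<Suc i. b j)\<bar>)"
        by (rule sum_abs)
      also have "\<dots> \<le> (\<Sum>i<m. (a i - a (Suc i)) * B)"
      proof (rule sum_mono)
        fix i
        show "\<bar>(a i - a (Suc i)) * (\<Sum>j<Suc i. b j)\<bar> \<le> (a i - a (Suc i)) * B"
          unfolding abs_mult using dec[of i] bd[of "Suc i"] by (simp add: mult_left_mono del: sum.lessThan_Suc)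
      qed
      finally show "\<bar>\<Sum>i<m. (a i - a (Suc i)) * (\<Sum>j<Suc i. b j)\<bar> \<le> (\<Sum>i<m. (a i - a (Suc i)) * B)" .
    qed
    also have "(\<Sum>i<m. (a i - a (Suc i)) * B) = (a 0 - a m) * B"
      by (simp add: sum_distrib_right[symmetric] sum_lessThan_telescope')
    finally show ?thesis by (simp add: Suc algebra_simps)
  qed (use pos[of 0] B in simp)
qed

text \<open>The weights \<open>r ^ i * tail q i\<close> decrease and start at most at 1, whatever
  \<open>r\<close> is. This is the source of all bounds that are uniform in
  \<open>r\<close>.\<close>

lemma abel_bound_tail:
  assumes r: "0 \<le> r" "r < 1" and bd: "\<And>n. \<bar>\<Sum>i<n. b i\<bar> \<le> B"
  shows "\<bar>\<Sum>i<n. r ^ i * tail q i * b i\<bar> \<le> B"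
proof -
  have B: "B \<ge> 0" using bd[of 0] by simp
  have "\<bar>\<Sum>i<n. r ^ i * tail q i * b i\<bar> \<le> r ^ 0 * tail q 0 * B"
  proof (rule abel_bound[OF _ _ bd])
    show "r ^ Suc n * tail q (Suc n) \<le> r ^ n * tail q n" for n
      using r tail_nonneg tail_Suc_le by (intro mult_mono power_decreasing) auto
  qed (use r tail_nonneg in auto)
  also have "\<dots> \<le> 1 * B"
    using tail_le_1[of q 0] B by (intro mult_right_mono) auto
  finally show ?thesis by simp
qed

lemma sum_cos_closed:
  fixes s :: real
  shows "2 * sin (s / 2) * (\<Sum>i<n. cos (real i * s)) = sin ((real n - 1 / 2) * s) + sin (s / 2)"
proof (induction n)
  case 0
  have "sin ((real 0 - 1 / 2) * s) = - sin (s / 2)" using sin_minus[of "s / 2"] by simp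
  then show ?case by simp
next
  case (Suc n)
  have "2 * sin (s / 2) * cos (real n * s) = sin ((real (Suc n) - 1 / 2) * s) - sin ((real n - 1 / 2) * s)"
  proof -
    have 1: "(real (Suc n) - 1 / 2) * s = real n * s + s / 2" "(real n - 1 / 2) * s = real n * s - s / 2"
      by (simp_all add: algebra_simps)
    show ?thesis unfolding 1 by (simp add: sin_add sin_diff)
  qed
  then show ?case using Suc by (simp add: distrib_left)
qed

lemma sum_cos_bound:
  assumes "sin (s / 2) \<noteq> 0"
  shows "\<bar>\<Sum>i<n. cos (real i * s)\<bar> \<le> 1 / \<bar>sin (s / 2)\<bar>"
proof -
  have "\<bar>2 * sin (s / 2) * (\<Sum>i<n. cos (real i * s))\<bar> \<le> 2"
    unfolding sum_cos_closed using abs_triangle_ineq[of "sin ((real n - 1 / 2) * s)" "sin (s / 2)"]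
      abs_sin_le_one[of "(real n - 1 / 2) * s"] abs_sin_le_one[of "s / 2"] by linarith
  then have "\<bar>sin (s / 2)\<bar> * \<bar>\<Sum>i<n. cos (real i * s)\<bar> \<le> 1"
    by (simp add: abs_mult)
  then show ?thesis using assms by (simp add: field_simps)
qed

lemma abs_tail_fun_le_sin:
  assumes r: "0 \<le> r" "r < 1" and s: "sin (s / 2) \<noteq> 0"
  shows "\<bar>tail_fun q r s\<bar> \<le> 1 / \<bar>sin (s / 2)\<bar>"
proof -
  have "(\<lambda>n. \<Sum>i<n. r ^ i * tail q i * cos (real i * s)) \<longlonglongrightarrow> tail_fun q r s"
    unfolding tail_fun_def by (rule summable_LIMSEQ[OF summable_tail_fun[OF r]])
  then have "(\<lambda>n. \<bar>\<Sum>i<n. r ^ i * tail q i * cos (real i * s)\<bar>) \<longlonglongrightarrow> \<bar>tail_fun q r s\<bar>"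
    by (rule tendsto_rabs)
  then show ?thesis
    by (rule LIMSEQ_le_const2) (use abel_bound_tail[OF r sum_cos_bound[OF s]] in auto)
qed

lemma sin_ge_half:
  assumes "0 \<le> x" "x \<le> pi / 2"
  shows "x / 2 \<le> sin (x::real)"
proof -
  have "\<bar>sin x - (\<Sum>m<3. sin_coeff m * x ^ m)\<bar> \<le> inverse (fact 3) * \<bar>x\<bar> ^ 3"
    by (rule Maclaurin_sin_bound)
  moreover have "(\<Sum>m<3. sin_coeff m * x ^ m) = x"
    by (simp add: numeral_3_eq_3 sin_coeff_def)
  ultimately have "\<bar>sin x - x\<bar> \<le> x ^ 3 / 6" using assms by (simp add: fact_numeral)
  then have 1: "x - x ^ 3 / 6 \<le> sin x" by linarith
  have "x \<le> 1.6" using assms pi_less_4 pi_approx by simp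
  then have "x * x \<le> 1.6 * 1.6" using assms by (intro mult_mono) auto
  then have "x * (x * x) \<le> x * 3" using assms by (intro mult_left_mono) auto
  then have "x ^ 3 / 6 \<le> x / 2" by (simp add: power3_eq_cube)
  with 1 show ?thesis by simp
qed

lemma sum_sin_closed:
  fixes u :: real
  shows "2 * sin (u / 2) * (\<Sum>i<n. sin (real (i + m) * u)) = cos ((real m - 1 / 2) * u) - cos ((real (n + m) - 1 / 2) * u)"
proof (induction n)
  case (Suc n)
  have "2 * sin (u / 2) * sin (real (n + m) * u) = cos ((real (n + m) - 1 / 2) * u) - cos ((real (Suc n + m) - 1 / 2) * u)"
  proof -
    have 1: "(real (Suc n + m) - 1 / 2) * u = real (n + m) * u + u / 2" "(real (n + m) - 1 / 2) * u = real (n + m) * u - u / 2"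
      by (simp_all add: algebra_simps)
    show ?thesis unfolding 1 by (simp add: cos_add cos_diff)
  qed
  then show ?case using Suc by (simp add: distrib_left)
qed simp

lemma sum_sin_bound:
  assumes "sin (u / 2) > 0"
  shows "\<bar>\<Sum>i<n. sin (real (i + m) * u)\<bar> \<le> 1 / sin (u / 2)"
proof -
  have "\<bar>2 * sin (u / 2) * (\<Sum>i<n. sin (real (i + m) * u))\<bar> \<le> 2"
    unfolding sum_sin_closed
    using abs_triangle_ineq4[of "cos ((real m - 1 / 2) * u)" "cos ((real (n + m) - 1 / 2) * u)"]
      abs_cos_le_one[of "(real m - 1 / 2) * u"] abs_cos_le_one[of "(real (n + m) - 1 / 2) * u"] by linarith
  then have "sin (u / 2) * \<bar>\<Sum>i<n. sin (real (i + m) * u)\<bar> \<le> 1"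
    using assms by (simp add: abs_mult)
  then show ?thesis using assms by (simp add: field_simps)
qed

text \<open>The classical bounded partial sums, split at \<open>1 / u\<close>. Up to there each term
  is at most \<open>u\<close>, which gives 1. Beyond it, summation by parts gives the first
  coefficient, at most \<open>u\<close>, times \<open>1 / sin (u / 2)\<close>, at most
  \<open>4 / u\<close>.\<close>

lemma sum_sin_div_bound:
  assumes u: "0 < u" "u \<le> pi"
  shows "\<bar>\<Sum>k<n. sin (real (Suc k) * u) / real (Suc k)\<bar> \<le> 5"
proof -
  define m where "m = nat \<lfloor>1 / u\<rfloor>"
  have m: "real m \<le> 1 / u" "1 / u < real (Suc m)" using u by (auto simp: m_def) linarith+
  let ?t = "\<lambda>k. sin (real (Suc k) * u) / real (Suc k)"
  have t: "\<bar>?t k\<bar> \<le> u" for k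
    using abs_sin_x_le_abs_x[of "real (Suc k) * u"] u by (simp add: abs_mult divide_simps mult.commute)
  have small: "\<bar>\<Sum>k<j. ?t k\<bar> \<le> 1" if "j \<le> m" for j
  proof -
    have "\<bar>\<Sum>k<j. ?t k\<bar> \<le> (\<Sum>k<j. \<bar>?t k\<bar>)" by (rule sum_abs)
    also have "\<dots> \<le> (\<Sum>k<j. u)" by (intro sum_mono t)
    also have "\<dots> \<le> real m * u" using that u by (simp add: mult_right_mono)
    also have "\<dots> \<le> 1" using m u by (simp add: field_simps)
    finally show ?thesis .
  qed
  show ?thesis
  proof (cases "n \<le> m")
    case True
    then show ?thesis using small[of n] by simp
  next
    case False
    have sin_pos: "sin (u / 2) \<ge> u / 4" using sin_ge_half[of "u / 2"] u by simp
    have "\<bar>\<Sum>i<n - m. (1 / real (Suc (i + m))) * sin (real (i + Suc m) * u)\<bar> \<le> (1 / real (Suc (0 + m))) * (1 / sin (u / 2))"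
      using sin_pos u by (intro abel_bound sum_sin_bound) (auto simp: divide_simps)
    also have "\<dots> \<le> u * (4 / u)"
    proof (intro mult_mono)
      show "1 / real (Suc (0 + m)) \<le> u" using m u by (simp add: field_simps)
      show "1 / sin (u / 2) \<le> 4 / u" using sin_pos u by (simp add: field_simps)
    qed (use u sin_pos in auto)
    also have "\<dots> = 4" using u by simp
    also have "(\<Sum>i<n - m. (1 / real (Suc (i + m))) * sin (real (i + Suc m) * u)) = (\<Sum>k\<in>{m..<n}. ?t k)"
      using False by (intro sum.reindex_bij_witness[of _ "\<lambda>k. k - m" "\<lambda>i. i + m"]) auto
    finally have "\<bar>\<Sum>k\<in>{m..<n}. ?t k\<bar> \<le> 4" .
    moreover have "(\<Sum>k<n. ?t k) = (\<Sum>k<m. ?t k) + (\<Sum>k\<in>{m..<n}. ?t k)"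
      using False sum.atLeastLessThan_concat[of 0 m n ?t] by (simp add: atLeast0LessThan)
    ultimately show ?thesis using small[of m] by linarith
  qed
qed

text \<open>The integral of \<open>cos (k * s)\<close> over \<open>{0..u}\<close>, with its value at
  \<open>k = 0\<close> filled in.\<close>

definition wave :: "real \<Rightarrow> int \<Rightarrow> real" where
  "wave u k = (if k = 0 then u else sin (real_of_int k * u) / real_of_int k)"

lemma wave_uminus: "wave u (- k) = wave u k"
  by (simp add: wave_def)

lemma sum_wave_bound:
  assumes u: "0 \<le> u" "u \<le> pi"
  shows "\<bar>\<Sum>k<n. wave u (int k)\<bar> \<le> 9"
proof (cases n)
  case (Suc m)
  have "(\<Sum>k<Suc m. wave u (int k)) = u + (\<Sum>k<m. sin (real (Suc k) * u) / real (Suc k))"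
    by (subst sum.lessThan_Suc_shift) (simp add: wave_def)
  moreover have "\<bar>\<Sum>k<m. sin (real (Suc k) * u) / real (Suc k)\<bar> \<le> 5"
    using sum_sin_div_bound[of u m] u by (cases "u = 0") auto
  ultimately show ?thesis unfolding Suc using u pi_less_4 by linarith
qed simp

text \<open>Since \<open>wave u\<close> is even, a sum over any window of consecutive integers is a
  signed combination of at most three partial sums \<open>R\<close>, each bounded by 9. Thus the
  bound does not see the shift \<open>v\<close>.\<close>

lemma sum_wave_shift_bound:
  assumes u: "0 \<le> u" "u \<le> pi"
  shows "\<bar>\<Sum>i<n. wave u (int i - v)\<bar> \<le> 27"
proof -
  define R where "R j = (\<Sum>k<j. wave u (int k))" for j :: nat
  have R: "\<bar>R j\<bar> \<le> 9" for j unfolding R_def by (rule sum_wave_bound[OF u])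
  have up: "(\<Sum>i<n. wave u (int i + int w)) = R (n + w) - R w" for n w
    by (induction n) (simp_all add: R_def)
  \<comment> \<open>The truncated subtraction makes \<open>R (Suc w - n)\<close> vanish once the
    window has passed the centre; then \<open>R 1\<close> corrects for counting the centre
    twice.\<close>
  have down: "(\<Sum>i<n. wave u (int i - int w)) = R (Suc w) - R (Suc w - n) + (if n > w then R (n - w) - R 1 else 0)" for w n
  proof (induction n)
    case (Suc n)
    consider "n < w" | "n = w" | "n > w" by linarith
    then show ?case
    proof cases
      case 1
      then have "wave u (int n - int w) = wave u (int (w - n))" using wave_uminus[of u "int (w - n)"] by (simp add: of_nat_diff)
      moreover have "R (Suc w - n) = R (w - n) + wave u (int (w - n))"
        using 1 by (simp add: R_def Suc_diff_le)
      ultimately show ?thesis using 1 Suc by simp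
    next
      case 2
      then show ?thesis using Suc by (simp add: R_def)
    next
      case 3
      then have "R (Suc n - w) = R (n - w) + wave u (int n - int w)"
        by (simp add: R_def Suc_diff_le of_nat_diff)
      then show ?thesis using 3 Suc by simp
    qed
  qed (simp add: R_def)
  have R0: "R 0 = 0" by (simp add: R_def)
  show ?thesis
  proof (cases "v \<ge> 0")
    case True
    then obtain w where w: "v = int w" using nonneg_int_cases by blast
    show ?thesis
    proof (cases "n > w")
      case True
      then have "(\<Sum>i<n. wave u (int i - v)) = R (Suc w) + R (n - w) - R 1"
        unfolding w down by (simp add: R0)
      then show ?thesis using R[of "Suc w"] R[of "n - w"] R[of 1] by linarith
    next
      case False
      then have "(\<Sum>i<n. wave u (int i - v)) = R (Suc w) - R (Suc w - n)"
        unfolding w down by simp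
      then show ?thesis using R[of "Suc w"] R[of "Suc w - n"] by linarith
    qed
  next
    case False
    then obtain w where w: "v = - int w" using nonneg_int_cases[of "- v"] by (metis add.inverse_inverse neg_0_le_iff_le nle_le)
    have "(\<Sum>i<n. wave u (int i - v)) = R (n + w) - R w"
      using up[of w n] by (simp add: w)
    then show ?thesis using R[of "n + w"] R[of w] by linarith
  qed
qed

lemma integral_circ_window:
  fixes F :: "real \<Rightarrow> real"
  assumes u: "0 \<le> u" "u \<le> pi" and F: "continuous_on {0..u} F"
  shows "(\<integral>s. indicator {0..u} s * F s \<partial>circ) = integral {0..u} F"
proof -
  have "(\<integral>s. indicator {0..u} s * F s \<partial>circ) = (LINT s:{- pi..pi}|lborel. indicator {0..u} s * F s)"
    by (rule integral_circ)
  also have "\<dots> = (LINT s:{0..u}|lborel. F s)"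
    unfolding set_lebesgue_integral_def
    by (intro Bochner_Integration.integral_cong) (use u in \<open>auto simp: indicator_def\<close>)
  also have "\<dots> = integral {0..u} F"
    by (intro set_borel_integral_eq_integral borel_integrable_atLeastAtMost' F)
  finally show ?thesis .
qed

lemma integral_window_cos:
  assumes u: "0 \<le> u"
  shows "integral {0..u} (\<lambda>s. cos (real_of_int k * s)) = wave u k"
proof (cases "k = 0")
  case False
  then have "integral {0..u} (\<lambda>s. cos (real_of_int k * s)) = sin (real_of_int k * u) / real_of_int k - sin (real_of_int k * 0) / real_of_int k"
    using u by (intro integral_unique fundamental_theorem_of_calculus)
       (auto intro!: derivative_eq_intros simp: has_real_derivative_iff_has_vector_derivative[symmetric])
  then show ?thesis using False by (simp add: wave_def)
qed (use u in \<open>simp add: wave_def\<close>)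

lemma bounded_on_circ:
  fixes g :: "real \<Rightarrow> real"
  assumes "continuous_on UNIV g"
  obtains K where "\<And>t. t \<in> {- pi..pi} \<Longrightarrow> \<bar>g t\<bar> \<le> K"
proof -
  have "compact (g ` {- pi..pi})"
    by (intro compact_continuous_image continuous_on_subset[OF assms]) auto
  then obtain K where "\<forall>y\<in>g ` {- pi..pi}. norm y \<le> K" using compact_imp_bounded bounded_iff by metis
  then show ?thesis by (intro that[of K]) auto
qed

text \<open>Although \<open>tail_fun\<close> may blow up at 0 as \<open>r\<close> tends to 1, its
  integrals over initial segments do not: integrating termwise replaces cosines by waves centred at
  \<open>v\<close> and \<open>- v\<close>, whose partial sums are bounded, and the tail weights are
  monotone.\<close>

lemma integral_tail_fun_window_bound:
  assumes r: "0 \<le> r" "r < 1" and u: "0 \<le> u" "u \<le> pi"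
  shows "\<bar>integral {0..u} (\<lambda>s. tail_fun q r s * cos (real_of_int v * s))\<bar> \<le> 27"
proof -
  let ?P = "\<lambda>N s. (\<Sum>n<N. r ^ n * tail q n * cos (real n * s)) * cos (real_of_int v * s)"
  have ul: "uniform_limit {0..u} ?P (\<lambda>s. tail_fun q r s * cos (real_of_int v * s)) sequentially"
  proof -
    have "uniform_limit {0..u} (\<lambda>N s. \<Sum>n<N. r ^ n * tail q n * cos (real n * s) * cos (real_of_int v * s))
        (\<lambda>s. \<Sum>n. r ^ n * tail q n * cos (real n * s) * cos (real_of_int v * s)) sequentially"
    proof (rule Weierstrass_m_test[where M = "\<lambda>n. r ^ n"])
      fix n s
      have "\<bar>r ^ n * tail q n * cos (real n * s)\<bar> * \<bar>cos (real_of_int v * s)\<bar> \<le> r ^ n * 1"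
        using r by (intro mult_mono abs_tail_term_le) auto
      then show "norm (r ^ n * tail q n * cos (real n * s) * cos (real_of_int v * s)) \<le> r ^ n"
        by (simp add: abs_mult)
    qed (use r in simp)
    moreover have "(\<Sum>n. r ^ n * tail q n * cos (real n * s) * cos (real_of_int v * s)) = tail_fun q r s * cos (real_of_int v * s)" for s
      unfolding tail_fun_def by (rule suminf_mult2[symmetric, OF summable_tail_fun[OF r]])
    ultimately show ?thesis by (simp add: sum_distrib_right)
  qed
  obtain I J where I: "\<And>N. (?P N has_integral I N) {0..u}"
    and J: "((\<lambda>s. tail_fun q r s * cos (real_of_int v * s)) has_integral J) {0..u}"
    and lim: "(I \<longlongrightarrow> J) sequentially"
    by (rule uniform_limit_integral[OF ul]) (auto intro!: continuous_intros)
  have I_le: "\<bar>I N\<bar> \<le> 27" for N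
  proof -
    have "I N = integral {0..u} (?P N)" by (rule integral_unique[OF I, symmetric])
    also have "?P N = (\<lambda>s. \<Sum>n<N. r ^ n * tail q n * (cos (real n * s) * cos (real_of_int v * s)))"
      by (simp add: sum_distrib_right mult.assoc)
    also have "integral {0..u} \<dots> = (\<Sum>n<N. r ^ n * tail q n * integral {0..u} (\<lambda>s. cos (real n * s) * cos (real_of_int v * s)))"
      by (subst integral_sum) (auto intro!: integrable_continuous_real continuous_intros)
    also have "(\<lambda>n. integral {0..u} (\<lambda>s. cos (real n * s) * cos (real_of_int v * s))) =
        (\<lambda>n. (wave u (int n - v) + wave u (int n - (- v))) / 2)"
    proof
      fix n
      have "integral {0..u} (\<lambda>s. cos (real n * s) * cos (real_of_int v * s)) =
          integral {0..u} (\<lambda>s. (cos (real_of_int (int n - v) * s) + cos (real_of_int (int n - (- v)) * s)) / 2)"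
        by (intro integral_cong) (simp add: cos_times_cos left_diff_distrib distrib_right)
      also have "\<dots> = (integral {0..u} (\<lambda>s. cos (real_of_int (int n - v) * s)) + integral {0..u} (\<lambda>s. cos (real_of_int (int n - (- v)) * s))) / 2"
        by (subst integral_divide, subst integral_add) (auto intro!: integrable_continuous_real continuous_intros)
      finally show "integral {0..u} (\<lambda>s. cos (real n * s) * cos (real_of_int v * s)) = (wave u (int n - v) + wave u (int n - (- v))) / 2"
        unfolding integral_window_cos[OF u(1)] .
    qed
    finally have eq: "I N = (\<Sum>n<N. r ^ n * tail q n * ((wave u (int n - v) + wave u (int n - (- v))) / 2))" .
    show "\<bar>I N\<bar> \<le> 27"
      unfolding eq
    proof (rule abel_bound_tail[OF r])
      fix M
      have "\<bar>\<Sum>n<M. (wave u (int n - v) + wave u (int n - (- v))) / 2\<bar> =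
          \<bar>(\<Sum>n<M. wave u (int n - v)) + (\<Sum>n<M. wave u (int n - (- v)))\<bar> / 2"
        by (simp add: sum_divide_distrib[symmetric] sum.distrib)
      also have "\<dots> \<le> 27"
      proof -
        have "\<bar>a + b\<bar> / 2 \<le> 27" if "\<bar>a\<bar> \<le> 27" "\<bar>b\<bar> \<le> 27" for a b :: real
          using that abs_triangle_ineq[of a b] by simp
        from this[OF sum_wave_shift_bound[OF u] sum_wave_shift_bound[OF u]] show ?thesis .
      qed
      finally show "\<bar>\<Sum>n<M. (wave u (int n - v) + wave u (int n - (- v))) / 2\<bar> \<le> 27" .
    qed
  qed
  have "\<bar>J\<bar> \<le> 27"
    by (rule LIMSEQ_le_const2[OF tendsto_rabs[OF lim]]) (intro exI allI impI I_le)
  then show ?thesis using J by (simp add: integral_unique)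
qed

text \<open>Arbitrary modulations \<open>v\<close> make this class stable under products with characteristic functions,
  arbitrary initial segments \<open>{0..u}\<close> under products with increasing functions.\<close>

definition osc_mult :: "int pmf \<Rightarrow> real \<Rightarrow> (real \<Rightarrow> real) \<Rightarrow> real \<Rightarrow> bool" where
  "osc_mult q \<eta> w C \<longleftrightarrow> continuous_on UNIV w \<and>
     (\<forall>r\<in>{0..<1}. \<forall>v::int. \<forall>u\<in>{0..\<eta>}. \<bar>integral {0..u} (\<lambda>s. tail_fun q r s * w s * cos (real_of_int v * s))\<bar> \<le> C)"

lemma osc_mult_one: "\<eta> \<le> pi \<Longrightarrow> osc_mult q \<eta> (\<lambda>_. 1) 27"
  unfolding osc_mult_def using integral_tail_fun_window_bound by auto

lemma osc_multD:
  assumes "osc_mult q \<eta> w C" "0 \<le> r" "r < 1" "0 \<le> u" "u \<le> \<eta>"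
  shows "\<bar>integral {0..u} (\<lambda>s. tail_fun q r s * w s * cos (real_of_int v * s))\<bar> \<le> C"
  using assms by (auto simp: osc_mult_def)

lemma osc_mult_continuous: "osc_mult q \<eta> w C \<Longrightarrow> continuous_on A w"
  by (auto simp: osc_mult_def intro: continuous_on_subset)

lemma osc_mult_integrable:
  assumes w: "continuous_on UNIV w" and r: "0 \<le> r" "r < 1"
  shows "(\<lambda>s. tail_fun q r s * w s * cos (real_of_int v * s)) integrable_on {a..b}"
  by (intro integrable_continuous_real continuous_intros continuous_on_tail_fun r continuous_on_subset[OF w]) auto

lemma osc_mult_add:
  assumes "osc_mult q \<eta> w C" "osc_mult q \<eta> w' C'"
  shows "osc_mult q \<eta> (\<lambda>s. w s + w' s) (C + C')"
  unfolding osc_mult_def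
proof (intro conjI ballI allI)
  show "continuous_on UNIV (\<lambda>s. w s + w' s)"
    using assms by (intro continuous_intros) (auto simp: osc_mult_def)
  fix r v u assume r: "r \<in> {0..<1::real}" and u: "u \<in> {0..\<eta>}"
  have "integral {0..u} (\<lambda>s. tail_fun q r s * (w s + w' s) * cos (real_of_int v * s)) =
      integral {0..u} (\<lambda>s. tail_fun q r s * w s * cos (real_of_int v * s)) + integral {0..u} (\<lambda>s. tail_fun q r s * w' s * cos (real_of_int v * s))"
  proof -
    have "integral {0..u} (\<lambda>s. tail_fun q r s * (w s + w' s) * cos (real_of_int v * s)) =
        integral {0..u} (\<lambda>s. tail_fun q r s * w s * cos (real_of_int v * s) + tail_fun q r s * w' s * cos (real_of_int v * s))"
      by (intro integral_cong) (simp add: algebra_simps)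
    also have "\<dots> = integral {0..u} (\<lambda>s. tail_fun q r s * w s * cos (real_of_int v * s)) + integral {0..u} (\<lambda>s. tail_fun q r s * w' s * cos (real_of_int v * s))"
      by (rule integral_add; rule osc_mult_integrable[OF osc_mult_continuous]) (use assms r in auto)
    finally show ?thesis .
  qed
  then show "\<bar>integral {0..u} (\<lambda>s. tail_fun q r s * (w s + w' s) * cos (real_of_int v * s))\<bar> \<le> C + C'"
    using osc_multD[OF assms(1), of r u v] osc_multD[OF assms(2), of r u v] r u by auto
qed

lemma osc_mult_scale:
  assumes "osc_mult q \<eta> w C"
  shows "osc_mult q \<eta> (\<lambda>s. w s * c) (C * \<bar>c\<bar>)"
  unfolding osc_mult_def
proof (intro conjI ballI allI)
  show "continuous_on UNIV (\<lambda>s. w s * c)"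
    using assms by (intro continuous_intros) (auto simp: osc_mult_def)
  fix r v u assume r: "r \<in> {0..<1::real}" and u: "u \<in> {0..\<eta>}"
  have "integral {0..u} (\<lambda>s. tail_fun q r s * (w s * c) * cos (real_of_int v * s)) =
      integral {0..u} (\<lambda>s. (tail_fun q r s * w s * cos (real_of_int v * s)) * c)"
    by (intro integral_cong) (simp add: ac_simps)
  also have "\<dots> = integral {0..u} (\<lambda>s. tail_fun q r s * w s * cos (real_of_int v * s)) * c"
    by (rule integral_mult_left)
  finally show "\<bar>integral {0..u} (\<lambda>s. tail_fun q r s * (w s * c) * cos (real_of_int v * s))\<bar> \<le> C * \<bar>c\<bar>"
    using osc_multD[OF assms(1), of r u v] r u by (simp add: abs_mult mult_right_mono)
qed

lemma osc_mult_mono: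
  assumes "osc_mult q \<eta> w C" "C \<le> C'"
  shows "osc_mult q \<eta> w C'"
  unfolding osc_mult_def
proof (intro conjI ballI allI)
  show "continuous_on UNIV w" using assms(1) by (rule osc_mult_continuous)
  fix r v u assume "r \<in> {0..<1::real}" "u \<in> {0..\<eta>}"
  then show "\<bar>integral {0..u} (\<lambda>s. tail_fun q r s * w s * cos (real_of_int v * s))\<bar> \<le> C'"
    using osc_multD[OF assms(1), of r u v] assms(2) by simp
qed

section \<open>Multipliers built from characteristic functions\<close>

definition part_char :: "int pmf \<Rightarrow> int set \<Rightarrow> real \<Rightarrow> real" where
  "part_char q B s = (\<integral>x. indicator B x * cos (s * real_of_int x) \<partial>measure_pmf q)"

lemma continuous_on_part_char: "continuous_on A (part_char q B)"
proof (rule continuous_at_imp_continuous_on, rule ballI, rule continuous_at_sequentiallyI)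
  fix s and f :: "nat \<Rightarrow> real" assume f: "f \<longlonglongrightarrow> s"
  show "(\<lambda>n. part_char q B (f n)) \<longlonglongrightarrow> part_char q B s"
    unfolding part_char_def
  proof (rule integral_dominated_convergence[where w = "\<lambda>_. 1"])
    show "AE x in measure_pmf q. (\<lambda>n. indicator B x * cos (f n * real_of_int x)) \<longlonglongrightarrow> indicator B x * cos (s * real_of_int x)"
      by (intro AE_I2 tendsto_intros f)
    show "AE x in measure_pmf q. norm (indicator B x * cos (f n * real_of_int x)) \<le> 1" for n
      by (intro AE_I2) (auto simp: indicator_def)
  qed auto
qed

text \<open>\<open>part_char q B\<close> is a superposition, of total mass
  \<open>measure_pmf.prob q B\<close>, of cosines of integer frequencies \<open>x\<close>. Each of
  these only shifts the modulation to \<open>v - x\<close> and \<open>v + x\<close>, under which the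
  class is invariant.\<close>

lemma osc_mult_part_char:
  assumes w: "osc_mult q \<eta> w C" and \<eta>: "0 \<le> \<eta>" "\<eta> \<le> pi"
  shows "osc_mult q \<eta> (\<lambda>s. w s * part_char q B s) (C * measure_pmf.prob q B)"
  unfolding osc_mult_def
proof (intro conjI ballI allI)
  note cw = osc_mult_continuous[OF w]
  show "continuous_on UNIV (\<lambda>s. w s * part_char q B s)"
    by (intro continuous_intros cw continuous_on_part_char)
  fix r v u assume r: "r \<in> {0..<1::real}" and u: "u \<in> {0..\<eta>}"
  have r': "0 \<le> r" "r < 1" and u': "0 \<le> u" "u \<le> pi" using r u \<eta> by auto
  let ?F = "\<lambda>v s. tail_fun q r s * w s * cos (real_of_int v * s)"
  have cF: "continuous_on A (?F v)" for A v
    by (intro continuous_intros continuous_on_tail_fun r' cw)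
  obtain K where K: "\<And>t. t \<in> {- pi..pi} \<Longrightarrow> \<bar>?F v t\<bar> \<le> K"
    using bounded_on_circ[OF cF] by blast
  let ?g = "\<lambda>s. indicator {0..u} s * ?F v s"
  have gm: "?g \<in> borel_measurable circ"
    by (intro measurable_circ borel_measurable_times borel_measurable_indicator borel_measurable_continuous_onI[OF cF]) auto
  have gK: "\<bar>?g t\<bar> \<le> max K 0" if "t \<in> {- pi..pi}" for t
    using K[OF that] by (auto simp: indicator_def)
  have inner: "\<bar>\<integral>t. ?g t * cos (t * real_of_int x) \<partial>circ\<bar> \<le> C" for x
  proof -
    have "(\<integral>t. ?g t * cos (t * real_of_int x) \<partial>circ) = (\<integral>t. indicator {0..u} t * (?F v t * cos (t * real_of_int x)) \<partial>circ)"
      by (simp add: ac_simps)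
    also have "\<dots> = integral {0..u} (\<lambda>t. ?F v t * cos (t * real_of_int x))"
      by (intro integral_circ_window u' continuous_intros cF)
    also have "\<dots> = integral {0..u} (\<lambda>t. (?F (v - x) t + ?F (v + x) t) / 2)"
    proof (intro integral_cong)
      fix t
      have "cos (real_of_int v * t) * cos (t * real_of_int x) = (cos (real_of_int (v - x) * t) + cos (real_of_int (v + x) * t)) / 2"
        by (simp add: cos_times_cos algebra_simps)
      then show "?F v t * cos (t * real_of_int x) = (?F (v - x) t + ?F (v + x) t) / 2"
        by (simp add: mult.assoc) (simp add: algebra_simps)
    qed
    also have "\<dots> = (integral {0..u} (?F (v - x)) + integral {0..u} (?F (v + x))) / 2"
      by (simp only: integral_divide integral_add[OF osc_mult_integrable[OF cw r'] osc_mult_integrable[OF cw r']])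
    finally show ?thesis
      using osc_multD[OF w r', of u "v - x"] osc_multD[OF w r', of u "v + x"] u by auto
  qed
  have "integral {0..u} (\<lambda>s. tail_fun q r s * (w s * part_char q B s) * cos (real_of_int v * s)) =
      integral {0..u} (\<lambda>s. ?F v s * part_char q B s)"
    by (intro integral_cong) (simp add: ac_simps)
  also have "\<dots> = (\<integral>s. ?g s * part_char q B s \<partial>circ)"
    by (subst integral_circ_window[symmetric]) (auto intro!: u' continuous_intros continuous_on_tail_fun r' cw continuous_on_part_char simp: mult.assoc)
  also have "\<dots> = (\<integral>x. indicator B x * (\<integral>t. ?g t * cos (t * real_of_int x) \<partial>circ) \<partial>measure_pmf q)"
    unfolding part_char_def by (rule integral_circ_char_swap[OF gm gK])
  finally have eq: "integral {0..u} (\<lambda>s. tail_fun q r s * (w s * part_char q B s) * cos (real_of_int v * s)) = \<dots>" .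
  have "norm (\<integral>x. indicator B x * (\<integral>t. ?g t * cos (t * real_of_int x) \<partial>circ) \<partial>measure_pmf q) \<le> (\<integral>x. C * indicator B x \<partial>measure_pmf q)"
  proof (intro order_trans[OF integral_norm_bound] integral_mono integrable_norm)
    show "integrable (measure_pmf q) (\<lambda>x. indicator B x * (\<integral>t. ?g t * cos (t * real_of_int x) \<partial>circ))"
      using inner order_trans[OF abs_ge_zero inner]
      by (intro measure_pmf.integrable_const_bound[of _ C]) (auto simp: indicator_def)
    show "integrable (measure_pmf q) (\<lambda>x. C * indicator B x :: real)" by (simp add: less_top[symmetric])
    show "norm (indicator B x * (\<integral>t. ?g t * cos (t * real_of_int x) \<partial>circ)) \<le> C * indicator B x" for x
      using inner[of x] by (auto simp: indicator_def)
  qed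
  then show "\<bar>integral {0..u} (\<lambda>s. tail_fun q r s * (w s * part_char q B s) * cos (real_of_int v * s))\<bar> \<le> C * measure_pmf.prob q B"
    unfolding eq by simp
qed

text \<open>By the second mean value theorem and \<open>g 0 = 0\<close>, the integral is
  \<open>g u\<close> times an integral over some \<open>{c..u}\<close>. The latter is a difference
  of two initial segments, hence the factor 2.\<close>

lemma osc_mult_increasing:
  assumes w: "osc_mult q \<eta> w C" and \<eta>: "0 \<le> \<eta>" and g: "continuous_on UNIV g"
    and mono: "\<And>x y. 0 \<le> x \<Longrightarrow> x \<le> y \<Longrightarrow> y \<le> \<eta> \<Longrightarrow> g x \<le> g y" and g0: "g 0 = 0"
  shows "osc_mult q \<eta> (\<lambda>s. w s * g s) (2 * C * g \<eta>)"
  unfolding osc_mult_def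
proof (intro conjI ballI allI)
  note cw = osc_mult_continuous[OF w]
  show "continuous_on UNIV (\<lambda>s. w s * g s)" by (intro continuous_intros cw g)
  fix r v u assume r: "r \<in> {0..<1::real}" and u: "u \<in> {0..\<eta>}"
  let ?F = "\<lambda>s. tail_fun q r s * w s * cos (real_of_int v * s)"
  have int: "?F integrable_on {a..b}" for a b using r by (intro osc_mult_integrable cw) auto
  have le: "\<bar>integral {0..c} ?F\<bar> \<le> C" if "c \<in> {0..u}" for c
    using osc_multD[OF w, of r c v] that r u by auto
  obtain c where c: "c \<in> {0..u}"
    and eq: "integral {0..u} (\<lambda>s. g s * ?F s) = g 0 * integral {0..c} ?F + g u * integral {c..u} ?F"
    by (rule second_mean_value_theorem[OF int, of 0 u g]) (use u mono in auto)
  have "integral {0..c} ?F + integral {c..u} ?F = integral {0..u} ?F"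
    using c by (intro Henstock_Kurzweil_Integration.integral_combine int) auto
  then have "\<bar>integral {c..u} ?F\<bar> \<le> 2 * C"
    using le[OF c] le[of u] u by auto
  moreover have gu: "0 \<le> g u" "g u \<le> g \<eta>" using mono[of 0 u] mono[of u \<eta>] g0 u by auto
  moreover have eq': "integral {0..u} (\<lambda>s. tail_fun q r s * (w s * g s) * cos (real_of_int v * s)) = g u * integral {c..u} ?F"
  proof -
    have "integral {0..u} (\<lambda>s. tail_fun q r s * (w s * g s) * cos (real_of_int v * s)) = integral {0..u} (\<lambda>s. g s * ?F s)"
      by (intro integral_cong) (simp add: ac_simps)
    then show ?thesis by (simp only: eq g0 mult_zero_left add_0_left)
  qed
  moreover have "0 \<le> C" using le[OF c] by linarith
  ultimately have "\<bar>integral {c..u} ?F\<bar> * g u \<le> 2 * C * g \<eta>"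
    by (intro mult_mono) auto
  then show "\<bar>integral {0..u} (\<lambda>s. tail_fun q r s * (w s * g s) * cos (real_of_int v * s))\<bar> \<le> 2 * C * g \<eta>"
    unfolding eq' abs_mult using gu by (simp add: mult.commute)
qed

lemma part_char_UNIV: "part_char q UNIV = sym_char q"
  by (simp add: part_char_def sym_char_alt fun_eq_iff)

text \<open>The full mass is 1, so the constant does not grow with the power.\<close>

lemma osc_mult_sym_char_power:
  assumes "0 \<le> \<eta>" "\<eta> \<le> pi"
  shows "osc_mult q \<eta> (\<lambda>s. sym_char q s ^ n) 27"
proof (induction n)
  case 0
  show ?case using osc_mult_one[OF assms(2)] by simp
next
  case (Suc n)
  from osc_mult_part_char[OF this assms, of UNIV] show ?case
    by (simp add: part_char_UNIV mult.commute)
qed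

text \<open>Smallness of \<open>1 - sym_char q\<close> in absolute value is not enough, since what
  counts is the oscillation constant. The jumps are split at a level \<open>L\<close>: the large
  ones have mass \<open>m < \<kappa> / 8\<close>, and the small ones contribute a function
  \<open>g\<close> that increases on \<open>{0..\<eta>}\<close> and stays below
  \<open>\<kappa> / 4\<close>. Each further factor then multiplies the constant by
  \<open>2 * g \<eta> + 2 * m\<close>, which is less than \<open>\<kappa>\<close>.\<close>

lemma osc_mult_gap_power:
  assumes \<kappa>: "\<kappa> > 0"
  shows "\<exists>\<eta>>0. \<eta> \<le> pi \<and> (\<forall>s\<in>{0..\<eta>}. \<bar>1 - sym_char q s\<bar> \<le> \<kappa>) \<and> (\<forall>k. osc_mult q \<eta> (\<lambda>s. (1 - sym_char q s) ^ k) (27 * \<kappa> ^ k))"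
proof -
  define A where "A L = {x::int. int L < \<bar>x\<bar>}" for L :: nat
  have "(\<lambda>L. measure_pmf.prob q (A L)) \<longlonglongrightarrow> measure_pmf.prob q (\<Inter>L. A L)"
    by (intro measure_pmf.finite_Lim_measure_decseq) (auto simp: decseq_def A_def)
  moreover have "(\<Inter>L. A L) = {}"
  proof -
    have "x \<notin> A (nat \<bar>x\<bar>)" for x by (simp add: A_def)
    then show ?thesis by blast
  qed
  ultimately have "(\<lambda>L. measure_pmf.prob q (A L)) \<longlonglongrightarrow> 0" by simp
  then have "\<forall>\<^sub>F L in sequentially. measure_pmf.prob q (A L) < \<kappa> / 8"
    using \<kappa> by (intro order_tendstoD) auto
  then obtain L where L: "measure_pmf.prob q (A L) < \<kappa> / 8" by (auto simp: eventually_sequentially)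
  define B where "B = A L"
  define m where "m = measure_pmf.prob q B"
  define g where "g s = (1 - m) - part_char q (- B) s" for s
  have cg: "continuous_on UNIV g" unfolding g_def by (intro continuous_intros continuous_on_part_char)
  have int: "integrable (measure_pmf q) (\<lambda>x. indicator D x * cos (s * real_of_int x))" for D s
    by (intro measure_pmf.integrable_const_bound[of _ 1]) (auto simp: indicator_def)
  have mc: "1 - m = measure_pmf.prob q (- B)"
    using measure_pmf.prob_compl[of B q] by (simp add: m_def Compl_eq_Diff_UNIV)
  have g_alt: "g s = (\<integral>x. indicator (- B) x * (1 - cos (s * real_of_int x)) \<partial>measure_pmf q)" for s
  proof -
    have "(\<integral>x. indicator (- B) x * (1 - cos (s * real_of_int x)) \<partial>measure_pmf q) =
        (\<integral>x. indicator (- B) x - indicator (- B) x * cos (s * real_of_int x) \<partial>measure_pmf q)"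
      by (simp add: algebra_simps)
    also have "\<dots> = g s"
      using int[of "- B" s] by (subst Bochner_Integration.integral_diff) (auto simp: less_top[symmetric] g_def part_char_def mc)
    finally show ?thesis ..
  qed
  have split: "1 - sym_char q s = g s + (m - part_char q B s)" for s
  proof -
    have "sym_char q s = part_char q (- B) s + part_char q B s"
      unfolding sym_char_alt part_char_def
      unfolding Bochner_Integration.integral_add[OF int[of "- B" s] int[of B s], symmetric]
      by (intro Bochner_Integration.integral_cong) (auto simp: indicator_def)
    then show ?thesis by (simp add: g_def)
  qed
  have g0: "g 0 = 0" by (simp add: g_alt)
  have "g \<midarrow>0\<rightarrow> g 0" using cg by (simp add: continuous_on_eq_continuous_at isCont_def)
  then have "\<forall>\<^sub>F s in at 0. g s < \<kappa> / 4" using \<kappa> g0 by (intro order_tendstoD) auto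
  then obtain d where d: "d > 0" "\<And>s. s \<noteq> 0 \<Longrightarrow> \<bar>s\<bar> < d \<Longrightarrow> g s < \<kappa> / 4"
    by (auto simp: eventually_at dist_real_def)
  \<comment> \<open>The second bound keeps \<open>s * \<bar>x\<bar>\<close> within
    \<open>{0..pi}\<close> for all jumps of size at most \<open>L\<close>; there the cosine
    decreases, which makes \<open>g\<close> increasing.\<close>
  define \<eta> where "\<eta> = min (d / 2) (pi / (real L + 1))"
  have \<eta>: "\<eta> > 0" "\<eta> < d" "\<eta> \<le> pi / (real L + 1)" using d by (auto simp: \<eta>_def)
  have \<eta>L: "\<eta> * real L \<le> pi"
  proof -
    have "\<eta> * (real L + 1) \<le> pi" using \<eta>(3) by (simp add: pos_le_divide_eq)
    then show ?thesis using \<eta>(1) by (simp add: distrib_left)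
  qed
  have \<eta>pi: "\<eta> \<le> pi"
  proof -
    have "pi / (real L + 1) \<le> pi / 1" by (intro divide_left_mono) auto
    then show ?thesis using \<eta>(3) by simp
  qed
  have g\<eta>: "g \<eta> < \<kappa> / 4" using d(2)[of \<eta>] \<eta> by auto
  have intg: "integrable (measure_pmf q) (\<lambda>z. indicator (- B) z * (1 - cos (s * real_of_int z)))" for s
  proof (rule measure_pmf.integrable_const_bound[of _ 2])
    show "AE z in measure_pmf q. norm (indicator (- B) z * (1 - cos (s * real_of_int z))) \<le> 2"
    proof (intro AE_I2)
      fix z show "norm (indicator (- B) z * (1 - cos (s * real_of_int z))) \<le> 2"
        using cos_ge_minus_one[of "s * real_of_int z"] cos_le_one[of "s * real_of_int z"] by (auto simp: indicator_def)
    qed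
  qed simp
  have mono: "g x \<le> g y" if "0 \<le> x" "x \<le> y" "y \<le> \<eta>" for x y
    unfolding g_alt
  proof (intro integral_mono intg)
    fix z :: int
    show "indicator (- B) z * (1 - cos (x * real_of_int z)) \<le> indicator (- B) z * (1 - cos (y * real_of_int z))"
    proof (cases "z \<in> B")
      case False
      then have zL: "\<bar>real_of_int z\<bar> \<le> real L" by (auto simp: B_def A_def)
      have "cos (y * \<bar>real_of_int z\<bar>) \<le> cos (x * \<bar>real_of_int z\<bar>)"
      proof (rule cos_monotone_0_pi_le)
        have "y * \<bar>real_of_int z\<bar> \<le> \<eta> * real L" using that zL \<eta> by (intro mult_mono) auto
        then show "y * \<bar>real_of_int z\<bar> \<le> pi" using \<eta>L by simp
        show "x * \<bar>real_of_int z\<bar> \<le> y * \<bar>real_of_int z\<bar>" using that by (intro mult_right_mono) auto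
      qed (use that in auto)
      moreover have "cos (t * \<bar>real_of_int z\<bar>) = cos (t * real_of_int z)" for t
        by (simp add: abs_if)
      ultimately show ?thesis by (auto simp: indicator_def)
    qed simp
  qed
  have part_le: "\<bar>part_char q B s\<bar> \<le> m" for s
  proof -
    have "norm (part_char q B s) \<le> (\<integral>x. indicator B x \<partial>measure_pmf q)"
      unfolding part_char_def
    proof (intro order_trans[OF integral_norm_bound] integral_mono integrable_norm)
      show "norm (indicator B x * cos (s * real_of_int x)) \<le> indicator B x" for x
        by (auto simp: indicator_def)
    qed (use int[of B s] in \<open>auto simp: less_top[symmetric]\<close>)
    then show ?thesis by (simp add: m_def)
  qed
  have m: "0 \<le> m" "m < \<kappa> / 8" using L by (auto simp: m_def B_def)
  have "\<bar>1 - sym_char q s\<bar> \<le> \<kappa>" if "s \<in> {0..\<eta>}" for s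
  proof -
    have "0 \<le> g s" "g s \<le> g \<eta>" using mono[of 0 s] mono[of s \<eta>] g0 that by auto
    then show ?thesis unfolding split using part_le[of s] m g\<eta> by linarith
  qed
  moreover have "osc_mult q \<eta> (\<lambda>s. (1 - sym_char q s) ^ k) (27 * \<kappa> ^ k)" for k
  proof (induction k)
    case 0
    show ?case using osc_mult_one[OF \<eta>pi] by simp
  next
    case (Suc k)
    let ?w = "\<lambda>s. (1 - sym_char q s) ^ k" and ?C = "27 * \<kappa> ^ k"
    have C: "?C \<ge> 0" using \<kappa> by simp
    have 1: "osc_mult q \<eta> (\<lambda>s. ?w s * g s) (2 * ?C * g \<eta>)"
      using \<eta> by (intro osc_mult_increasing Suc cg mono g0) auto
    have 2: "osc_mult q \<eta> (\<lambda>s. ?w s * m) (?C * \<bar>m\<bar>)" by (rule osc_mult_scale[OF Suc])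
    have "osc_mult q \<eta> (\<lambda>s. ?w s * part_char q B s) (?C * m)"
      unfolding m_def using \<eta> by (intro osc_mult_part_char Suc \<eta>pi) auto
    from osc_mult_scale[OF this, of "- 1"]
    have 3: "osc_mult q \<eta> (\<lambda>s. ?w s * part_char q B s * (- 1)) (?C * m * \<bar>- 1\<bar>)" .
    have "osc_mult q \<eta> (\<lambda>s. ?w s * g s + (?w s * m + ?w s * part_char q B s * (- 1))) (2 * ?C * g \<eta> + (?C * \<bar>m\<bar> + ?C * m * \<bar>- 1\<bar>))"
      by (intro osc_mult_add 1 2 3)
    moreover have "(\<lambda>s. ?w s * g s + (?w s * m + ?w s * part_char q B s * (- 1))) = (\<lambda>s. (1 - sym_char q s) ^ Suc k)"
    proof
      fix s
      have "(1 - sym_char q s) ^ Suc k = ?w s * (g s + (m - part_char q B s))" by (simp add: split[symmetric])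
      then show "?w s * g s + (?w s * m + ?w s * part_char q B s * (- 1)) = (1 - sym_char q s) ^ Suc k"
        by (simp add: algebra_simps)
    qed
    moreover have "2 * ?C * g \<eta> + (?C * \<bar>m\<bar> + ?C * m * \<bar>- 1\<bar>) \<le> 27 * \<kappa> ^ Suc k"
    proof -
      have "2 * ?C * g \<eta> + (?C * \<bar>m\<bar> + ?C * m * \<bar>- 1\<bar>) = ?C * (2 * g \<eta> + 2 * m)"
        using m by (simp add: algebra_simps)
      also have "\<dots> \<le> ?C * \<kappa>" using C m g\<eta> by (intro mult_left_mono) auto
      finally show ?thesis by (simp add: mult.commute mult.left_commute)
    qed
    ultimately show ?case by (simp only: osc_mult_mono)
  qed
  ultimately show ?thesis using \<eta> \<eta>pi by blast
qed

section \<open>The Green kernel on the torus\<close>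

lemma integral_sum_swap:
  fixes f :: "nat \<Rightarrow> 'a \<Rightarrow> real"
  assumes M: "finite_measure M" and f: "\<And>n. f n \<in> borel_measurable M"
    and bd: "\<And>n x. x \<in> space M \<Longrightarrow> \<bar>f n x\<bar> \<le> B n" and B: "summable B"
  shows "(\<lambda>n. \<integral>x. f n x \<partial>M) sums (\<integral>x. (\<Sum>n. f n x) \<partial>M)"
proof (rule sums_integral)
  show int: "integrable M (f n)" for n
    using bd by (intro finite_measure.integrable_const_bound[OF M, of _ "B n"] AE_I2 f) auto
  show "AE x in M. summable (\<lambda>n. norm (f n x))"
  proof (rule AE_I2)
    fix x assume x: "x \<in> space M"
    show "summable (\<lambda>n. norm (f n x))"
      by (rule summable_comparison_test'[OF B, of 0]) (simp add: bd[OF x])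
  qed
  show "summable (\<lambda>n. \<integral>x. norm (f n x) \<partial>M)"
  proof (rule summable_comparison_test'[of "\<lambda>n. measure M (space M) * B n" 0])
    show "summable (\<lambda>n. measure M (space M) * B n)" using B by (rule summable_mult)
    fix n
    have "(\<integral>x. norm (f n x) \<partial>M) \<le> (\<integral>x. B n \<partial>M)"
      by (rule integral_mono[OF integrable_norm[OF int] finite_measure.integrable_const[OF M]]) (simp add: bd)
    then show "norm (\<integral>x. norm (f n x) \<partial>M) \<le> measure M (space M) * B n" by simp
  qed
qed

section \<open>Abel-regularised crossing probabilities\<close>

definition half_sum :: "int pmf \<Rightarrow> nat \<Rightarrow> real \<Rightarrow> real" where
  "half_sum q n r = (\<Sum>x. r ^ x * tail q x * pmf (walk_pmf q n) (int x))"

lemma half_sum_term_bounds: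
  assumes "0 \<le> r"
  shows "0 \<le> r ^ x * tail q x * pmf (walk_pmf q n) (int x)" "r ^ x * tail q x * pmf (walk_pmf q n) (int x) \<le> r ^ x"
proof -
  show "0 \<le> r ^ x * tail q x * pmf (walk_pmf q n) (int x)" using assms tail_nonneg by simp
  have "r ^ x * (tail q x * pmf (walk_pmf q n) (int x)) \<le> r ^ x * (1 * 1)"
    using assms tail_nonneg tail_le_1 by (intro mult_left_mono mult_mono) (auto simp: pmf_le_1)
  then show "r ^ x * tail q x * pmf (walk_pmf q n) (int x) \<le> r ^ x" by (simp add: mult.assoc)
qed

lemma summable_half_sum:
  assumes "0 \<le> r" "r < 1"
  shows "summable (\<lambda>x. r ^ x * tail q x * pmf (walk_pmf q n) (int x))"
  by (rule summable_comparison_test'[where g = "\<lambda>x. r ^ x" and N = 0])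
     (use assms half_sum_term_bounds[OF assms(1)] in auto)

lemma half_sum_nonneg: "0 \<le> r \<Longrightarrow> r < 1 \<Longrightarrow> 0 \<le> half_sum q n r"
  unfolding half_sum_def by (intro suminf_nonneg summable_half_sum half_sum_term_bounds)

text \<open>Parseval's identity: \<open>sym_char q s ^ n\<close> has the law of \<open>V\<close> at
  time \<open>n\<close> as its Fourier coefficients and \<open>tail_fun\<close> has the damped tail,
  so the integral is the damped crossing probability.\<close>

lemma integral_tail_fun_sym_char_power:
  assumes sym: "map_pmf uminus q = q" and r: "0 \<le> r" "r < 1"
  shows "(\<integral>s. tail_fun q r s * sym_char q s ^ n \<partial>circ) = 2 * pi * half_sum q n r"
proof -
  have wsym: "pmf (walk_pmf q n) (- x) = pmf (walk_pmf q n) x" for x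
  proof -
    have "pmf (map_pmf uminus (walk_pmf q n)) x = pmf (walk_pmf q n) (- x)"
      by (simp add: pmf_map measure_pmf_single vimage_def minus_equation_iff[of _ x] eq_commute[of "- x"])
    then show ?thesis by (simp add: walk_pmf_uminus[OF sym])
  qed
  have "(\<lambda>x. \<integral>s. r ^ x * tail q x * cos (real x * s) * sym_char q s ^ n \<partial>circ) sums
      (\<integral>s. (\<Sum>x. r ^ x * tail q x * cos (real x * s) * sym_char q s ^ n) \<partial>circ)"
  proof (rule integral_sum_swap[where B = "\<lambda>x. r ^ x"])
    show "(\<lambda>s. r ^ x * tail q x * cos (real x * s) * sym_char q s ^ n) \<in> borel_measurable circ" for x
      by (rule measurable_circ) measurable
    fix x s
    have "\<bar>r ^ x * tail q x * cos (real x * s)\<bar> * \<bar>sym_char q s ^ n\<bar> \<le> r ^ x * 1"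
      using r abs_sym_char_le[of q s] by (intro mult_mono abs_tail_term_le) (auto simp: power_abs power_le_one)
    then show "\<bar>r ^ x * tail q x * cos (real x * s) * sym_char q s ^ n\<bar> \<le> r ^ x" by (simp add: abs_mult)
  qed (use r finite_measure_circ in auto)
  moreover have "(\<Sum>x. r ^ x * tail q x * cos (real x * s) * sym_char q s ^ n) = tail_fun q r s * sym_char q s ^ n" for s
    unfolding tail_fun_def by (rule suminf_mult2[symmetric, OF summable_tail_fun[OF r]])
  moreover have "(\<integral>s. r ^ x * tail q x * cos (real x * s) * sym_char q s ^ n \<partial>circ) =
      2 * pi * (r ^ x * tail q x * pmf (walk_pmf q n) (int x))" for x
  proof -
    have "(\<integral>s. r ^ x * tail q x * cos (real x * s) * sym_char q s ^ n \<partial>circ) =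
        r ^ x * tail q x * (\<integral>s. cos (real_of_int (int x) * s) * Re (pmf_char (walk_pmf q n) s) \<partial>circ)"
      by (simp add: mult.assoc flip: sym_char_def sym_char_walk[OF sym])
    also have "\<dots> = 2 * pi * (r ^ x * tail q x * pmf (walk_pmf q n) (int x))"
      unfolding integral_circ_cos_char wsym by (simp add: algebra_simps)
    finally show ?thesis .
  qed
  ultimately have "(\<lambda>x. 2 * pi * (r ^ x * tail q x * pmf (walk_pmf q n) (int x))) sums (\<integral>s. tail_fun q r s * sym_char q s ^ n \<partial>circ)"
    by simp
  then show ?thesis
    unfolding half_sum_def using suminf_mult[OF summable_half_sum[OF r, of q n], of "2 * pi"] by (simp add: sums_iff)
qed

lemma half_cross_suminf:
  "half_cross q n = (\<Sum>x. ennreal (tail q x * pmf (walk_pmf q n) (int x)))"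
proof -
  let ?W = "walk_pmf q n"
  have "half_cross q n = (\<integral>\<^sup>+v. emeasure q {x. 0 \<le> v \<and> v \<le> \<bar>x\<bar>} \<partial>?W)"
    by (simp add: half_cross_def emeasure_pair_pmf)
  also have "\<dots> = (\<integral>\<^sup>+v. ennreal (pmf ?W v) * emeasure q {x. 0 \<le> v \<and> v \<le> \<bar>x\<bar>} \<partial>count_space UNIV)"
    by (rule nn_integral_measure_pmf)
  also have "\<dots> = (\<integral>\<^sup>+v. ennreal (pmf ?W v) * emeasure q {x. 0 \<le> v \<and> v \<le> \<bar>x\<bar>} \<partial>count_space (range int))"
  proof (rule nn_integral_count_space_eq)
    fix v :: int assume "v \<in> UNIV - range int"
    then have "v < 0" using nonneg_int_cases[of v] by (force simp: not_le)
    then show "ennreal (pmf ?W v) * emeasure q {x. 0 \<le> v \<and> v \<le> \<bar>x\<bar>} = 0" by simp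
  qed simp
  also have "\<dots> = (\<integral>\<^sup>+x. ennreal (pmf ?W (int x)) * emeasure q {y. int x \<le> \<bar>y\<bar>} \<partial>count_space UNIV)"
    by (subst nn_integral_bij_count_space[symmetric, where g = int and A = UNIV]) (auto intro!: inj_on_imp_bij_betw)
  also have "\<dots> = (\<Sum>x. ennreal (tail q x * pmf ?W (int x)))"
    by (simp add: nn_integral_count_space_nat tail_def measure_pmf.emeasure_eq_measure ennreal_mult' mult.commute)
  finally show ?thesis .
qed

lemma half_sum_le_half_cross:
  assumes r: "0 \<le> r" "r < 1"
  shows "ennreal (half_sum q n r) \<le> half_cross q n"
proof -
  have "ennreal (half_sum q n r) = (\<Sum>x. ennreal (r ^ x * tail q x * pmf (walk_pmf q n) (int x)))"
    unfolding half_sum_def using r by (intro suminf_ennreal2[symmetric] summable_half_sum half_sum_term_bounds)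
  also have "\<dots> \<le> (\<Sum>x. ennreal (tail q x * pmf (walk_pmf q n) (int x)))"
  proof (intro suminf_le ennreal_leI)
    fix x
    have "r ^ x * (tail q x * pmf (walk_pmf q n) (int x)) \<le> 1 * (tail q x * pmf (walk_pmf q n) (int x))"
      using r tail_nonneg by (intro mult_right_mono power_le_one) auto
    then show "r ^ x * tail q x * pmf (walk_pmf q n) (int x) \<le> tail q x * pmf (walk_pmf q n) (int x)"
      by (simp add: mult.assoc)
  qed auto
  finally show ?thesis by (simp add: half_cross_suminf)
qed

text \<open>At even times this is the return probability of \<open>V\<close>. Taking absolute values
  makes it decreasing and keeps it meaningful at odd times, as required of \<open>\<beta>\<close> in
  \<open>suminf_dominated_returns_finite\<close>; it also measures absolute convergence in
  \<open>s\<close>.\<close>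

definition mean_power :: "int pmf \<Rightarrow> nat \<Rightarrow> real" where
  "mean_power q n = (\<integral>s. \<bar>sym_char q s\<bar> ^ n \<partial>circ) / (2 * pi)"

lemma integrable_abs_sym_char_power: "integrable circ (\<lambda>s. \<bar>sym_char q s\<bar> ^ n)"
  by (rule integrable_circ_bounded[of _ 1]) (auto intro!: measurable_circ power_le_one abs_sym_char_le)

lemma mean_power_nonneg: "mean_power q n \<ge> 0"
  unfolding mean_power_def by (intro divide_nonneg_nonneg integral_nonneg_AE AE_I2) auto

lemma mean_power_Suc_le: "mean_power q (Suc n) \<le> mean_power q n"
  unfolding mean_power_def
proof (rule divide_right_mono, rule integral_mono[OF integrable_abs_sym_char_power integrable_abs_sym_char_power])
  show "\<bar>sym_char q s\<bar> ^ Suc n \<le> \<bar>sym_char q s\<bar> ^ n" for s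
    by (rule power_decreasing[OF _ abs_ge_zero abs_sym_char_le]) simp
qed simp

lemma mean_power_even:
  assumes "map_pmf uminus q = q"
  shows "mean_power q (2 * m) = pmf (walk_pmf q (2 * m)) 0"
proof -
  have "(\<integral>s. \<bar>sym_char q s\<bar> ^ (2 * m) \<partial>circ) = (\<integral>s. cos (real_of_int 0 * s) * Re (pmf_char (walk_pmf q (2 * m)) s) \<partial>circ)"
    by (simp add: power_even_abs flip: sym_char_def sym_char_walk[OF assms])
  also have "\<dots> = pi * (pmf (walk_pmf q (2 * m)) 0 + pmf (walk_pmf q (2 * m)) (- 0))"
    by (rule integral_circ_cos_char)
  finally show ?thesis by (simp add: mean_power_def)
qed

text \<open>The maximum principle, applicable because \<open>mean_power\<close> decreases, moves
  visits at \<open>x\<close> to returns at 0; the parity argument then reduces to the Green function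
  of the planar walk.\<close>

lemma summable_visits_mean_power:
  fixes p q :: "int pmf"
  assumes sym: "map_pmf uminus q = q"
    and fin: "(\<Sum>n. ennreal (pmf (walk_pmf p n) 0) * ennreal (pmf (walk_pmf q n) 0)) < \<infinity>"
  shows "summable (\<lambda>n. pmf (walk_pmf p n) x * mean_power q n)"
proof -
  have "(\<Sum>n. ennreal (pmf (walk_pmf p n) x) * ennreal (mean_power q n)) \<le> (\<Sum>n. ennreal (pmf (walk_pmf p n) 0) * ennreal (mean_power q n))"
    by (intro walk_pmf_suminf_visits_le ennreal_leI mean_power_Suc_le)
  also have "\<dots> < \<infinity>"
    by (intro suminf_dominated_returns_finite[OF sym _ _ fin] ennreal_leI mean_power_Suc_le) (simp add: mean_power_even[OF sym])
  finally have "(\<Sum>n. ennreal (pmf (walk_pmf p n) x * mean_power q n)) \<noteq> top"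
    by (simp add: ennreal_mult' mean_power_nonneg)
  then show ?thesis by (intro summable_suminf_not_top) (auto simp: mean_power_nonneg)
qed

text \<open>Some jump \<open>x \<noteq> 0\<close> and its negative both have positive mass. The gap
  at distance \<open>2 * x\<close> confines the exceptional points to the zeros of
  \<open>sin (x * s)\<close>, a countable set.\<close>

lemma AE_abs_sym_char_less:
  assumes sym: "map_pmf uminus q = q" and nd: "q \<noteq> return_pmf 0"
  shows "AE s in circ. \<bar>sym_char q s\<bar> < 1"
proof -
  obtain x where x: "x \<in> set_pmf q" "x \<noteq> 0"
  proof -
    have "\<not> set_pmf q \<subseteq> {0}" using nd by (simp add: set_pmf_subset_singleton)
    then show ?thesis using that by auto
  qed
  have "- x \<in> set_pmf (map_pmf uminus q)" using x by auto
  then have mx: "- x \<in> set_pmf q" by (simp only: sym)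
  define N where "N = (\<lambda>k::int. real_of_int k * pi / real_of_int x) ` UNIV"
  have "countable N" by (simp add: N_def)
  then have "N \<in> null_sets lborel" by (rule countable_imp_null_set_lborel)
  then have "AE s in lborel. s \<notin> N" by (rule AE_not_in)
  moreover have "\<bar>sym_char q s\<bar> < 1" if "s \<notin> N" for s
  proof -
    have "sin (real_of_int x * s) \<noteq> 0"
    proof
      assume "sin (real_of_int x * s) = 0"
      then obtain k :: int where "real_of_int x * s = real_of_int k * pi" by (auto simp: sin_zero_iff_int2)
      then have "s = real_of_int k * pi / real_of_int x" using x by (simp add: field_simps)
      then have "s \<in> N" by (auto simp: N_def)
      with that show False by simp
    qed
    then have "0 < 2 * (pmf q x * pmf q (- x)) * (sin (real_of_int x * s))\<^sup>2"
      using x mx by (simp add: pmf_positive)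
    also have "\<dots> \<le> 1 - norm (pmf_char q s)"
      using norm_pmf_char_gap[of q x "- x" s] by simp
    finally have "norm (pmf_char q s) < 1" by simp
    then show ?thesis by (simp add: pmf_char_symmetric[OF sym])
  qed
  ultimately show ?thesis
    by (subst AE_restrict_space_iff) (auto elim!: eventually_mono)
qed

section \<open>The Green kernel and its weighted integrals\<close>

text \<open>Formally the real part of the Fourier transform of the planar Green function. Where the
  denominator vanishes the quotient is 0, so the kernel is nonnegative without exception.\<close>

definition green_kernel :: "int pmf \<Rightarrow> int pmf \<Rightarrow> real \<Rightarrow> real \<Rightarrow> real" where
  "green_kernel p q t s = Re (1 / (1 - pmf_char p t * complex_of_real (sym_char q s)))"

lemma Re_inverse_one_minus_nonneg:
  assumes "norm z \<le> 1"
  shows "0 \<le> Re (1 / (1 - z))"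
proof -
  have "Re z \<le> 1" using assms complex_Re_le_cmod[of z] by linarith
  then show ?thesis by (simp add: Re_divide)
qed

lemma norm_char_prod_le: "norm (pmf_char p t * complex_of_real (sym_char q s)) \<le> 1"
  using mult_mono[OF norm_pmf_char_le[of p t] abs_sym_char_le[of q s]] by (simp add: norm_mult)

lemma green_kernel_nonneg: "green_kernel p q t s \<ge> 0"
  unfolding green_kernel_def by (intro Re_inverse_one_minus_nonneg norm_char_prod_le)

lemma green_kernel_even: "green_kernel p q t (- s) = green_kernel p q t s"
  by (simp add: green_kernel_def sym_char_even)

lemma measurable_green_kernel: "(\<lambda>z. green_kernel p q (fst z) (snd z)) \<in> borel_measurable (borel \<Otimes>\<^sub>M borel)"
  unfolding green_kernel_def by measurable

text \<open>As \<open>sym_char q s\<close> is real, taking real parts of the geometric series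
  separates the variables: each term is a function of \<open>t\<close> times a power of
  \<open>sym_char q s\<close>.\<close>

lemma green_kernel_sums:
  assumes "norm (pmf_char p t * complex_of_real (sym_char q s)) < 1"
  shows "(\<lambda>n. Re (pmf_char p t ^ n) * sym_char q s ^ n) sums green_kernel p q t s"
proof -
  have "(\<lambda>n. (pmf_char p t * complex_of_real (sym_char q s)) ^ n) sums (1 / (1 - pmf_char p t * complex_of_real (sym_char q s)))"
    by (rule geometric_sums[OF assms])
  then have "(\<lambda>n. Re ((pmf_char p t * complex_of_real (sym_char q s)) ^ n)) sums green_kernel p q t s"
    unfolding green_kernel_def by (rule sums_Re)
  then show ?thesis by (simp add: power_mult_distrib flip: of_real_power)
qed

lemma abs_Re_power_le: "\<bar>Re (pmf_char p t ^ n)\<bar> \<le> 1"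
proof -
  have "norm (pmf_char p t ^ n) \<le> 1" unfolding norm_power by (intro power_le_one norm_pmf_char_le) auto
  then show ?thesis using abs_Re_le_cmod[of "pmf_char p t ^ n"] by linarith
qed

definition weight_coeff :: "int pmf \<Rightarrow> (real \<Rightarrow> real) \<Rightarrow> nat \<Rightarrow> real" where
  "weight_coeff p \<psi> n = (\<integral>t. \<psi> t * Re (pmf_char p t ^ n) \<partial>circ)"

lemma weight_coeff_cos:
  "weight_coeff p (\<lambda>t. cos (real_of_int m * t)) n = pi * (pmf (walk_pmf p n) m + pmf (walk_pmf p n) (- m))"
  unfolding weight_coeff_def pmf_char_walk[symmetric] by (rule integral_circ_cos_char)

lemma weight_coeff_one: "weight_coeff p (\<lambda>_. 1) n = 2 * pi * pmf (walk_pmf p n) 0"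
  using weight_coeff_cos[of p 0 n] by simp

lemma integral_weight_green_kernel:
  assumes s: "\<bar>sym_char q s\<bar> < 1" and \<psi>: "\<psi> \<in> borel_measurable borel" "\<And>t. \<bar>\<psi> t\<bar> \<le> 1"
  shows "(\<lambda>n. weight_coeff p \<psi> n * sym_char q s ^ n) sums (\<integral>t. \<psi> t * green_kernel p q t s \<partial>circ)"
proof -
  have lt: "norm (pmf_char p t * complex_of_real (sym_char q s)) < 1" for t
  proof -
    have "norm (pmf_char p t) * \<bar>sym_char q s\<bar> \<le> 1 * \<bar>sym_char q s\<bar>"
      by (intro mult_right_mono norm_pmf_char_le) auto
    then show ?thesis using s by (simp add: norm_mult)
  qed
  have "(\<lambda>n. \<integral>t. \<psi> t * (Re (pmf_char p t ^ n) * sym_char q s ^ n) \<partial>circ) sums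
      (\<integral>t. (\<Sum>n. \<psi> t * (Re (pmf_char p t ^ n) * sym_char q s ^ n)) \<partial>circ)"
  proof (rule integral_sum_swap[where B = "\<lambda>n. \<bar>sym_char q s\<bar> ^ n"])
    show "(\<lambda>t. \<psi> t * (Re (pmf_char p t ^ n) * sym_char q s ^ n)) \<in> borel_measurable circ" for n
      by (intro measurable_circ borel_measurable_times \<psi> borel_measurable_const) measurable
    fix n t
    have "\<bar>\<psi> t\<bar> * (\<bar>Re (pmf_char p t ^ n)\<bar> * \<bar>sym_char q s ^ n\<bar>) \<le> 1 * (1 * \<bar>sym_char q s ^ n\<bar>)"
      by (intro mult_mono \<psi> abs_Re_power_le mult_nonneg_nonneg) auto
    then show "\<bar>\<psi> t * (Re (pmf_char p t ^ n) * sym_char q s ^ n)\<bar> \<le> \<bar>sym_char q s\<bar> ^ n"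
      by (simp add: abs_mult power_abs)
  qed (use s finite_measure_circ in \<open>auto intro: summable_geometric\<close>)
  moreover have "(\<Sum>n. \<psi> t * (Re (pmf_char p t ^ n) * sym_char q s ^ n)) = \<psi> t * green_kernel p q t s" for t
    using sums_mult[OF green_kernel_sums[OF lt[of t]], of "\<psi> t"] by (simp add: sums_iff)
  moreover have "(\<integral>t. \<psi> t * (Re (pmf_char p t ^ n) * sym_char q s ^ n) \<partial>circ) = weight_coeff p \<psi> n * sym_char q s ^ n" for n
    by (simp add: weight_coeff_def mult.assoc[symmetric])
  ultimately show ?thesis by simp
qed

lemma pair_sigma_finite_circ: "pair_sigma_finite circ circ"
  by (intro pair_sigma_finite.intro finite_measure.sigma_finite_measure finite_measure_circ)

abbreviation torus :: "(real \<times> real) measure" where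
  "torus \<equiv> circ \<Otimes>\<^sub>M circ"

lemma measurable_torus_id: "(\<lambda>z. (fst z, snd z)) \<in> measurable torus (borel \<Otimes>\<^sub>M borel)"
  by (intro measurable_Pair measurable_compose[OF measurable_fst measurable_ident_circ]
      measurable_compose[OF measurable_snd measurable_ident_circ])

lemma measurable_torus_fst: "f \<in> borel_measurable borel \<Longrightarrow> (\<lambda>z. f (fst z)) \<in> borel_measurable torus"
  by (rule measurable_compose[OF measurable_fst measurable_circ])

lemma measurable_torus_snd: "f \<in> borel_measurable borel \<Longrightarrow> (\<lambda>z. f (snd z)) \<in> borel_measurable torus"
  by (rule measurable_compose[OF measurable_snd measurable_circ])

lemma measurable_green_kernel_torus: "(\<lambda>z. green_kernel p q (fst z) (snd z)) \<in> borel_measurable torus"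
  using measurable_compose[OF measurable_torus_id measurable_green_kernel[of p q]] by simp

lemma measurable_green_kernel_section: "(\<lambda>t. green_kernel p q t s) \<in> borel_measurable borel"
  unfolding green_kernel_def by measurable

lemma measurable_green_kernel_section': "(\<lambda>s. green_kernel p q t s) \<in> borel_measurable borel"
  unfolding green_kernel_def by measurable

lemma green_kernel_le:
  assumes "norm (pmf_char p t * complex_of_real (sym_char q s)) \<le> \<rho>" "\<rho> < 1"
  shows "green_kernel p q t s \<le> 1 / (1 - \<rho>)"
proof -
  let ?z = "pmf_char p t * complex_of_real (sym_char q s)"
  have "1 - \<rho> \<le> norm (1 - ?z)"
    using assms norm_triangle_ineq2[of 1 ?z] by simp
  then have "norm (1 / (1 - ?z)) \<le> 1 / (1 - \<rho>)"
    using assms(2) by (simp add: norm_divide frac_le)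
  then show ?thesis unfolding green_kernel_def using complex_Re_le_cmod[of "1 / (1 - ?z)"] by linarith
qed

text \<open>The finite sum is the Green function of the planar walk at 0, in product form.
  Nondegeneracy gives \<open>\<bar>sym_char q s\<bar> < 1\<close> almost everywhere, so that the
  geometric series converges.\<close>

locale transient_pair =
  fixes p q :: "int pmf"
  assumes sym: "map_pmf uminus q = q"
    and nondegenerate: "q \<noteq> return_pmf 0"
    and green_finite: "(\<Sum>n. ennreal (pmf (walk_pmf p n) 0) * ennreal (pmf (walk_pmf q n) 0)) < \<infinity>"
begin

abbreviation "u n x \<equiv> pmf (walk_pmf p n) x"
abbreviation "K \<equiv> green_kernel p q"

lemma nn_integral_green_kernel_section:
  assumes s: "\<bar>sym_char q s\<bar> < 1"
  shows "(\<integral>\<^sup>+t. ennreal (K t s) \<partial>circ) \<le> (\<Sum>n. ennreal (2 * pi * u n 0 * \<bar>sym_char q s\<bar> ^ n))"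
proof -
  have int: "integrable circ (\<lambda>t. K t s)"
  proof (rule integrable_circ_bounded)
    show "(\<lambda>t. K t s) \<in> borel_measurable circ"
      by (rule measurable_circ[OF measurable_green_kernel_section])
    fix t
    have "norm (pmf_char p t * complex_of_real (sym_char q s)) \<le> \<bar>sym_char q s\<bar>"
      using mult_right_mono[OF norm_pmf_char_le[of p t], of "\<bar>sym_char q s\<bar>"] by (simp add: norm_mult)
    from green_kernel_le[OF this s] green_kernel_nonneg[of p q t s]
    show "norm (K t s) \<le> 1 / (1 - \<bar>sym_char q s\<bar>)" by simp
  qed
  have S: "summable (\<lambda>n. 2 * pi * u n 0 * \<bar>sym_char q s\<bar> ^ n)"
  proof (rule summable_comparison_test'[where g = "\<lambda>n. 2 * pi * \<bar>sym_char q s\<bar> ^ n" and N = 0])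
    show "summable (\<lambda>n. 2 * pi * \<bar>sym_char q s\<bar> ^ n)" using s by (intro summable_mult summable_geometric) auto
    show "norm (2 * pi * u n 0 * \<bar>sym_char q s\<bar> ^ n) \<le> 2 * pi * \<bar>sym_char q s\<bar> ^ n" for n
      using pmf_le_1[of "walk_pmf p n" 0] by (simp add: abs_mult mult_left_le_one_le)
  qed
  have "(\<lambda>n. weight_coeff p (\<lambda>_. 1) n * sym_char q s ^ n) sums (\<integral>t. 1 * K t s \<partial>circ)"
    by (rule integral_weight_green_kernel[OF s]) auto
  then have eq: "(\<lambda>n. 2 * pi * u n 0 * sym_char q s ^ n) sums (\<integral>t. K t s \<partial>circ)"
    by (simp add: weight_coeff_one)
  have "(\<integral>\<^sup>+t. ennreal (K t s) \<partial>circ) = ennreal (\<integral>t. K t s \<partial>circ)"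
    by (rule nn_integral_eq_integral[OF int]) (simp add: green_kernel_nonneg)
  also have "\<dots> \<le> ennreal (\<Sum>n. 2 * pi * u n 0 * \<bar>sym_char q s\<bar> ^ n)"
  proof (rule ennreal_leI, rule sums_le[OF _ eq summable_sums[OF S]])
    fix n
    have "sym_char q s ^ n \<le> \<bar>sym_char q s\<bar> ^ n" by (simp add: power_abs[symmetric])
    then show "2 * pi * u n 0 * sym_char q s ^ n \<le> 2 * pi * u n 0 * \<bar>sym_char q s\<bar> ^ n"
      by (intro mult_left_mono) auto
  qed
  also have "\<dots> = (\<Sum>n. ennreal (2 * pi * u n 0 * \<bar>sym_char q s\<bar> ^ n))"
    using S by (intro suminf_ennreal2[symmetric]) auto
  finally show ?thesis .
qed

text \<open>The kernel is nonnegative, so \<open>t\<close> may be integrated first. For almost every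
  \<open>s\<close> this leaves a series of powers of \<open>\<bar>sym_char q s\<bar>\<close>
  weighted by return probabilities of \<open>p\<close>; integrating in \<open>s\<close> gives
  \<open>mean_power\<close>, and transience makes the result finite.\<close>

lemma integrable_green_kernel: "integrable torus (\<lambda>z. K (fst z) (snd z))"
proof (rule integrableI_bounded)
  interpret pair_sigma_finite circ circ by (rule pair_sigma_finite_circ)
  show m: "(\<lambda>z. K (fst z) (snd z)) \<in> borel_measurable torus" by (rule measurable_green_kernel_torus)
  have "(\<integral>\<^sup>+z. ennreal (norm (K (fst z) (snd z))) \<partial>torus) = (\<integral>\<^sup>+s. \<integral>\<^sup>+t. ennreal (K t s) \<partial>circ \<partial>circ)"
    using nn_integral_snd[of "\<lambda>z. ennreal (K (fst z) (snd z))"] m by (simp add: green_kernel_nonneg)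
  also have "\<dots> \<le> (\<integral>\<^sup>+s. (\<Sum>n. ennreal (2 * pi * u n 0 * \<bar>sym_char q s\<bar> ^ n)) \<partial>circ)"
    using AE_abs_sym_char_less[OF sym nondegenerate]
    by (intro nn_integral_mono_AE) (auto elim!: eventually_mono intro!: nn_integral_green_kernel_section)
  also have "\<dots> = (\<Sum>n. \<integral>\<^sup>+s. ennreal (2 * pi * u n 0 * \<bar>sym_char q s\<bar> ^ n) \<partial>circ)"
  proof (rule nn_integral_suminf)
    fix n
    have "(\<lambda>s. ennreal (2 * pi * u n 0 * \<bar>sym_char q s\<bar> ^ n)) \<in> borel_measurable borel" by measurable
    then show "(\<lambda>s. ennreal (2 * pi * u n 0 * \<bar>sym_char q s\<bar> ^ n)) \<in> borel_measurable circ"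
      by (rule measurable_compose[OF measurable_ident_circ])
  qed
  also have "\<dots> = (\<Sum>n. ennreal (4 * pi\<^sup>2 * (u n 0 * mean_power q n)))"
  proof (rule suminf_cong)
    fix n
    have "(\<integral>\<^sup>+s. ennreal (2 * pi * u n 0 * \<bar>sym_char q s\<bar> ^ n) \<partial>circ) = ennreal (\<integral>s. 2 * pi * u n 0 * \<bar>sym_char q s\<bar> ^ n \<partial>circ)"
      by (intro nn_integral_eq_integral integrable_mult_right integrable_abs_sym_char_power) auto
    also have "(\<integral>s. 2 * pi * u n 0 * \<bar>sym_char q s\<bar> ^ n \<partial>circ) = 4 * pi\<^sup>2 * (u n 0 * mean_power q n)"
      by (simp add: mean_power_def power2_eq_square)
    finally show "(\<integral>\<^sup>+s. ennreal (2 * pi * u n 0 * \<bar>sym_char q s\<bar> ^ n) \<partial>circ) = ennreal (4 * pi\<^sup>2 * (u n 0 * mean_power q n))" .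
  qed
  also have "\<dots> = ennreal (\<Sum>n. 4 * pi\<^sup>2 * (u n 0 * mean_power q n))"
    using summable_visits_mean_power[OF sym green_finite, of 0] mean_power_nonneg
    by (intro suminf_ennreal2 summable_mult) auto
  also have "\<dots> < \<infinity>" by simp
  finally show "(\<integral>\<^sup>+z. ennreal (norm (K (fst z) (snd z))) \<partial>torus) < \<infinity>" .
qed

definition "integrand r z = tail_fun q r (snd z) * K (fst z) (snd z)"

lemma measurable_integrand:
  assumes r: "0 \<le> r" "r < 1"
  shows "integrand r \<in> borel_measurable torus"
  unfolding integrand_def
  by (intro borel_measurable_times measurable_green_kernel_torus measurable_torus_snd measurable_tail_fun r)

lemma integrable_integrand:
  assumes r: "0 \<le> r" "r < 1"
  shows "integrable torus (integrand r)"
proof (rule Bochner_Integration.integrable_bound)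
  show "integrable torus (\<lambda>z. 1 / (1 - r) * K (fst z) (snd z))"
    by (intro integrable_mult_right integrable_green_kernel)
  show "AE z in torus. norm (integrand r z) \<le> norm (1 / (1 - r) * K (fst z) (snd z))"
  proof (rule AE_I2)
    fix z
    have "\<bar>tail_fun q r (snd z)\<bar> * K (fst z) (snd z) \<le> 1 / (1 - r) * K (fst z) (snd z)"
      by (intro mult_right_mono abs_tail_fun_le r green_kernel_nonneg)
    then show "norm (integrand r z) \<le> norm (1 / (1 - r) * K (fst z) (snd z))"
      using r green_kernel_nonneg[of p q "fst z" "snd z"] by (simp add: integrand_def abs_mult)
  qed
qed (rule measurable_integrand[OF r])

lemma integrable_weight_integrand:
  assumes r: "0 \<le> r" "r < 1" and g: "g \<in> borel_measurable torus" and bd: "\<And>z. \<bar>g z\<bar> \<le> B"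
  shows "integrable torus (\<lambda>z. g z * integrand r z)"
proof (rule Bochner_Integration.integrable_bound)
  show "integrable torus (\<lambda>z. B * integrand r z)"
    by (intro integrable_mult_right integrable_integrand r)
  show "(\<lambda>z. g z * integrand r z) \<in> borel_measurable torus"
    by (intro borel_measurable_times g measurable_integrand r)
  have B: "0 \<le> B" using order_trans[OF abs_ge_zero bd] .
  show "AE z in torus. norm (g z * integrand r z) \<le> norm (B * integrand r z)"
  proof (rule AE_I2)
    fix z
    have "\<bar>g z\<bar> * \<bar>integrand r z\<bar> \<le> B * \<bar>integrand r z\<bar>" by (intro mult_right_mono bd) auto
    then show "norm (g z * integrand r z) \<le> norm (B * integrand r z)" using B by (simp add: abs_mult)
  qed
qed

text \<open>For fixed \<open>r\<close> the tail function is at most \<open>1 / (1 - r)\<close>, so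
  summability of the coefficients against \<open>mean_power\<close> justifies integrating the series
  termwise in \<open>s\<close>; the integral in \<open>t\<close> is a geometric series for almost
  every \<open>s\<close>.\<close>

lemma integral_weight_integrand:
  assumes r: "0 \<le> r" "r < 1" and \<psi>: "\<psi> \<in> borel_measurable borel" "\<And>t. \<bar>\<psi> t\<bar> \<le> 1"
    and c: "summable (\<lambda>n. \<bar>weight_coeff p \<psi> n\<bar> * mean_power q n)"
  shows "(\<lambda>n. weight_coeff p \<psi> n * (2 * pi * half_sum q n r)) sums (\<integral>z. \<psi> (fst z) * integrand r z \<partial>torus)"
proof -
  interpret pair_sigma_finite circ circ by (rule pair_sigma_finite_circ)
  let ?c = "weight_coeff p \<psi>"
  let ?f = "\<lambda>n s. tail_fun q r s * (?c n * sym_char q s ^ n)"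
  have mf: "?f n \<in> borel_measurable circ" for n
    by (intro measurable_circ borel_measurable_times measurable_tail_fun r borel_measurable_const borel_measurable_power measurable_sym_char)
  have int: "integrable torus (\<lambda>z. \<psi> (fst z) * integrand r z)"
    by (rule integrable_weight_integrand[OF r measurable_torus_fst[OF \<psi>(1)] \<psi>(2)])
  have ae: "AE s in circ. (\<lambda>n. ?f n s) sums (\<integral>t. \<psi> t * integrand r (t, s) \<partial>circ)"
    using AE_abs_sym_char_less[OF sym nondegenerate]
  proof eventually_elim
    case (elim s)
    have "(\<integral>t. \<psi> t * integrand r (t, s) \<partial>circ) = tail_fun q r s * (\<integral>t. \<psi> t * K t s \<partial>circ)"
      unfolding integral_mult_right_zero[symmetric] by (simp add: integrand_def ac_simps)
    then show ?case using sums_mult[OF integral_weight_green_kernel[OF elim \<psi>], of "tail_fun q r s" p] by simp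
  qed
  have f_le: "\<bar>?f n s\<bar> \<le> 1 / (1 - r) * (\<bar>?c n\<bar> * \<bar>sym_char q s\<bar> ^ n)" for n s
    unfolding abs_mult power_abs using abs_tail_fun_le[OF r, of q s] by (intro mult_right_mono) auto
  have f_int: "integrable circ (?f n)" for n
  proof (rule Bochner_Integration.integrable_bound[OF _ mf])
    show "integrable circ (\<lambda>s. 1 / (1 - r) * (\<bar>?c n\<bar> * \<bar>sym_char q s\<bar> ^ n))"
      by (intro integrable_mult_right integrable_abs_sym_char_power)
    show "AE s in circ. norm (?f n s) \<le> norm (1 / (1 - r) * (\<bar>?c n\<bar> * \<bar>sym_char q s\<bar> ^ n))"
      using f_le r by (intro AE_I2) (simp add: abs_mult)
  qed
  have "(\<lambda>n. \<integral>s. ?f n s \<partial>circ) sums (\<integral>s. (\<Sum>n. ?f n s) \<partial>circ)"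
  proof (rule sums_integral[OF f_int])
    show "AE s in circ. summable (\<lambda>n. norm (?f n s))"
      using AE_abs_sym_char_less[OF sym nondegenerate]
    proof eventually_elim
      case (elim s)
      have c_le: "\<bar>?c n\<bar> \<le> 2 * pi" for n
      proof -
        have "norm (?c n) \<le> (\<integral>t. norm (\<psi> t * Re (pmf_char p t ^ n)) \<partial>circ)"
          unfolding weight_coeff_def by (rule integral_norm_bound)
        also have "\<dots> \<le> (\<integral>t. 1 \<partial>circ)"
        proof (rule integral_mono')
          show "integrable circ (\<lambda>t. 1 :: real)" by (rule integrable_circ_bounded[of _ 1]) auto
          fix t
          have "\<bar>\<psi> t\<bar> * \<bar>Re (pmf_char p t ^ n)\<bar> \<le> 1 * 1"
            by (intro mult_mono \<psi>(2) abs_Re_power_le) auto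
          then show "norm (\<psi> t * Re (pmf_char p t ^ n)) \<le> 1" by (simp add: abs_mult)
        qed simp
        finally show ?thesis by (simp add: measure_circ)
      qed
      show ?case
      proof (rule summable_comparison_test'[where g = "\<lambda>n. 1 / (1 - r) * (2 * pi * \<bar>sym_char q s\<bar> ^ n)" and N = 0])
        show "summable (\<lambda>n. 1 / (1 - r) * (2 * pi * \<bar>sym_char q s\<bar> ^ n))"
          using elim by (intro summable_mult summable_geometric) auto
        fix n
        have "1 / (1 - r) * (\<bar>?c n\<bar> * \<bar>sym_char q s\<bar> ^ n) \<le> 1 / (1 - r) * (2 * pi * \<bar>sym_char q s\<bar> ^ n)"
          using r c_le by (intro mult_left_mono mult_right_mono) auto
        then show "norm (norm (?f n s)) \<le> 1 / (1 - r) * (2 * pi * \<bar>sym_char q s\<bar> ^ n)"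
          using f_le[where n = n and s = s] by simp
      qed
    qed
    show "summable (\<lambda>n. \<integral>s. norm (?f n s) \<partial>circ)"
    proof (rule summable_comparison_test'[where g = "\<lambda>n. 1 / (1 - r) * (2 * pi * (\<bar>?c n\<bar> * mean_power q n))" and N = 0])
      show "summable (\<lambda>n. 1 / (1 - r) * (2 * pi * (\<bar>?c n\<bar> * mean_power q n)))"
        by (intro summable_mult c)
      fix n
      have "(\<integral>s. norm (?f n s) \<partial>circ) \<le> (\<integral>s. 1 / (1 - r) * (\<bar>?c n\<bar> * \<bar>sym_char q s\<bar> ^ n) \<partial>circ)"
        using f_le by (intro integral_mono integrable_norm f_int integrable_mult_right integrable_abs_sym_char_power) simp
      also have "\<dots> = 1 / (1 - r) * (2 * pi * (\<bar>?c n\<bar> * mean_power q n))"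
        by (simp add: mean_power_def)
      finally show "norm (\<integral>s. norm (?f n s) \<partial>circ) \<le> 1 / (1 - r) * (2 * pi * (\<bar>?c n\<bar> * mean_power q n))"
        by simp
    qed
  qed
  moreover have "(\<integral>s. (\<Sum>n. ?f n s) \<partial>circ) = (\<integral>z. \<psi> (fst z) * integrand r z \<partial>torus)"
  proof -
    have "(\<integral>z. \<psi> (fst z) * integrand r z \<partial>torus) = (\<integral>s. \<integral>t. \<psi> t * integrand r (t, s) \<partial>circ \<partial>circ)"
      using integral_snd[of "\<lambda>t s. \<psi> t * integrand r (t, s)"] int by (simp add: split_beta')
    also have "\<dots> = (\<integral>s. (\<Sum>n. ?f n s) \<partial>circ)"
    proof (rule integral_cong_AE)
      show "(\<lambda>s. \<integral>t. \<psi> t * integrand r (t, s) \<partial>circ) \<in> borel_measurable circ"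
        using integrable_snd[of "\<lambda>t s. \<psi> t * integrand r (t, s)"] int by (simp add: split_beta' borel_measurable_integrable)
      show "(\<lambda>s. \<Sum>n. ?f n s) \<in> borel_measurable circ"
        by (rule borel_measurable_suminf[OF mf])
      show "AE s in circ. (\<integral>t. \<psi> t * integrand r (t, s) \<partial>circ) = (\<Sum>n. ?f n s)"
        using ae by eventually_elim (simp add: sums_iff)
    qed
    finally show ?thesis ..
  qed
  moreover have "(\<integral>s. ?f n s \<partial>circ) = ?c n * (2 * pi * half_sum q n r)" for n
  proof -
    have "(\<integral>s. ?f n s \<partial>circ) = ?c n * (\<integral>s. tail_fun q r s * sym_char q s ^ n \<partial>circ)"
      unfolding integral_mult_right_zero[symmetric] by (simp add: ac_simps)
    then show ?thesis by (simp add: integral_tail_fun_sym_char_power[OF sym r])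
  qed
  ultimately show ?thesis by simp
qed

lemma sin_half_ge:
  assumes "0 < e" "e \<le> pi" "e \<le> \<bar>s\<bar>" "\<bar>s\<bar> \<le> pi"
  shows "sin (e / 2) \<le> \<bar>sin (s / 2)\<bar>" "0 < sin (e / 2)"
proof -
  have "sin (e / 2) \<le> sin (\<bar>s\<bar> / 2)" using assms by (intro sin_monotone_2pi_le) auto
  also have "\<dots> \<le> \<bar>sin (s / 2)\<bar>" by (simp add: abs_if)
  finally show "sin (e / 2) \<le> \<bar>sin (s / 2)\<bar>" .
  show "0 < sin (e / 2)" using assms by (intro sin_gt_zero) auto
qed

text \<open>Away from the line \<open>s = 0\<close> the tail function is bounded uniformly in \<open>r\<close> and the kernel is
  integrable, so only a strip around that line matters.\<close>

lemma strip_comparison: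
  assumes \<psi>: "\<psi> \<in> borel_measurable borel" "\<And>t. \<bar>\<psi> t\<bar> \<le> 1"
    and c: "summable (\<lambda>n. \<bar>weight_coeff p \<psi> n\<bar> * mean_power q n)"
    and U: "U \<in> sets borel" "{- e..e} \<subseteq> U" and e: "0 < e" "e \<le> pi"
    and strip: "\<And>r. 0 \<le> r \<Longrightarrow> r < 1 \<Longrightarrow>
       \<bar>\<integral>t. (indicator U t - \<psi> t) * (\<integral>s. indicator {- e..e} s * integrand r (t, s) \<partial>circ) \<partial>circ\<bar> \<le> C"
  shows "\<exists>C'. \<forall>r. 0 \<le> r \<longrightarrow> r < 1 \<longrightarrow>
    \<bar>(\<integral>t. indicator U t * (\<integral>s. indicator U s * integrand r (t, s) \<partial>circ) \<partial>circ) -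
      (\<Sum>n. weight_coeff p \<psi> n * (2 * pi * half_sum q n r))\<bar> \<le> C'"
proof (intro exI allI impI)
  fix r :: real assume r: "0 \<le> r" "r < 1"
  interpret pair_sigma_finite circ circ by (rule pair_sigma_finite_circ)
  let ?W = "{- e..e}"
  have indm: "(\<lambda>z. indicator A (fst z) :: real) \<in> borel_measurable torus" "(\<lambda>z. indicator A (snd z) :: real) \<in> borel_measurable torus"
    if "A \<in> sets borel" for A
    using that by (intro measurable_torus_fst measurable_torus_snd borel_measurable_indicator; simp)+
  have \<psi>m: "(\<lambda>z. \<psi> (fst z)) \<in> borel_measurable torus" by (rule measurable_torus_fst[OF \<psi>(1)])
  have W: "?W \<in> sets borel" by simp
  have i1: "integrable torus (\<lambda>z. (indicator U (fst z) * indicator U (snd z)) * integrand r z)"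
  proof (rule integrable_weight_integrand[OF r, where B = 1])
    show "(\<lambda>z. indicator U (fst z) * indicator U (snd z) :: real) \<in> borel_measurable torus"
      by (intro borel_measurable_times indm U)
  qed (auto simp: indicator_def)
  have i2: "integrable torus (\<lambda>z. \<psi> (fst z) * integrand r z)"
    by (rule integrable_weight_integrand[OF r \<psi>m \<psi>(2)])
  have bd2: "\<bar>indicator U t * a - \<psi> t\<bar> \<le> 2" if "\<bar>a\<bar> \<le> 1" for t a
    using \<psi>(2)[of t] that by (auto simp: indicator_def)
  \<comment> \<open>\<open>g1\<close> lives off the strip \<open>\<bar>s\<bar> \<le> e\<close> and
    \<open>g2\<close> on it. On the strip the indicator of \<open>U\<close> in \<open>s\<close> is 1
    because \<open>{- e..e} \<subseteq> U\<close>, so there only the difference of weights in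
    \<open>t\<close> remains.\<close>
  define g1 where "g1 z = (indicator U (fst z) * indicator U (snd z) - \<psi> (fst z)) * (1 - indicator ?W (snd z) :: real)" for z
  define g2 where "g2 z = (indicator U (fst z) - \<psi> (fst z)) * (indicator ?W (snd z) :: real)" for z
  have g1m: "g1 \<in> borel_measurable torus" and g2m: "g2 \<in> borel_measurable torus"
    unfolding g1_def g2_def
    by (intro borel_measurable_times borel_measurable_diff borel_measurable_const indm U W \<psi>m)+
  have g1b: "\<bar>g1 z\<bar> \<le> 2" and g2b: "\<bar>g2 z\<bar> \<le> 2" for z
    using bd2[of "indicator U (snd z)" "fst z"] bd2[of 1 "fst z"] by (auto simp: g1_def g2_def indicator_def)
  have i3: "integrable torus (\<lambda>z. g1 z * integrand r z)" and i4: "integrable torus (\<lambda>z. g2 z * integrand r z)"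
    by (rule integrable_weight_integrand[OF r g1m g1b]) (rule integrable_weight_integrand[OF r g2m g2b])
  have I: "(\<integral>t. indicator U t * (\<integral>s. indicator U s * integrand r (t, s) \<partial>circ) \<partial>circ) =
      (\<integral>z. (indicator U (fst z) * indicator U (snd z)) * integrand r z \<partial>torus)"
    using integral_fst'[OF i1] by (simp add: mult.assoc)
  have J: "(\<Sum>n. weight_coeff p \<psi> n * (2 * pi * half_sum q n r)) = (\<integral>z. \<psi> (fst z) * integrand r z \<partial>torus)"
    using integral_weight_integrand[OF r \<psi> c] by (simp add: sums_iff)
  have "(\<integral>t. indicator U t * (\<integral>s. indicator U s * integrand r (t, s) \<partial>circ) \<partial>circ) -
      (\<Sum>n. weight_coeff p \<psi> n * (2 * pi * half_sum q n r)) =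
      (\<integral>z. (indicator U (fst z) * indicator U (snd z)) * integrand r z - \<psi> (fst z) * integrand r z \<partial>torus)"
    unfolding I J by (rule Bochner_Integration.integral_diff[symmetric, OF i1 i2])
  also have "\<dots> = (\<integral>z. g1 z * integrand r z + g2 z * integrand r z \<partial>torus)"
  proof (rule Bochner_Integration.integral_cong[OF refl])
    fix z
    have "indicator U (fst z) * indicator U (snd z) - \<psi> (fst z) = g1 z + g2 z"
      using U(2) by (auto simp: g1_def g2_def indicator_def)
    then show "(indicator U (fst z) * indicator U (snd z)) * integrand r z - \<psi> (fst z) * integrand r z = g1 z * integrand r z + g2 z * integrand r z"
      by (metis left_diff_distrib distrib_right)
  qed
  also have "\<dots> = (\<integral>z. g1 z * integrand r z \<partial>torus) + (\<integral>z. g2 z * integrand r z \<partial>torus)"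
    by (rule Bochner_Integration.integral_add[OF i3 i4])
  finally have eq: "(\<integral>t. indicator U t * (\<integral>s. indicator U s * integrand r (t, s) \<partial>circ) \<partial>circ) -
      (\<Sum>n. weight_coeff p \<psi> n * (2 * pi * half_sum q n r)) =
      (\<integral>z. g1 z * integrand r z \<partial>torus) + (\<integral>z. g2 z * integrand r z \<partial>torus)" .
  have "norm (\<integral>z. g1 z * integrand r z \<partial>torus) \<le> (\<integral>z. norm (g1 z * integrand r z) \<partial>torus)"
    by (rule integral_norm_bound)
  also have "\<dots> \<le> (\<integral>z. 2 / sin (e / 2) * K (fst z) (snd z) \<partial>torus)"
  proof (rule integral_mono[OF integrable_norm[OF i3] integrable_mult_right[OF integrable_green_kernel]])
    fix z assume "z \<in> space torus"
    then have z: "\<bar>snd z\<bar> \<le> pi" by (auto simp: space_pair_measure)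
    show "norm (g1 z * integrand r z) \<le> 2 / sin (e / 2) * K (fst z) (snd z)"
    proof (cases "\<bar>snd z\<bar> \<le> e")
      case True
      then have "g1 z = 0" by (auto simp: g1_def indicator_def)
      moreover have "0 \<le> 2 / sin (e / 2)" using sin_half_ge(2)[of e e] e by simp
      ultimately show ?thesis using green_kernel_nonneg[of p q "fst z" "snd z"] by simp
    next
      case False
      then have s: "sin (e / 2) \<le> \<bar>sin (snd z / 2)\<bar>" "0 < sin (e / 2)"
        using sin_half_ge[of e "snd z"] e z by auto
      have "\<bar>tail_fun q r (snd z)\<bar> \<le> 1 / \<bar>sin (snd z / 2)\<bar>" using s by (intro abs_tail_fun_le_sin r) auto
      also have "\<dots> \<le> 1 / sin (e / 2)" using s by (intro divide_left_mono) auto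
      finally have t: "\<bar>tail_fun q r (snd z)\<bar> \<le> 1 / sin (e / 2)" .
      have "\<bar>g1 z\<bar> * (\<bar>tail_fun q r (snd z)\<bar> * K (fst z) (snd z)) \<le> 2 * (1 / sin (e / 2) * K (fst z) (snd z))"
        by (intro mult_mono g1b t order_refl green_kernel_nonneg mult_nonneg_nonneg) (use s in auto)
      then show ?thesis
        using green_kernel_nonneg[of p q "fst z" "snd z"] by (simp add: integrand_def abs_mult)
    qed
  qed
  finally have b1: "\<bar>\<integral>z. g1 z * integrand r z \<partial>torus\<bar> \<le> (\<integral>z. 2 / sin (e / 2) * K (fst z) (snd z) \<partial>torus)" by simp
  have "(\<integral>z. g2 z * integrand r z \<partial>torus) = (\<integral>t. (indicator U t - \<psi> t) * (\<integral>s. indicator ?W s * integrand r (t, s) \<partial>circ) \<partial>circ)"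
    using integral_fst'[OF i4] by (simp add: g2_def mult.assoc)
  then have b2: "\<bar>\<integral>z. g2 z * integrand r z \<partial>torus\<bar> \<le> C" using strip[OF r] by simp
  show "\<bar>(\<integral>t. indicator U t * (\<integral>s. indicator U s * integrand r (t, s) \<partial>circ) \<partial>circ) -
      (\<Sum>n. weight_coeff p \<psi> n * (2 * pi * half_sum q n r))\<bar> \<le> (\<integral>z. 2 / sin (e / 2) * K (fst z) (snd z) \<partial>torus) + C"
    unfolding eq using abs_triangle_ineq[of "\<integral>z. g1 z * integrand r z \<partial>torus" "\<integral>z. g2 z * integrand r z \<partial>torus"] b1 b2 by linarith
qed

end

section \<open>The strip around the zero line\<close>

lemma integral_circ_even_window:
  fixes F :: "real \<Rightarrow> real"
  assumes e: "0 \<le> e" "e \<le> pi" and F: "continuous_on {- e..e} F" and even: "\<And>s. F (- s) = F s"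
  shows "(\<integral>s. indicator {- e..e} s * F s \<partial>circ) = 2 * integral {0..e} F"
proof -
  have "(\<integral>s. indicator {- e..e} s * F s \<partial>circ) = (LINT s:{- pi..pi}|lborel. indicator {- e..e} s * F s)"
    by (rule integral_circ)
  also have "\<dots> = (LINT s:{- e..e}|lborel. F s)"
    unfolding set_lebesgue_integral_def
    by (intro Bochner_Integration.integral_cong) (use e in \<open>auto simp: indicator_def\<close>)
  also have "\<dots> = integral {- e..e} F"
    by (intro set_borel_integral_eq_integral borel_integrable_atLeastAtMost' F)
  also have "\<dots> = integral {- e..0} F + integral {0..e} F"
    using e F by (intro Henstock_Kurzweil_Integration.integral_combine[symmetric] integrable_continuous_real) auto
  also have "integral {- e..0} F = integral {0..e} F"
    using Henstock_Kurzweil_Integration.integral_reflect_real[of e 0 F] by (simp add: even)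
  finally show ?thesis by simp
qed

text \<open>Multipliers may be summed with their oscillation constants. The crude bound
  \<open>1 / (1 - r)\<close> on the tail function serves only for uniform convergence at fixed
  \<open>r\<close> and leaves no trace in the result.\<close>

lemma osc_mult_series:
  assumes w: "\<And>k. osc_mult q e (w k) (C k)" and wb: "\<And>k s. s \<in> {0..e} \<Longrightarrow> \<bar>w k s\<bar> \<le> C k"
    and sm: "summable (\<lambda>k. \<bar>a k\<bar> * C k)" and G: "\<And>s. s \<in> {0..e} \<Longrightarrow> (\<lambda>k. a k * w k s) sums G s"
    and r: "0 \<le> r" "r < 1" and e: "0 \<le> e"
  shows "\<bar>integral {0..e} (\<lambda>s. tail_fun q r s * G s)\<bar> \<le> (\<Sum>k. \<bar>a k\<bar> * C k)"
proof -
  let ?g = "\<lambda>k s. tail_fun q r s * (a k * w k s)"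
  have "uniform_limit {0..e} (\<lambda>N s. \<Sum>k<N. ?g k s) (\<lambda>s. \<Sum>k. ?g k s) sequentially"
  proof (rule Weierstrass_m_test[where M = "\<lambda>k. 1 / (1 - r) * (\<bar>a k\<bar> * C k)"])
    show "summable (\<lambda>k. 1 / (1 - r) * (\<bar>a k\<bar> * C k))" by (rule summable_mult[OF sm])
    fix k s assume s: "s \<in> {0..e}"
    have "\<bar>tail_fun q r s\<bar> * (\<bar>a k\<bar> * \<bar>w k s\<bar>) \<le> 1 / (1 - r) * (\<bar>a k\<bar> * C k)"
      using r by (intro mult_mono abs_tail_fun_le wb s order_refl mult_nonneg_nonneg) auto
    then show "norm (?g k s) \<le> 1 / (1 - r) * (\<bar>a k\<bar> * C k)" by (simp add: abs_mult)
  qed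
  moreover have "(\<Sum>k. ?g k s) = tail_fun q r s * G s" if "s \<in> {0..e}" for s
    using sums_mult[OF G[OF that], of "tail_fun q r s"] by (simp add: sums_iff)
  moreover from this have "uniform_limit {0..e} (\<lambda>N s. \<Sum>k<N. ?g k s) (\<lambda>s. \<Sum>k. ?g k s) sequentially \<longleftrightarrow>
      uniform_limit {0..e} (\<lambda>N s. \<Sum>k<N. ?g k s) (\<lambda>s. tail_fun q r s * G s) sequentially"
    by (intro uniform_limit_cong') auto
  ultimately have ul: "uniform_limit {0..e} (\<lambda>N s. \<Sum>k<N. ?g k s) (\<lambda>s. tail_fun q r s * G s) sequentially"
    by blast
  have cont: "continuous_on A (?g k)" for A k
    by (intro continuous_intros continuous_on_tail_fun r osc_mult_continuous[OF w])
  obtain I J where I: "\<And>N. ((\<lambda>s. \<Sum>k<N. ?g k s) has_integral I N) {0..e}"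
    and J: "((\<lambda>s. tail_fun q r s * G s) has_integral J) {0..e}"
    and lim: "(I \<longlongrightarrow> J) sequentially"
    by (rule uniform_limit_integral[OF ul continuous_on_sum[OF cont]]) auto
  have le: "\<bar>I N\<bar> \<le> (\<Sum>k. \<bar>a k\<bar> * C k)" for N
  proof -
    have Ck: "0 \<le> C k" for k using order_trans[OF abs_ge_zero wb[of 0 k]] e by simp
    have "I N = integral {0..e} (\<lambda>s. \<Sum>k<N. ?g k s)" by (rule integral_unique[OF I, symmetric])
    also have "\<dots> = (\<Sum>k<N. integral {0..e} (?g k))"
      by (rule integral_sum) (auto intro!: integrable_continuous_real cont)
    also have "\<bar>\<dots>\<bar> \<le> (\<Sum>k<N. \<bar>integral {0..e} (?g k)\<bar>)" by (rule sum_abs)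
    also have "\<dots> \<le> (\<Sum>k<N. \<bar>a k\<bar> * C k)"
    proof (rule sum_mono)
      fix k
      have "integral {0..e} (?g k) = integral {0..e} (\<lambda>s. a k * (tail_fun q r s * w k s * cos (real_of_int 0 * s)))"
        by (intro integral_cong) (simp add: ac_simps)
      also have "\<dots> = a k * integral {0..e} (\<lambda>s. tail_fun q r s * w k s * cos (real_of_int 0 * s))"
        by (rule integral_mult_right)
      finally have "\<bar>integral {0..e} (?g k)\<bar> = \<bar>a k\<bar> * \<bar>integral {0..e} (\<lambda>s. tail_fun q r s * w k s * cos (real_of_int 0 * s))\<bar>"
        by (simp only: abs_mult)
      also have "\<dots> \<le> \<bar>a k\<bar> * C k"
        using osc_multD[OF w r e order_refl, of k 0] by (intro mult_left_mono) auto
      finally show "\<bar>integral {0..e} (?g k)\<bar> \<le> \<bar>a k\<bar> * C k" .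
    qed
    also have "\<dots> \<le> (\<Sum>k. \<bar>a k\<bar> * C k)"
      using Ck by (intro sum_le_suminf sm) auto
    finally show ?thesis .
  qed
  have "\<bar>J\<bar> \<le> (\<Sum>k. \<bar>a k\<bar> * C k)"
    by (rule LIMSEQ_le_const2[OF tendsto_rabs[OF lim]]) (intro exI allI impI le)
  then show ?thesis using J by (simp add: integral_unique)
qed

definition strip_integral :: "int pmf \<Rightarrow> int pmf \<Rightarrow> real \<Rightarrow> real \<Rightarrow> real \<Rightarrow> real" where
  "strip_integral p q e r t = (\<integral>s. indicator {- e..e} s * (tail_fun q r s * green_kernel p q t s) \<partial>circ)"

lemma strip_integral_series_bound:
  assumes w: "\<And>k. osc_mult q e (w k) (C k)" and wb: "\<And>k s. s \<in> {0..e} \<Longrightarrow> \<bar>w k s\<bar> \<le> C k"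
    and sm: "summable (\<lambda>k. \<bar>a k\<bar> * C k)" and G: "\<And>s. s \<in> {0..e} \<Longrightarrow> (\<lambda>k. a k * w k s) sums green_kernel p q t s"
    and nz: "\<And>s. s \<in> {0..e} \<Longrightarrow> pmf_char p t * complex_of_real (sym_char q s) \<noteq> 1"
    and r: "0 \<le> r" "r < 1" and e: "0 \<le> e" "e \<le> pi"
  shows "\<bar>strip_integral p q e r t\<bar> \<le> 2 * (\<Sum>k. \<bar>a k\<bar> * C k)"
proof -
  have nz': "pmf_char p t * complex_of_real (sym_char q s) \<noteq> 1" if "s \<in> {- e..e}" for s
    using nz[of s] nz[of "- s"] that by (cases "0 \<le> s") (simp_all add: sym_char_even)
  have "strip_integral p q e r t = 2 * integral {0..e} (\<lambda>s. tail_fun q r s * green_kernel p q t s)"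
    unfolding strip_integral_def
  proof (rule integral_circ_even_window[OF e])
    show "continuous_on {- e..e} (\<lambda>s. tail_fun q r s * green_kernel p q t s)"
      unfolding green_kernel_def using nz'
      by (intro continuous_intros continuous_on_tail_fun r continuous_on_sym_char) fastforce
  qed (simp add: tail_fun_even green_kernel_even)
  then show ?thesis
    using osc_mult_series[OF w wb sm G r e(1)] by simp
qed

text \<open>Expanding in powers of \<open>sym_char q s\<close>, each of which costs 27, leaves the
  geometric series of \<open>norm (pmf_char p t)\<close>. The two halves of the strip double 27 to
  54.\<close>

lemma strip_integral_le:
  assumes e: "0 \<le> e" "e \<le> pi" and r: "0 \<le> r" "r < 1" and t: "norm (pmf_char p t) < 1"
  shows "\<bar>strip_integral p q e r t\<bar> \<le> 54 / (1 - norm (pmf_char p t))"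
proof -
  let ?\<rho> = "norm (pmf_char p t)"
  have lt: "norm (pmf_char p t * complex_of_real (sym_char q s)) < 1" for s
    using mult_left_mono[OF abs_sym_char_le[of q s], of ?\<rho>] t by (simp add: norm_mult)
  have a_le: "\<bar>Re (pmf_char p t ^ n)\<bar> * 27 \<le> 27 * ?\<rho> ^ n" for n
    using abs_Re_le_cmod[of "pmf_char p t ^ n"] by (simp add: norm_power)
  have S: "summable (\<lambda>n. 27 * ?\<rho> ^ n)" using t by (intro summable_mult summable_geometric) auto
  have sm: "summable (\<lambda>n. \<bar>Re (pmf_char p t ^ n)\<bar> * 27)"
    by (rule summable_comparison_test'[OF S, of 0]) (use a_le in simp)
  have "\<bar>strip_integral p q e r t\<bar> \<le> 2 * (\<Sum>n. \<bar>Re (pmf_char p t ^ n)\<bar> * 27)"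
  proof (rule strip_integral_series_bound[where w = "\<lambda>n s. sym_char q s ^ n" and a = "\<lambda>n. Re (pmf_char p t ^ n)"])
    show "osc_mult q e (\<lambda>s. sym_char q s ^ k) 27" for k by (rule osc_mult_sym_char_power[OF e])
    show "\<bar>sym_char q s ^ k\<bar> \<le> 27" for s k
      using power_le_one[OF abs_ge_zero abs_sym_char_le, of q s k] by (simp add: power_abs)
    show "(\<lambda>k. Re (pmf_char p t ^ k) * sym_char q s ^ k) sums green_kernel p q t s" for s
      by (rule green_kernel_sums[OF lt])
    show "pmf_char p t * complex_of_real (sym_char q s) \<noteq> 1" for s
      using lt[of s] by auto
  qed (rule sm r e)+
  also have "(\<Sum>n. \<bar>Re (pmf_char p t ^ n)\<bar> * 27) \<le> (\<Sum>n. 27 * ?\<rho> ^ n)"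
    by (rule suminf_le[OF a_le sm S])
  also have "(\<Sum>n. 27 * ?\<rho> ^ n) = 27 / (1 - ?\<rho>)"
    using t by (subst suminf_mult) (auto simp: suminf_geometric summable_geometric)
  finally show ?thesis by simp
qed

text \<open>Where \<open>\<phi>\<^sub>H(t)\<close> stays away from \<open>1\<close>, expand in powers of \<open>1 - \<phi>\<^sub>V(s)\<close>, small for \<open>s\<close> near \<open>0\<close>.\<close>

lemma strip_integral_away_from_one:
  assumes \<kappa>: "\<kappa> > 0" and b: "0 < b"
  shows "\<exists>e>0. e \<le> b \<and> (\<forall>r t. 0 \<le> r \<longrightarrow> r < 1 \<longrightarrow> norm (1 - pmf_char p t) \<ge> \<kappa> \<longrightarrow> \<bar>strip_integral p q e r t\<bar> \<le> 108 / \<kappa>)"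
proof -
  obtain e0 where e0: "e0 > 0" "e0 \<le> pi" and small0: "\<And>s. s \<in> {0..e0} \<Longrightarrow> \<bar>1 - sym_char q s\<bar> \<le> \<kappa> / 2"
    and osc0: "\<And>k. osc_mult q e0 (\<lambda>s. (1 - sym_char q s) ^ k) (27 * (\<kappa> / 2) ^ k)"
    using osc_mult_gap_power[of "\<kappa> / 2" q] \<kappa> by auto
  define e where "e = min e0 b"
  have e: "e > 0" "e \<le> pi" "e \<le> b" and small: "\<And>s. s \<in> {0..e} \<Longrightarrow> \<bar>1 - sym_char q s\<bar> \<le> \<kappa> / 2"
    using e0 b small0 by (auto simp: e_def)
  have osc: "osc_mult q e (\<lambda>s. (1 - sym_char q s) ^ k) (27 * (\<kappa> / 2) ^ k)" for k
    using osc0[of k] by (auto simp: osc_mult_def e_def)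
  have "\<bar>strip_integral p q e r t\<bar> \<le> 108 / \<kappa>" if r: "0 \<le> r" "r < 1" and t: "norm (1 - pmf_char p t) \<ge> \<kappa>" for r t
  proof -
    let ?z = "pmf_char p t"
    have z1: "1 - ?z \<noteq> 0" using t \<kappa> by auto
    \<comment> \<open>With \<open>z = pmf_char p t\<close> and \<open>y = sym_char q s\<close>,
      write \<open>1 - z * y = (1 - z) + z * (1 - y)\<close> and expand in powers of
      \<open>1 - y\<close>. Coefficients of order \<open>(1 / \<kappa>) ^ Suc k\<close> meet
      constants \<open>27 * (\<kappa> / 2) ^ k\<close>, a geometric series of ratio 1/2; summing it
      and doubling for the two halves gives \<open>108 / \<kappa>\<close>.\<close>
    define a where "a k = Re ((- ?z) ^ k / (1 - ?z) ^ Suc k)" for k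
    have a_le: "\<bar>a k\<bar> \<le> (1 / \<kappa>) ^ Suc k" for k
    proof -
      have "\<bar>a k\<bar> \<le> norm ((- ?z) ^ k / (1 - ?z) ^ Suc k)" unfolding a_def by (rule abs_Re_le_cmod)
      also have "\<dots> = norm ?z ^ k / norm (1 - ?z) ^ Suc k" by (simp add: norm_divide norm_power norm_mult)
      also have "\<dots> \<le> 1 / \<kappa> ^ Suc k"
        using \<kappa> t by (intro frac_le power_le_one norm_pmf_char_le power_mono zero_less_power) auto
      finally show ?thesis by (simp add: power_divide)
    qed
    have aC: "\<bar>a k\<bar> * (27 * (\<kappa> / 2) ^ k) \<le> 27 / \<kappa> * (1 / 2) ^ k" for k
    proof -
      have "\<bar>a k\<bar> * (27 * (\<kappa> / 2) ^ k) \<le> (1 / \<kappa>) ^ Suc k * (27 * (\<kappa> / 2) ^ k)"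
        using \<kappa> by (intro mult_right_mono a_le) auto
      also have "\<dots> = 27 / \<kappa> * (1 / 2) ^ k" using \<kappa> by (simp add: power_divide)
      finally show ?thesis .
    qed
    have S: "summable (\<lambda>k. 27 / \<kappa> * (1 / 2) ^ k)" by (intro summable_mult summable_geometric) auto
    have sm: "summable (\<lambda>k. \<bar>a k\<bar> * (27 * (\<kappa> / 2) ^ k))"
      by (rule summable_comparison_test'[OF S, of 0]) (use aC \<kappa> in \<open>simp add: abs_mult\<close>)
    have w_le: "norm (- ?z * complex_of_real (1 - sym_char q s) / (1 - ?z)) \<le> 1 / 2" if "s \<in> {0..e}" for s
    proof -
      have "norm (- ?z * complex_of_real (1 - sym_char q s) / (1 - ?z)) = norm ?z * \<bar>1 - sym_char q s\<bar> / norm (1 - ?z)"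
        by (simp add: norm_divide norm_mult del: of_real_diff)
      also have "\<dots> \<le> (1 * (\<kappa> / 2)) / \<kappa>"
        using \<kappa> t small[OF that] by (intro frac_le mult_mono norm_pmf_char_le) auto
      also have "\<dots> = 1 / 2" using \<kappa> by simp
      finally show ?thesis .
    qed
    have den: "1 - ?z * complex_of_real (sym_char q s) = (1 - ?z) * (1 - (- ?z * complex_of_real (1 - sym_char q s) / (1 - ?z)))" for s
      using z1 by (simp add: field_simps)
    have "\<bar>strip_integral p q e r t\<bar> \<le> 2 * (\<Sum>k. \<bar>a k\<bar> * (27 * (\<kappa> / 2) ^ k))"
    proof (rule strip_integral_series_bound[where w = "\<lambda>k s. (1 - sym_char q s) ^ k"])
      show "osc_mult q e (\<lambda>s. (1 - sym_char q s) ^ k) (27 * (\<kappa> / 2) ^ k)" for k by (rule osc)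
      fix s assume s: "s \<in> {0..e}"
      let ?y = "- ?z * complex_of_real (1 - sym_char q s) / (1 - ?z)"
      show "\<bar>(1 - sym_char q s) ^ k\<bar> \<le> 27 * (\<kappa> / 2) ^ k" for k
      proof -
        have "\<bar>1 - sym_char q s\<bar> ^ k \<le> (\<kappa> / 2) ^ k" using small[OF s] by (intro power_mono) auto
        moreover have "0 \<le> (\<kappa> / 2) ^ k" using \<kappa> by simp
        ultimately show ?thesis by (simp add: power_abs)
      qed
      have y: "norm ?y < 1" using w_le[OF s] by simp
      have "(\<lambda>k. 1 / (1 - ?z) * ?y ^ k) sums (1 / (1 - ?z) * (1 / (1 - ?y)))"
        by (intro sums_mult geometric_sums y)
      then have "(\<lambda>k. Re (1 / (1 - ?z) * ?y ^ k)) sums Re (1 / (1 - ?z) * (1 / (1 - ?y)))"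
        by (rule sums_Re)
      moreover have "Re (1 / (1 - ?z) * (1 / (1 - ?y))) = green_kernel p q t s"
        unfolding green_kernel_def den by simp
      moreover have "Re (1 / (1 - ?z) * ?y ^ k) = a k * (1 - sym_char q s) ^ k" for k
      proof -
        have "1 / (1 - ?z) * ?y ^ k = (- ?z) ^ k / (1 - ?z) ^ Suc k * complex_of_real ((1 - sym_char q s) ^ k)"
          unfolding power_divide power_mult_distrib of_real_power by (simp only: power_Suc times_divide_times_eq mult_1 times_divide_eq_left divide_divide_eq_left mult.commute[of "(1 - ?z) ^ k" "1 - ?z"])
        then show ?thesis unfolding a_def by (simp only: Re_complex_of_real Im_complex_of_real times_complex.sel mult_zero_right diff_zero)
      qed
      ultimately show "(\<lambda>k. a k * (1 - sym_char q s) ^ k) sums green_kernel p q t s" by simp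
      have "1 - ?y \<noteq> 0"
      proof
        assume "1 - ?y = 0"
        then have "norm ?y = 1" by (metis norm_one right_minus_eq)
        with y show False by linarith
      qed
      then show "?z * complex_of_real (sym_char q s) \<noteq> 1"
        using den[of s] z1 by (metis diff_self mult_eq_0_iff)
    qed (use sm r e in auto)
    also have "(\<Sum>k. \<bar>a k\<bar> * (27 * (\<kappa> / 2) ^ k)) \<le> (\<Sum>k. 27 / \<kappa> * (1 / 2) ^ k)"
      by (rule suminf_le[OF aC sm S])
    also have "(\<Sum>k. 27 / \<kappa> * (1 / 2) ^ k) = 27 / \<kappa> * 2"
      by (subst suminf_mult) (auto simp: suminf_geometric summable_geometric)
    finally show ?thesis by simp
  qed
  then show ?thesis using e by blast
qed

section \<open>The Fejer kernel\<close>

text \<open>Normalised to be 1 at 0. The double sum displays it as a cosine polynomial with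
  nonnegative coefficients, which is how its weight coefficients are computed.\<close>

definition fejer :: "nat \<Rightarrow> real \<Rightarrow> real" where
  "fejer d t = (\<Sum>j<d. \<Sum>k<d. cos (real_of_int (int j - int k) * t)) / (real d)\<^sup>2"

lemma fejer_sq:
  "(\<Sum>j<d. \<Sum>k<d. cos (real_of_int (int j - int k) * t)) = (\<Sum>j<d. cos (real j * t))\<^sup>2 + (\<Sum>j<d. sin (real j * t))\<^sup>2"
proof -
  have "cos (real_of_int (int j - int k) * t) = cos (real j * t) * cos (real k * t) + sin (real j * t) * sin (real k * t)" for j k
    by (simp add: left_diff_distrib cos_diff)
  then show ?thesis by (simp add: power2_eq_square sum_product sum.distrib)
qed

lemma fejer_nonneg: "0 \<le> fejer d t"
  unfolding fejer_def fejer_sq by simp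

lemma fejer_le_1: "d > 0 \<Longrightarrow> fejer d t \<le> 1"
proof -
  assume d: "d > 0"
  have "(\<Sum>j<d. \<Sum>k<d. cos (real_of_int (int j - int k) * t)) \<le> (\<Sum>j<d. \<Sum>k<d. 1)"
    by (intro sum_mono) auto
  also have "\<dots> = (real d)\<^sup>2" by (simp add: power2_eq_square)
  finally show ?thesis using d by (simp add: fejer_def)
qed

lemma fejer_sin:
  assumes "d > 0"
  shows "(sin (t / 2))\<^sup>2 * fejer d t = (sin (real d * t / 2))\<^sup>2 / (real d)\<^sup>2"
proof -
  let ?A = "(real d - 1 / 2) * t" and ?B = "t / 2"
  have c: "2 * sin ?B * (\<Sum>j<d. cos (real j * t)) = sin ?A + sin ?B" by (rule sum_cos_closed)
  have s: "2 * sin ?B * (\<Sum>j<d. sin (real j * t)) = cos ?B - cos ?A"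
  proof -
    have "(real 0 - 1 / 2) * t = - ?B" by simp
    then have "cos ((real 0 - 1 / 2) * t) = cos ?B" by (simp only: cos_minus)
    then show ?thesis using sum_sin_closed[where u = t and n = d and m = 0] by (simp only: add_0_right)
  qed
  have "4 * (sin ?B)\<^sup>2 * ((\<Sum>j<d. cos (real j * t))\<^sup>2 + (\<Sum>j<d. sin (real j * t))\<^sup>2) =
      (2 * sin ?B * (\<Sum>j<d. cos (real j * t)))\<^sup>2 + (2 * sin ?B * (\<Sum>j<d. sin (real j * t)))\<^sup>2"
    by (simp add: power_mult_distrib distrib_left)
  also have "\<dots> = (sin ?A + sin ?B)\<^sup>2 + (cos ?B - cos ?A)\<^sup>2" by (simp only: c s)
  also have "\<dots> = ((sin ?A)\<^sup>2 + (cos ?A)\<^sup>2) + ((sin ?B)\<^sup>2 + (cos ?B)\<^sup>2) - 2 * (cos ?A * cos ?B - sin ?A * sin ?B)"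
    by (simp add: power2_eq_square algebra_simps)
  also have "\<dots> = 2 - 2 * cos (?A + ?B)" by (simp add: cos_add)
  also have "?A + ?B = 2 * (real d * t / 2)" by (simp add: algebra_simps)
  also have "2 - 2 * cos (2 * (real d * t / 2)) = 4 * (sin (real d * t / 2))\<^sup>2"
    using cos_double_sin[of "real d * t / 2"] by simp
  finally show ?thesis
    unfolding fejer_def fejer_sq using assms by (simp add: field_simps)
qed

lemma one_minus_fejer_le:
  assumes "d > 0"
  shows "1 - fejer d t \<le> (real d)\<^sup>2 * t\<^sup>2 / 2"
proof -
  have c: "1 - (real d)\<^sup>2 * t\<^sup>2 / 2 \<le> cos (real_of_int (int j - int k) * t)" if "j < d" "k < d" for j k
  proof -
    let ?m = "real_of_int (int j - int k)"
    have "\<bar>?m\<bar> \<le> real d" using that by auto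
    then have "?m\<^sup>2 \<le> (real d)\<^sup>2" by (simp add: abs_le_square_iff[symmetric])
    then have "?m\<^sup>2 * t\<^sup>2 \<le> (real d)\<^sup>2 * t\<^sup>2" by (intro mult_right_mono) auto
    moreover have "cos (?m * t) = 1 - 2 * (sin (?m * t / 2))\<^sup>2" using cos_double_sin[of "?m * t / 2"] by simp
    moreover have "(sin (?m * t / 2))\<^sup>2 \<le> (?m * t / 2)\<^sup>2"
      using abs_sin_x_le_abs_x[of "?m * t / 2"] by (simp only: abs_le_square_iff[symmetric])
    ultimately show ?thesis by (simp add: power_mult_distrib power_divide)
  qed
  have "(real d)\<^sup>2 * (1 - (real d)\<^sup>2 * t\<^sup>2 / 2) = (\<Sum>j<d. \<Sum>k<d. 1 - (real d)\<^sup>2 * t\<^sup>2 / 2)"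
    by (simp add: power2_eq_square)
  also have "\<dots> \<le> (\<Sum>j<d. \<Sum>k<d. cos (real_of_int (int j - int k) * t))"
    by (intro sum_mono c) auto
  finally have "1 - (real d)\<^sup>2 * t\<^sup>2 / 2 \<le> fejer d t"
    using assms by (simp add: fejer_def field_simps)
  then show ?thesis by simp
qed

text \<open>Three regions. For \<open>\<bar>t\<bar> \<le> e\<close> the difference is
  \<open>1 - fejer d t\<close>, of order \<open>t\<^sup>2\<close>. Outside \<open>U\<close> it is
  the kernel itself, proportional to \<open>(sin (real d * t / 2))\<^sup>2\<close> with
  \<open>sin (t / 2)\<close> bounded away from 0. On the rest of \<open>U\<close> it is at most 1,
  and since \<open>\<bar>t\<bar> < pi / real d\<close> the sine stays away from its zeros.\<close>

lemma indicator_minus_fejer_le: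
  assumes d: "d > 0" and e: "0 < e" and U: "{- e..e} \<subseteq> U" "U \<subseteq> {- (pi / real d)<..<pi / real d}"
  shows "\<exists>C. \<forall>t\<in>{- pi..pi}. \<bar>indicator U t - fejer d t\<bar> \<le> C * (sin (real d * t / 2))\<^sup>2"
proof -
  have "e \<in> U" using U(1) e by auto
  then have e_lt: "e < pi / real d" using U(2) by auto
  then have de: "real d * e < pi" using d by (simp add: field_simps)
  have e_pi: "e < pi"
  proof -
    have "pi / real d \<le> pi / 1" using d by (intro divide_left_mono) auto
    then show ?thesis using e_lt by simp
  qed
  define C1 where "C1 = 1 / (sin (e / 2))\<^sup>2"
  define C2 where "C2 = 1 / (sin (real d * e / 2))\<^sup>2"
  have s1: "sin (e / 2) > 0" using e e_pi by (intro sin_gt_zero) auto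
  have s2: "sin (real d * e / 2) > 0" using e d de pi_gt_zero by (intro sin_gt_zero) (simp, linarith)
  have C: "C1 \<ge> 0" "C2 \<ge> 0" by (auto simp: C1_def C2_def)
  have f: "0 \<le> fejer d t" "fejer d t \<le> 1" for t using fejer_nonneg fejer_le_1[OF d] by auto
  have "\<bar>indicator U t - fejer d t\<bar> \<le> (C1 + C2 + 8) * (sin (real d * t / 2))\<^sup>2" if t: "t \<in> {- pi..pi}" for t
  proof -
    let ?S = "(sin (real d * t / 2))\<^sup>2"
    have S: "0 \<le> ?S" by simp
    consider "\<bar>t\<bar> \<le> e" | "\<bar>t\<bar> > e" "t \<notin> U" | "\<bar>t\<bar> > e" "t \<in> U" by linarith
    then have "\<bar>indicator U t - fejer d t\<bar> \<le> 8 * ?S \<or> \<bar>indicator U t - fejer d t\<bar> \<le> C1 * ?S \<or> \<bar>indicator U t - fejer d t\<bar> \<le> C2 * ?S"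
    proof cases
      case 1
      then have "t \<in> {- e..e}" by (simp add: abs_le_iff)
      then have "t \<in> U" using U(1) by blast
      then have "\<bar>indicator U t - fejer d t\<bar> \<le> (real d)\<^sup>2 * t\<^sup>2 / 2"
        using f[of t] one_minus_fejer_le[OF d, of t] by simp
      also have "\<dots> \<le> 8 * ?S"
      proof -
        have "real d * \<bar>t\<bar> \<le> real d * e" using 1 by (intro mult_left_mono) auto
        then have "real d * \<bar>t\<bar> / 2 / 2 \<le> sin (real d * \<bar>t\<bar> / 2)"
          using de by (intro sin_ge_half) auto
        moreover have "0 \<le> real d * \<bar>t\<bar> / 2 / 2" by simp
        ultimately have "(real d * \<bar>t\<bar> / 2 / 2)\<^sup>2 \<le> (sin (real d * \<bar>t\<bar> / 2))\<^sup>2"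
          by (intro power_mono)
        also have "\<dots> = ?S" by (simp add: abs_if)
        finally show ?thesis by (simp add: power_mult_distrib power_divide)
      qed
      finally show ?thesis by simp
    next
      case 2
      have sp: "sin (e / 2) \<le> \<bar>sin (t / 2)\<bar>"
      proof -
        have "sin (e / 2) \<le> sin (\<bar>t\<bar> / 2)" using 2 t e by (intro sin_monotone_2pi_le) auto
        also have "\<dots> \<le> \<bar>sin (t / 2)\<bar>" by (simp add: abs_if)
        finally show ?thesis .
      qed
      then have "(sin (e / 2))\<^sup>2 \<le> (sin (t / 2))\<^sup>2" using s1 by (simp add: abs_le_square_iff[symmetric])
      then have "(sin (e / 2))\<^sup>2 * fejer d t \<le> (sin (t / 2))\<^sup>2 * fejer d t" using f by (intro mult_right_mono) auto
      also have "\<dots> = ?S / (real d)\<^sup>2" by (rule fejer_sin[OF d])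
      also have "\<dots> \<le> ?S / 1" using d by (intro divide_left_mono) (auto simp: one_le_power)
      finally have "fejer d t \<le> C1 * ?S" using s1 by (simp add: C1_def field_simps)
      then show ?thesis using 2 f[of t] by simp
    next
      case 3
      then have "t \<in> {- (pi / real d)<..<pi / real d}" using U(2) by blast
      then have tl: "\<bar>t\<bar> < pi / real d" by (simp only: greaterThanLessThan_iff abs_less_iff) simp
      then have "real d * \<bar>t\<bar> < pi" using d by (simp add: field_simps)
      moreover have "real d * e \<le> real d * \<bar>t\<bar>" using 3 by (intro mult_left_mono) auto
      ultimately have "sin (real d * e / 2) \<le> sin (real d * \<bar>t\<bar> / 2)"
        using e by (intro sin_monotone_2pi_le) (auto intro: order_trans[of _ 0])
      then have "(sin (real d * e / 2))\<^sup>2 \<le> (sin (real d * \<bar>t\<bar> / 2))\<^sup>2" using s2 by (intro power_mono) auto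
      also have "\<dots> = ?S" by (simp add: abs_if)
      finally have "1 \<le> C2 * ?S" using s2 by (simp add: C2_def field_simps)
      then show ?thesis using 3 f[of t] by simp
    qed
    moreover have "8 * ?S \<le> (C1 + C2 + 8) * ?S" "C1 * ?S \<le> (C1 + C2 + 8) * ?S" "C2 * ?S \<le> (C1 + C2 + 8) * ?S"
      using C by (intro mult_right_mono; simp)+
    ultimately show ?thesis by linarith
  qed
  then show ?thesis by blast
qed

context transient_pair
begin

definition nbhd_integral :: "real set \<Rightarrow> real \<Rightarrow> real" where
  "nbhd_integral U r = (\<integral>t. indicator U t * (\<integral>s. indicator U s * integrand r (t, s) \<partial>circ) \<partial>circ)"

lemma nbhd_integral_comparison:
  assumes \<psi>: "\<psi> \<in> borel_measurable borel" "\<And>t. \<bar>\<psi> t\<bar> \<le> 1"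
    and c: "summable (\<lambda>n. \<bar>weight_coeff p \<psi> n\<bar> * mean_power q n)"
    and U: "U \<in> sets borel" "{- e..e} \<subseteq> U" and e: "0 < e" "e \<le> pi"
    and strip: "\<And>r. 0 \<le> r \<Longrightarrow> r < 1 \<Longrightarrow> \<bar>\<integral>t. (indicator U t - \<psi> t) * strip_integral p q e r t \<partial>circ\<bar> \<le> C"
  shows "\<exists>C'. \<forall>r. 0 \<le> r \<longrightarrow> r < 1 \<longrightarrow>
    \<bar>nbhd_integral U r - (\<Sum>n. weight_coeff p \<psi> n * (2 * pi * half_sum q n r))\<bar> \<le> C'"
  unfolding nbhd_integral_def using strip
  by (intro strip_comparison[OF \<psi> c U e, of C]) (simp add: strip_integral_def integrand_def)

end

section \<open>Divergence as the damping is removed\<close>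

lemma ennreal_suminf_infinite_partial:
  fixes a :: "nat \<Rightarrow> real" and b :: "nat \<Rightarrow> nat \<Rightarrow> real"
  assumes a: "\<And>n. 0 \<le> a n" and b: "\<And>n x. 0 \<le> b n x"
    and inf: "(\<Sum>n. ennreal (a n) * (\<Sum>x. ennreal (b n x))) = \<infinity>"
  shows "\<exists>N L. Y < (\<Sum>n<N. a n * (\<Sum>x<L. b n x))"
proof -
  have "(\<lambda>N. \<Sum>n<N. ennreal (a n) * (\<Sum>x. ennreal (b n x))) \<longlonglongrightarrow> \<infinity>"
    using summable_LIMSEQ[of "\<lambda>n. ennreal (a n) * (\<Sum>x. ennreal (b n x))"] inf by simp
  then have "\<forall>\<^sub>F N in sequentially. ennreal Y < (\<Sum>n<N. ennreal (a n) * (\<Sum>x. ennreal (b n x)))"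
    by (intro order_tendstoD) auto
  then obtain N where N: "ennreal Y < (\<Sum>n<N. ennreal (a n) * (\<Sum>x. ennreal (b n x)))"
    by (auto simp: eventually_sequentially)
  have "(\<lambda>L. \<Sum>n<N. ennreal (a n) * (\<Sum>x<L. ennreal (b n x))) \<longlonglongrightarrow> (\<Sum>n<N. ennreal (a n) * (\<Sum>x. ennreal (b n x)))"
    by (intro tendsto_sum ennreal_tendsto_cmult summable_LIMSEQ) auto
  then have "\<forall>\<^sub>F L in sequentially. ennreal Y < (\<Sum>n<N. ennreal (a n) * (\<Sum>x<L. ennreal (b n x)))"
    using N by (intro order_tendstoD)
  then obtain L where L: "ennreal Y < (\<Sum>n<N. ennreal (a n) * (\<Sum>x<L. ennreal (b n x)))"
    by (auto simp: eventually_sequentially)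
  also have "\<dots> = ennreal (\<Sum>n<N. a n * (\<Sum>x<L. b n x))"
    using a b by (simp add: ennreal_mult' sum_nonneg flip: sum_ennreal)
  finally have "Y < (\<Sum>n<N. a n * (\<Sum>x<L. b n x))"
    by (metis ennreal_leI not_le)
  then show ?thesis by blast
qed

text \<open>The comparison series has nonnegative terms. If the undamped series converges, it bounds
  \<open>I\<close> for all \<open>r\<close>. If it diverges, a finite section in both indices is
  already large; being a polynomial in \<open>r\<close>, it stays large near 1.\<close>

lemma filterlim_comparison_criterion:
  assumes I: "\<And>r. 0 \<le> r \<Longrightarrow> r < 1 \<Longrightarrow> \<bar>I r - (\<Sum>n. c n * (2 * pi * half_sum q n r))\<bar> \<le> C"
    and c: "\<And>n. 0 \<le> c n" and S: "\<And>r. 0 \<le> r \<Longrightarrow> r < 1 \<Longrightarrow> summable (\<lambda>n. c n * (2 * pi * half_sum q n r))"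
  shows "filterlim I at_top (at_left (1::real)) \<longleftrightarrow> (\<Sum>n. ennreal (c n) * half_cross q n) = \<infinity>"
proof
  assume lim: "filterlim I at_top (at_left 1)"
  show "(\<Sum>n. ennreal (c n) * half_cross q n) = \<infinity>"
  proof (rule ccontr)
    assume "(\<Sum>n. ennreal (c n) * half_cross q n) \<noteq> \<infinity>"
    then obtain B where B: "0 \<le> B" "(\<Sum>n. ennreal (c n) * half_cross q n) = ennreal B"
      by (metis ennreal_cases infinity_ennreal_def)
    have le: "I r \<le> 2 * pi * B + C" if r: "0 \<le> r" "r < 1" for r
    proof -
      have "ennreal (\<Sum>n. c n * (2 * pi * half_sum q n r)) = (\<Sum>n. ennreal (c n * (2 * pi * half_sum q n r)))"
        using c S[OF r] half_sum_nonneg[OF r] by (intro suminf_ennreal2[symmetric]) auto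
      also have "\<dots> \<le> ennreal (2 * pi) * (\<Sum>n. ennreal (c n) * half_cross q n)"
      proof (rule suminf_ennreal_le_cmult)
        fix n
        have "ennreal (c n * (2 * pi * half_sum q n r)) = ennreal (2 * pi) * (ennreal (c n) * ennreal (half_sum q n r))"
          using c half_sum_nonneg[OF r] by (simp add: ennreal_mult'[symmetric] ac_simps)
        also have "\<dots> \<le> ennreal (2 * pi) * (ennreal (c n) * half_cross q n)"
          by (intro mult_left_mono half_sum_le_half_cross r) auto
        finally show "ennreal (c n * (2 * pi * half_sum q n r)) \<le> ennreal (2 * pi) * (ennreal (c n) * half_cross q n)" .
      qed
      also have "\<dots> = ennreal (2 * pi * B)" unfolding B(2) by (simp add: ennreal_mult')
      finally have "(\<Sum>n. c n * (2 * pi * half_sum q n r)) \<le> 2 * pi * B" using B(1) by simp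
      then show ?thesis using I[OF r] by linarith
    qed
    have "\<forall>\<^sub>F r in at_left 1. 2 * pi * B + C + 1 \<le> I r" using lim by (simp add: filterlim_at_top)
    moreover have "\<forall>\<^sub>F r in at_left (1::real). r \<in> {0<..<1}" by (rule eventually_at_left_real) simp
    ultimately have "\<forall>\<^sub>F r in at_left (1::real). False"
    proof eventually_elim
      case (elim r)
      then show ?case using le[of r] by simp
    qed
    then show False by simp
  qed
next
  assume inf: "(\<Sum>n. ennreal (c n) * half_cross q n) = \<infinity>"
  show "filterlim I at_top (at_left 1)"
    unfolding filterlim_at_top
  proof
    fix Z :: real
    define Y where "Y = (Z + C) / (2 * pi)"
    let ?b = "\<lambda>n x. tail q x * pmf (walk_pmf q n) (int x)"
    have b0: "0 \<le> ?b n x" for n x by (simp add: tail_nonneg)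
    have "(\<Sum>n. ennreal (c n) * (\<Sum>x. ennreal (?b n x))) = \<infinity>"
      using inf by (simp only: half_cross_suminf)
    from ennreal_suminf_infinite_partial[OF c b0 this, of Y]
    obtain N L where NL: "Y < (\<Sum>n<N. c n * (\<Sum>x<L. ?b n x))" by blast
    let ?P = "\<lambda>r. \<Sum>n<N. c n * (\<Sum>x<L. r ^ x * ?b n x)"
    have "(?P \<longlongrightarrow> ?P 1) (at_left 1)" by (intro tendsto_intros)
    then have "\<forall>\<^sub>F r in at_left 1. Y < ?P r" using NL by (intro order_tendstoD) auto
    moreover have "\<forall>\<^sub>F r in at_left (1::real). r \<in> {0<..<1}" by (rule eventually_at_left_real) simp
    ultimately show "\<forall>\<^sub>F r in at_left 1. Z \<le> I r"
    proof eventually_elim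
      case (elim r)
      then have r: "0 \<le> r" "r < 1" by auto
      have "Z + C \<le> 2 * pi * ?P r" using elim(1) by (simp add: Y_def pos_divide_less_eq mult.commute)
      also have "2 * pi * ?P r = (\<Sum>n<N. c n * (2 * pi * (\<Sum>x<L. r ^ x * ?b n x)))"
        by (simp add: sum_distrib_left ac_simps)
      also have "\<dots> \<le> (\<Sum>n<N. c n * (2 * pi * half_sum q n r))"
      proof (intro sum_mono mult_left_mono c)
        fix n
        have "(\<Sum>x<L. r ^ x * ?b n x) = (\<Sum>x<L. r ^ x * tail q x * pmf (walk_pmf q n) (int x))"
          by (simp add: mult.assoc)
        also have "\<dots> \<le> half_sum q n r"
          unfolding half_sum_def using half_sum_term_bounds(1)[OF r(1)] by (intro sum_le_suminf summable_half_sum r) auto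
        finally show "(\<Sum>x<L. r ^ x * ?b n x) \<le> half_sum q n r" .
      qed auto
      also have "\<dots> \<le> (\<Sum>n. c n * (2 * pi * half_sum q n r))"
        using c half_sum_nonneg[OF r] by (intro sum_le_suminf S r) auto
      finally show ?case using I[OF r] by linarith
    qed
  qed
qed

section \<open>The criterion for each kind of jump of H\<close>

context transient_pair
begin

abbreviation "visit_sum \<equiv> (\<Sum>n. ennreal (u n 0) * half_cross q n)"

lemma summable_half_sum_series:
  assumes r: "0 \<le> r" "r < 1" and \<psi>: "\<psi> \<in> borel_measurable borel" "\<And>t. \<bar>\<psi> t\<bar> \<le> 1"
    and c: "summable (\<lambda>n. \<bar>weight_coeff p \<psi> n\<bar> * mean_power q n)"
  shows "summable (\<lambda>n. weight_coeff p \<psi> n * (2 * pi * half_sum q n r))"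
  using integral_weight_integrand[OF r \<psi> c] by (rule sums_summable)

text \<open>Fejer coefficients involve visits of \<open>H\<close> to several points. The bound by
  returns to 0 goes through \<open>cross\<close>, for which almost monotonicity in time is
  known.\<close>

lemma suminf_visits_finite:
  assumes "visit_sum \<noteq> \<infinity>"
  shows "(\<Sum>n. ennreal (u n x) * half_cross q n) \<noteq> \<infinity>"
proof -
  have "(\<Sum>n. ennreal (u n 0) * cross q n) \<noteq> \<infinity>"
    using assms suminf_half_cross_iff_cross[OF sym, of "\<lambda>n. ennreal (u n 0)"] by simp
  then have "16 * (\<Sum>n. ennreal (u n 0) * cross q n) < top"
    by (simp add: ennreal_mult_less_top less_top)
  moreover have "(\<Sum>n. ennreal (u n x) * half_cross q n) \<le> (\<Sum>n. ennreal (u n x) * cross q n)"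
    by (intro suminf_le mult_left_mono half_cross_le_cross) auto
  moreover have "(\<Sum>n. ennreal (u n x) * cross q n) \<le> 16 * (\<Sum>n. ennreal (u n 0) * cross q n)"
    by (rule suminf_cross_visits_le[OF sym])
  ultimately show ?thesis by (metis infinity_ennreal_def less_top order.strict_trans1)
qed

lemma weight_coeff_fejer:
  "weight_coeff p (fejer d) n =
    (\<Sum>j<d. \<Sum>k<d. pi * (u n (int j - int k) + u n (- (int j - int k)))) / (real d)\<^sup>2"
proof -
  have int: "integrable circ (\<lambda>t. cos (real_of_int m * t) * Re (pmf_char p t ^ n))" for m
  proof (rule integrable_circ_bounded[of _ 1])
    show "(\<lambda>t. cos (real_of_int m * t) * Re (pmf_char p t ^ n)) \<in> borel_measurable circ"
      by (rule measurable_circ) measurable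
    fix t
    have "\<bar>cos (real_of_int m * t)\<bar> * \<bar>Re (pmf_char p t ^ n)\<bar> \<le> 1 * 1"
      by (intro mult_mono abs_Re_power_le) auto
    then show "norm (cos (real_of_int m * t) * Re (pmf_char p t ^ n)) \<le> 1" by (simp add: abs_mult)
  qed
  have "weight_coeff p (fejer d) n =
      (\<integral>t. (\<Sum>j<d. \<Sum>k<d. cos (real_of_int (int j - int k) * t) * Re (pmf_char p t ^ n)) / (real d)\<^sup>2 \<partial>circ)"
    unfolding weight_coeff_def fejer_def by (simp add: sum_distrib_right)
  also have "\<dots> = (\<Sum>j<d. \<Sum>k<d. weight_coeff p (\<lambda>t. cos (real_of_int (int j - int k) * t)) n) / (real d)\<^sup>2"
    unfolding weight_coeff_def integral_divide_zero
    by (subst Bochner_Integration.integral_sum, (intro Bochner_Integration.integrable_sum int),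
        subst Bochner_Integration.integral_sum, (intro int), rule refl)
  finally show ?thesis unfolding weight_coeff_cos .
qed

text \<open>The strip integral may grow like \<open>1 / (1 - norm (pmf_char p t))\<close>, and the
  difference between the indicator of \<open>U\<close> and the Fejer kernel of order
  \<open>\<bar>a - b\<bar>\<close> is at most a multiple of the reciprocal, by the gap at the same
  distance. The product is bounded uniformly in \<open>r\<close> and \<open>t\<close>.\<close>

lemma criterion_nondeterministic:
  assumes ab: "a \<in> set_pmf p" "b \<in> set_pmf p" "a \<noteq> b"
    and U: "U \<in> sets borel" "{- e..e} \<subseteq> U" "0 < e" "U \<subseteq> {- (pi / \<bar>real_of_int (a - b)\<bar>)<..<pi / \<bar>real_of_int (a - b)\<bar>}"
  shows "filterlim (nbhd_integral U) at_top (at_left 1) \<longleftrightarrow> visit_sum = \<infinity>"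
proof -
  define d where "d = nat \<bar>a - b\<bar>"
  have d: "d > 0" "real d = \<bar>real_of_int (a - b)\<bar>" using ab by (auto simp: d_def)
  have sin_d: "(sin (real d * t / 2))\<^sup>2 = (sin (real_of_int (a - b) * t / 2))\<^sup>2" for t
    unfolding d(2) by (simp add: abs_if del: of_int_diff)
  have U': "U \<subseteq> {- (pi / real d)<..<pi / real d}" using U(4) by (simp only: d(2))
  have e_pi: "e \<le> pi"
  proof -
    have "e \<in> U" using U by auto
    then have "e < pi / real d" using U' by auto
    also have "\<dots> \<le> pi / 1" using d by (intro divide_left_mono) auto
    finally show ?thesis by simp
  qed
  obtain C where C: "\<And>t. t \<in> {- pi..pi} \<Longrightarrow> \<bar>indicator U t - fejer d t\<bar> \<le> C * (sin (real d * t / 2))\<^sup>2"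
    using indicator_minus_fejer_le[OF d(1) U(3,2) U'] by blast
  define m where "m = 2 * (pmf p a * pmf p b)"
  have m: "m > 0" using ab by (simp add: m_def pmf_positive)
  have gap: "m * (sin (real d * t / 2))\<^sup>2 \<le> 1 - norm (pmf_char p t)" for t
    unfolding sin_d m_def by (rule norm_pmf_char_gap)
  have \<psi>: "fejer d \<in> borel_measurable borel" unfolding fejer_def by measurable
  have \<psi>1: "\<bar>fejer d t\<bar> \<le> 1" for t using fejer_nonneg[of d t] fejer_le_1[OF d(1), of t] by simp
  let ?c = "weight_coeff p (fejer d)"
  have c0: "0 \<le> ?c n" for n
    unfolding weight_coeff_fejer by (intro divide_nonneg_nonneg sum_nonneg mult_nonneg_nonneg add_nonneg_nonneg) auto
  have c_mp: "\<bar>?c n\<bar> * mean_power q n = (\<Sum>j<d. \<Sum>k<d. pi / (real d)\<^sup>2 * (u n (int j - int k) * mean_power q n + u n (- (int j - int k)) * mean_power q n))" for n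
    unfolding abs_of_nonneg[OF c0] unfolding weight_coeff_fejer sum_divide_distrib sum_distrib_right
    by (intro sum.cong refl) (simp add: algebra_simps add_divide_distrib)
  have csum: "summable (\<lambda>n. \<bar>?c n\<bar> * mean_power q n)"
    unfolding c_mp by (intro summable_sum summable_mult summable_add summable_visits_mean_power[OF sym green_finite])
  have strip: "\<bar>\<integral>t. (indicator U t - fejer d t) * strip_integral p q e r t \<partial>circ\<bar> \<le> 2 * pi * (\<bar>C\<bar> * 54 / m)"
    if r: "0 \<le> r" "r < 1" for r
  proof -
    have B: "norm ((indicator U t - fejer d t) * strip_integral p q e r t) \<le> \<bar>C\<bar> * 54 / m" if t: "t \<in> {- pi..pi}" for t
    proof (cases "norm (pmf_char p t) < 1")
      case True
      have "\<bar>indicator U t - fejer d t\<bar> \<le> \<bar>C\<bar> * (sin (real d * t / 2))\<^sup>2"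
        using C[OF t] mult_right_mono[OF abs_ge_self[of C], of "(sin (real d * t / 2))\<^sup>2"] by simp
      also have "\<dots> \<le> \<bar>C\<bar> * ((1 - norm (pmf_char p t)) / m)"
        using gap[of t] m by (intro mult_left_mono) (auto simp: field_simps)
      finally have "\<bar>indicator U t - fejer d t\<bar> * \<bar>strip_integral p q e r t\<bar> \<le>
          (\<bar>C\<bar> * ((1 - norm (pmf_char p t)) / m)) * (54 / (1 - norm (pmf_char p t)))"
        using True m U(3) e_pi r by (intro mult_mono strip_integral_le) auto
      also have "\<dots> = \<bar>C\<bar> * 54 / m" using True by simp
      finally show ?thesis by (simp add: abs_mult)
    next
      case False
      \<comment> \<open>Where \<open>norm (pmf_char p t) = 1\<close> the strip integral has no
        bound, but there the gap forces the sine, and with it the weight difference, to be exactly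
        0.\<close>
      then have "m * (sin (real d * t / 2))\<^sup>2 \<le> 0" using gap[of t] by linarith
      then have "(sin (real d * t / 2))\<^sup>2 = 0" using m by (simp add: mult_le_0_iff)
      then have "indicator U t - fejer d t = 0" using C[OF t] by simp
      then show ?thesis using m by simp
    qed
    have "norm (\<integral>t. (indicator U t - fejer d t) * strip_integral p q e r t \<partial>circ) \<le>
        (\<integral>t. norm ((indicator U t - fejer d t) * strip_integral p q e r t) \<partial>circ)"
      by (rule integral_norm_bound)
    also have "\<dots> \<le> (\<integral>t. \<bar>C\<bar> * 54 / m \<partial>circ)"
      using B m by (intro integral_mono' integrable_circ_bounded[of _ "\<bar>C\<bar> * 54 / m"]) auto
    finally show ?thesis by (simp add: measure_circ)
  qed
  obtain C' where C': "\<And>r. 0 \<le> r \<Longrightarrow> r < 1 \<Longrightarrow> \<bar>nbhd_integral U r - (\<Sum>n. ?c n * (2 * pi * half_sum q n r))\<bar> \<le> C'"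
    using nbhd_integral_comparison[OF \<psi> \<psi>1 csum U(1,2,3) e_pi strip] by blast
  have "filterlim (nbhd_integral U) at_top (at_left 1) \<longleftrightarrow> (\<Sum>n. ennreal (?c n) * half_cross q n) = \<infinity>"
    by (rule filterlim_comparison_criterion[OF C' c0 summable_half_sum_series[OF _ _ \<psi> \<psi>1 csum]])
  also have "\<dots> \<longleftrightarrow> visit_sum = \<infinity>"
  proof
    assume inf: "visit_sum = \<infinity>"
    define \<kappa> where "\<kappa> = ennreal (pi * 2 / (real d)\<^sup>2)"
    \<comment> \<open>The single pair \<open>j = k = 0\<close> of the double sum already gives
      \<open>2 * pi * u n 0 / (real d)\<^sup>2\<close>; all other terms are nonnegative.\<close>
    have "\<kappa> * ennreal (u n 0) \<le> ennreal (?c n)" for n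
    proof -
      have "pi * (u n 0 + u n 0) \<le> (\<Sum>k<d. pi * (u n (int 0 - int k) + u n (- (int 0 - int k))))"
        using member_le_sum[of 0 "{..<d}" "\<lambda>k. pi * (u n (int 0 - int k) + u n (- (int 0 - int k)))"] d(1) by simp
      also have "\<dots> \<le> (\<Sum>j<d. \<Sum>k<d. pi * (u n (int j - int k) + u n (- (int j - int k))))"
        using member_le_sum[of 0 "{..<d}" "\<lambda>j. \<Sum>k<d. pi * (u n (int j - int k) + u n (- (int j - int k)))"] d(1)
        by (simp add: sum_nonneg)
      finally have "pi * 2 / (real d)\<^sup>2 * u n 0 \<le> ?c n"
        unfolding weight_coeff_fejer using d(1) by (simp add: divide_simps)
      then show ?thesis by (simp add: \<kappa>_def ennreal_mult'[symmetric] ennreal_leI)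
    qed
    then have "(\<Sum>n. \<kappa> * (ennreal (u n 0) * half_cross q n)) \<le> (\<Sum>n. ennreal (?c n) * half_cross q n)"
      by (intro suminf_le) (auto simp: mult.assoc[symmetric] intro!: mult_right_mono)
    moreover have "(\<Sum>n. \<kappa> * (ennreal (u n 0) * half_cross q n)) = \<kappa> * visit_sum" by simp
    moreover have "\<kappa> \<noteq> 0" using d(1) by (simp add: \<kappa>_def)
    ultimately show "(\<Sum>n. ennreal (?c n) * half_cross q n) = \<infinity>"
      using inf by (simp add: ennreal_mult_top top_unique)
  next
    assume inf: "(\<Sum>n. ennreal (?c n) * half_cross q n) = \<infinity>"
    show "visit_sum = \<infinity>"
    proof (rule ccontr)
      assume "visit_sum \<noteq> \<infinity>"
      note fin = suminf_visits_finite[OF this]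
      have "ennreal (?c n) * half_cross q n = (\<Sum>j<d. \<Sum>k<d. ennreal (pi / (real d)\<^sup>2) *
          (ennreal (u n (int j - int k)) * half_cross q n + ennreal (u n (- (int j - int k))) * half_cross q n))" for n
      proof -
        have "?c n = (\<Sum>j<d. \<Sum>k<d. pi / (real d)\<^sup>2 * (u n (int j - int k) + u n (- (int j - int k))))"
          unfolding weight_coeff_fejer by (simp add: sum_divide_distrib)
        then have "ennreal (?c n) = (\<Sum>j<d. \<Sum>k<d. ennreal (pi / (real d)\<^sup>2 * (u n (int j - int k) + u n (- (int j - int k)))))"
          by (simp only:) (subst sum_ennreal[symmetric], auto intro!: sum_nonneg sum.cong sum_ennreal[symmetric])
        also have "\<dots> = (\<Sum>j<d. \<Sum>k<d. ennreal (pi / (real d)\<^sup>2) * (ennreal (u n (int j - int k)) + ennreal (u n (- (int j - int k)))))"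
          by (intro sum.cong refl, subst ennreal_mult) auto
        finally have "ennreal (?c n) = (\<Sum>j<d. \<Sum>k<d. ennreal (pi / (real d)\<^sup>2) * (ennreal (u n (int j - int k)) + ennreal (u n (- (int j - int k)))))" .
        then show ?thesis by (simp only: sum_distrib_right mult.assoc distrib_right)
      qed
      then have "(\<Sum>n. ennreal (?c n) * half_cross q n) = (\<Sum>j<d. \<Sum>k<d. ennreal (pi / (real d)\<^sup>2) *
          ((\<Sum>n. ennreal (u n (int j - int k)) * half_cross q n) + (\<Sum>n. ennreal (u n (- (int j - int k))) * half_cross q n)))"
        by (simp add: suminf_sum suminf_add)
      moreover have "\<dots> < top"
        using fin by (simp add: less_top[symmetric] ennreal_mult_eq_top_iff)
      ultimately show False using inf by simp
    qed
  qed
  finally show ?thesis .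
qed

text \<open>Here \<open>pmf_char p\<close> is identically 1 and the strip integral does not depend
  on \<open>t\<close>. A constant weight with the same integral \<open>L\<close> as the indicator of
  \<open>U\<close> therefore makes the strip error exactly zero.\<close>

lemma criterion_zero:
  assumes p: "p = return_pmf 0" and U: "U \<in> sets borel" "{- e..e} \<subseteq> U" "0 < e" "e \<le> pi"
  shows "filterlim (nbhd_integral U) at_top (at_left 1) \<longleftrightarrow> visit_sum = \<infinity>"
proof -
  define L where "L = (\<integral>t. indicator U t \<partial>circ :: real)"
  have indm: "(indicator U :: real \<Rightarrow> real) \<in> borel_measurable circ"
    using U(1) by (intro measurable_circ borel_measurable_indicator) simp
  have int: "integrable circ (indicator U :: real \<Rightarrow> real)"
    by (rule integrable_circ_bounded[of _ 1, OF indm]) (auto simp: indicator_def)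
  have L2: "L \<le> 2 * pi"
  proof -
    have "L \<le> (\<integral>t. 1 \<partial>circ)" unfolding L_def
      by (intro integral_mono int integrable_circ_bounded[of _ 1]) (auto simp: indicator_def)
    then show ?thesis by (simp add: measure_circ)
  qed
  have L0: "L > 0"
  proof -
    have "2 * e = (\<integral>t. indicator {- e..e} t * 1 \<partial>circ)"
      using integral_circ_even_window[of e "\<lambda>_. 1"] U(3,4) by simp
    also have "\<dots> \<le> L" unfolding L_def
      using U(2) by (intro integral_mono int integrable_circ_bounded[of _ 1]) (auto simp: indicator_def intro!: measurable_circ)
    finally show ?thesis using U(3) by linarith
  qed
  define \<psi> where "\<psi> = (\<lambda>t :: real. L / (2 * pi))"
  have \<psi>: "\<psi> \<in> borel_measurable borel" "\<bar>\<psi> t\<bar> \<le> 1" for t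
    using L0 L2 by (auto simp: \<psi>_def)
  let ?c = "weight_coeff p \<psi>"
  have c: "?c n = L * u n 0" for n
  proof -
    have "?c n = L / (2 * pi) * weight_coeff p (\<lambda>_. 1) n"
      unfolding weight_coeff_def \<psi>_def by simp
    then show ?thesis by (simp add: weight_coeff_one)
  qed
  have c0: "0 \<le> ?c n" for n using L0 by (simp add: c)
  have csum: "summable (\<lambda>n. \<bar>?c n\<bar> * mean_power q n)"
    unfolding abs_of_nonneg[OF c0] unfolding c mult.assoc
    by (intro summable_mult summable_visits_mean_power[OF sym green_finite])
  have char: "pmf_char p t = 1" for t
    unfolding p pmf_char_alt by (subst integral_measure_pmf[of "{0}"]) auto
  have strip: "\<bar>\<integral>t. (indicator U t - \<psi> t) * strip_integral p q e r t \<partial>circ\<bar> \<le> 0" if "0 \<le> r" "r < 1" for r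
  proof -
    define F where "F = strip_integral p q e r 0"
    have "strip_integral p q e r t = F" for t
      by (simp add: F_def strip_integral_def green_kernel_def char)
    then have "(\<integral>t. (indicator U t - \<psi> t) * strip_integral p q e r t \<partial>circ) = (\<integral>t. indicator U t - \<psi> t \<partial>circ) * F"
      by simp
    also have "(\<integral>t. indicator U t - \<psi> t \<partial>circ) = L - (\<integral>t. \<psi> t \<partial>circ)"
      unfolding L_def by (intro Bochner_Integration.integral_diff int integrable_circ_bounded[of _ 1] measurable_circ \<psi>(1)) (use \<psi>(2) in simp)
    also have "(\<integral>t. \<psi> t \<partial>circ) = L" by (simp add: \<psi>_def measure_circ)
    finally show ?thesis by simp
  qed
  obtain C' where C': "\<And>r. 0 \<le> r \<Longrightarrow> r < 1 \<Longrightarrow> \<bar>nbhd_integral U r - (\<Sum>n. ?c n * (2 * pi * half_sum q n r))\<bar> \<le> C'"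
    using nbhd_integral_comparison[OF \<psi> csum U strip] by blast
  have "filterlim (nbhd_integral U) at_top (at_left 1) \<longleftrightarrow> (\<Sum>n. ennreal (?c n) * half_cross q n) = \<infinity>"
    by (rule filterlim_comparison_criterion[OF C' c0 summable_half_sum_series[OF _ _ \<psi> csum]])
  also have "(\<Sum>n. ennreal (?c n) * half_cross q n) = ennreal L * visit_sum"
    using L0 by (simp add: c ennreal_mult' mult.assoc)
  also have "\<dots> = \<infinity> \<longleftrightarrow> visit_sum = \<infinity>"
    using L0 by (simp add: ennreal_mult_eq_top_iff)
  finally show ?thesis .
qed

text \<open>\<open>H\<close> moves along \<open>n * c\<close> and \<open>norm (pmf_char p t)\<close>
  is identically 1, so the expansion in powers of \<open>pmf_char p\<close> gives no bound. The
  indicator of a full period \<open>{- b..b}\<close> has vanishing coefficients for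
  \<open>n > 0\<close>, and it differs from that of \<open>U\<close> only for
  \<open>e \<le> \<bar>t\<bar> \<le> b\<close>, where \<open>pmf_char p t\<close> is at distance at
  least \<open>\<kappa>\<close> from 1.\<close>

lemma criterion_drift:
  assumes p: "p = return_pmf c" and c: "c \<noteq> 0"
    and U: "U \<in> sets borel" "{- e..e} \<subseteq> U" "0 < e" "U \<subseteq> {- (pi / \<bar>real_of_int c\<bar>)<..<pi / \<bar>real_of_int c\<bar>}"
  shows "filterlim (nbhd_integral U) at_top (at_left 1) \<longleftrightarrow> visit_sum = \<infinity>"
proof -
  define b where "b = pi / \<bar>real_of_int c\<bar>"
  have c1: "1 \<le> \<bar>real_of_int c\<bar>" using c by linarith
  have b: "0 < b" "b \<le> pi"
  proof -
    show "0 < b" using c by (simp add: b_def)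
    have "b \<le> pi / 1" unfolding b_def using c1 by (intro divide_left_mono) auto
    then show "b \<le> pi" by simp
  qed
  have eb: "e < b"
  proof -
    have "e \<in> U" using U by auto
    then show ?thesis using U(4) by (auto simp: b_def)
  qed
  have char: "pmf_char p t = iexp (t * real_of_int c)" for t
    unfolding p pmf_char_alt by (subst integral_measure_pmf[of "{c}"]) auto
  define \<kappa> where "\<kappa> = 2 * sin (\<bar>real_of_int c\<bar> * e / 2)"
  have ce: "\<bar>real_of_int c\<bar> * e < pi" using eb c1 by (simp add: b_def field_simps)
  have \<kappa>: "\<kappa> > 0"
  proof -
    have "0 < \<bar>real_of_int c\<bar> * e" using U(3) c1 by (intro mult_pos_pos) auto
    then have "0 < sin (\<bar>real_of_int c\<bar> * e / 2)"
      using ce pi_gt_zero by (intro sin_gt_zero) linarith+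
    then show ?thesis by (simp add: \<kappa>_def)
  qed
  have far: "norm (1 - pmf_char p t) \<ge> \<kappa>" if t: "e \<le> \<bar>t\<bar>" "\<bar>t\<bar> \<le> b" for t
  proof -
    let ?x = "\<bar>real_of_int c\<bar> * \<bar>t\<bar> / 2"
    have n: "norm (1 - pmf_char p t) = 2 * \<bar>sin (t * real_of_int c / 2)\<bar>"
    proof -
      have "(norm (1 - pmf_char p t))\<^sup>2 = (1 - cos (t * real_of_int c))\<^sup>2 + (sin (t * real_of_int c))\<^sup>2"
        unfolding cmod_power2 char by (simp only: minus_complex.sel one_complex.sel Re_iexp Im_iexp) simp
      also have "\<dots> = 2 - 2 * cos (2 * (t * real_of_int c / 2))"
        using sin_cos_squared_add[of "t * real_of_int c"] by (simp add: power2_diff)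
      also have "\<dots> = (2 * \<bar>sin (t * real_of_int c / 2)\<bar>)\<^sup>2"
        unfolding cos_double_sin by (simp add: power_mult_distrib)
      finally show ?thesis by (rule power2_eq_imp_eq) auto
    qed
    have "\<bar>real_of_int c\<bar> * e / 2 \<le> ?x" using t by (intro divide_right_mono mult_left_mono) auto
    moreover have "\<bar>real_of_int c\<bar> * \<bar>t\<bar> \<le> \<bar>real_of_int c\<bar> * b" using t by (intro mult_left_mono) auto
    then have "?x \<le> pi / 2" using c by (simp add: b_def)
    moreover have "0 \<le> \<bar>real_of_int c\<bar> * e / 2" using U(3) by simp
    ultimately have "sin (\<bar>real_of_int c\<bar> * e / 2) \<le> sin ?x"
      using pi_gt_zero by (intro sin_monotone_2pi_le) linarith+
    also have "\<dots> \<le> \<bar>sin ?x\<bar>" by simp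
    also have "\<bar>sin ?x\<bar> = \<bar>sin (t * real_of_int c / 2)\<bar>"
      by (simp add: abs_if mult.commute)
    finally show ?thesis unfolding n \<kappa>_def by simp
  qed
  \<comment> \<open>The strip in \<open>s\<close> has to be thin in terms of
    \<open>\<kappa>\<close>, which in turn depends on the half-width \<open>e\<close> in
    \<open>t\<close>; hence a second, smaller half-width.\<close>
  obtain e' where e': "0 < e'" "e' \<le> e"
    and strip_le: "\<And>r t. 0 \<le> r \<Longrightarrow> r < 1 \<Longrightarrow> norm (1 - pmf_char p t) \<ge> \<kappa> \<Longrightarrow> \<bar>strip_integral p q e' r t\<bar> \<le> 108 / \<kappa>"
    using strip_integral_away_from_one[OF \<kappa> U(3), of p q] by blast
  define \<psi> where "\<psi> = (indicator {- b..b} :: real \<Rightarrow> real)"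
  have \<psi>: "\<psi> \<in> borel_measurable borel" "\<bar>\<psi> t\<bar> \<le> 1" for t
    by (auto simp: \<psi>_def indicator_def)
  let ?c = "weight_coeff p \<psi>"
  have coeff: "?c n = (if n = 0 then 2 * b else 0)" for n
  proof -
    have "Re (pmf_char p t ^ n) = cos (real_of_int (int n * c) * t)" for t
    proof -
      have "pmf_char p t ^ n = iexp (real_of_int (int n * c) * t)"
        by (simp add: char exp_of_nat_mult[symmetric] ac_simps)
      then show ?thesis by (simp only: Re_iexp)
    qed
    then have "?c n = (\<integral>t. indicator {- b..b} t * cos (real_of_int (int n * c) * t) \<partial>circ)"
      by (simp only: weight_coeff_def \<psi>_def)
    also have "\<dots> = 2 * integral {0..b} (\<lambda>t. cos (real_of_int (int n * c) * t))"
      using b by (intro integral_circ_even_window) (auto intro!: continuous_intros)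
    also have "\<dots> = 2 * wave b (int n * c)"
      using integral_window_cos[of b "int n * c"] b by simp
    also have "\<dots> = (if n = 0 then 2 * b else 0)"
    proof (cases "n = 0")
      case False
      have "sin (real_of_int (int n * c) * b) = 0"
      proof (cases "c > 0")
        case True
        then have "real_of_int (int n * c) * b = real n * pi" by (simp add: b_def)
        then show ?thesis by (simp only: sin_npi)
      next
        case False
        then have "real_of_int (int n * c) * b = - (real n * pi)" using c by (simp add: b_def)
        then show ?thesis by (simp only: sin_minus sin_npi)
      qed
      then show ?thesis using False c by (simp add: wave_def)
    qed (simp add: wave_def)
    finally show ?thesis .
  qed
  have c0: "0 \<le> ?c n" for n using b by (simp add: coeff)
  have csum: "summable (\<lambda>n. \<bar>?c n\<bar> * mean_power q n)"
    by (rule summable_finite[of "{0}"]) (auto simp: coeff)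
  have strip: "\<bar>\<integral>t. (indicator U t - \<psi> t) * strip_integral p q e' r t \<partial>circ\<bar> \<le> 2 * pi * (108 / \<kappa>)"
    if r: "0 \<le> r" "r < 1" for r
  proof -
    have B: "norm ((indicator U t - \<psi> t) * strip_integral p q e' r t) \<le> 108 / \<kappa>" for t
    proof (cases "e \<le> \<bar>t\<bar> \<and> \<bar>t\<bar> \<le> b")
      case True
      have "\<bar>indicator U t - \<psi> t\<bar> * \<bar>strip_integral p q e' r t\<bar> \<le> 1 * (108 / \<kappa>)"
        using True by (intro mult_mono strip_le r far) (auto simp: \<psi>_def indicator_def)
      then show ?thesis by (simp add: abs_mult)
    next
      case False
      have "indicator U t - \<psi> t = 0"
      proof (cases "e \<le> \<bar>t\<bar>")
        case True
        then have tb: "\<bar>t\<bar> > b" using False by simp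
        then have "t \<notin> {- b<..<b}" "t \<notin> {- b..b}" by auto
        then show ?thesis using U(4) by (auto simp: \<psi>_def b_def indicator_def)
      next
        case False
        then have "t \<in> {- e..e}" "t \<in> {- b..b}" using eb by auto
        then show ?thesis using U(2) by (auto simp: \<psi>_def indicator_def)
      qed
      then show ?thesis using \<kappa> by simp
    qed
    have "norm (\<integral>t. (indicator U t - \<psi> t) * strip_integral p q e' r t \<partial>circ) \<le>
        (\<integral>t. norm ((indicator U t - \<psi> t) * strip_integral p q e' r t) \<partial>circ)"
      by (rule integral_norm_bound)
    also have "\<dots> \<le> (\<integral>t. 108 / \<kappa> \<partial>circ)"
      using B \<kappa> by (intro integral_mono' integrable_circ_bounded[of _ "108 / \<kappa>"]) auto
    finally show ?thesis by (simp add: measure_circ)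
  qed
  have U': "{- e'..e'} \<subseteq> U" using U(2) e' by auto
  have e'pi: "e' \<le> pi" using e' eb b by linarith
  obtain C' where C': "\<And>r. 0 \<le> r \<Longrightarrow> r < 1 \<Longrightarrow> \<bar>nbhd_integral U r - (\<Sum>n. ?c n * (2 * pi * half_sum q n r))\<bar> \<le> C'"
    using nbhd_integral_comparison[OF \<psi> csum U(1) U' e'(1) e'pi strip] by blast
  have hc: "half_cross q n < top" for n
    using order_trans[OF half_cross_le_cross cross_le_one, of q n] by (rule le_less_trans) simp
  have "filterlim (nbhd_integral U) at_top (at_left 1) \<longleftrightarrow> (\<Sum>n. ennreal (?c n) * half_cross q n) = \<infinity>"
    by (rule filterlim_comparison_criterion[OF C' c0 summable_half_sum_series[OF _ _ \<psi> csum]])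
  moreover have "(\<Sum>n. ennreal (?c n) * half_cross q n) = ennreal (?c 0) * half_cross q 0"
    by (subst suminf_finite[of "{0}"]) (auto simp: coeff)
  moreover have "visit_sum = ennreal (u 0 0) * half_cross q 0"
  proof (subst suminf_finite[of "{0}"])
    fix n :: nat assume "n \<notin> {0}"
    have "walk_pmf p k = return_pmf (int k * c)" for k
      by (induction k) (auto simp: p bind_return_pmf algebra_simps)
    then have "u n 0 = 0" using \<open>n \<notin> {0}\<close> c by (simp add: indicator_def)
    then show "ennreal (u n 0) * half_cross q n = 0" by simp
  qed auto
  \<comment> \<open>Both series reduce to their finite term at time 0, so neither side of the
    equivalence holds.\<close>
  ultimately show ?thesis using hc[of 0] by (auto simp: ennreal_mult_eq_top_iff less_top)
qed

text \<open>The size \<open>\<delta>\<close> of the admissible arc depends only on the jumps of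
  \<open>H\<close>: \<open>pi\<close> divided by a distance between two of its jumps, or by the
  length of a constant jump, or \<open>pi\<close> if \<open>H\<close> never moves.\<close>

lemma criterion:
  "\<exists>\<delta>>0. \<delta> \<le> pi \<and> (\<forall>U e. U \<in> sets borel \<longrightarrow> 0 < e \<longrightarrow> {- e..e} \<subseteq> U \<longrightarrow> U \<subseteq> {- \<delta><..<\<delta>} \<longrightarrow>
    (filterlim (nbhd_integral U) at_top (at_left 1) \<longleftrightarrow> visit_sum = \<infinity>))"
proof -
  have ratio: "0 < pi / \<bar>real_of_int k\<bar> \<and> pi / \<bar>real_of_int k\<bar> \<le> pi" if "k \<noteq> 0" for k
  proof -
    have "1 \<le> \<bar>real_of_int k\<bar>" using that by linarith
    then have "pi / \<bar>real_of_int k\<bar> \<le> pi / 1" by (intro divide_left_mono) auto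
    then show ?thesis using that by simp
  qed
  show ?thesis
  proof (cases "\<exists>a\<in>set_pmf p. \<exists>b\<in>set_pmf p. a \<noteq> b")
    case True
    then obtain a b where ab: "a \<in> set_pmf p" "b \<in> set_pmf p" "a \<noteq> b" by blast
    show ?thesis
    proof (intro exI[of _ "pi / \<bar>real_of_int (a - b)\<bar>"] conjI allI impI)
      show "0 < pi / \<bar>real_of_int (a - b)\<bar>" "pi / \<bar>real_of_int (a - b)\<bar> \<le> pi"
        using ratio[of "a - b"] ab by auto
    qed (rule criterion_nondeterministic[OF ab])
  next
    case False
    obtain c where "c \<in> set_pmf p" using set_pmf_not_empty[of p] by auto
    with False have "set_pmf p \<subseteq> {c}" by auto
    then have p: "p = return_pmf c" by (simp only: set_pmf_subset_singleton)
    show ?thesis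
    proof (cases "c = 0")
      case True
      have "filterlim (nbhd_integral U) at_top (at_left 1) \<longleftrightarrow> visit_sum = \<infinity>"
        if "U \<in> sets borel" "0 < e" "{- e..e} \<subseteq> U" "U \<subseteq> {- pi<..<pi}" for U e
      proof (rule criterion_zero[OF _ that(1,3,2)])
        show "p = return_pmf 0" using p True by simp
        have "e \<in> U" using that by auto
        then show "e \<le> pi" using that(4) by auto
      qed
      then show ?thesis by (intro exI[of _ pi]) auto
    next
      case False
      show ?thesis
      proof (intro exI[of _ "pi / \<bar>real_of_int c\<bar>"] conjI allI impI)
        show "0 < pi / \<bar>real_of_int c\<bar>" "pi / \<bar>real_of_int c\<bar> \<le> pi"
          using ratio[OF False] by auto
      qed (rule criterion_drift[OF p False])
    qed
  qed
qed

end

section \<open>From Lebesgue measurable to Borel neighbourhoods\<close>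

lemma set_integral_lebesgue_borel_part:
  fixes f :: "real \<Rightarrow> real"
  assumes f: "f \<in> borel_measurable borel" and U: "U \<in> sets lebesgue" "U \<subseteq> {- pi..pi}"
    and B: "B \<in> sets borel" "B \<subseteq> U" and N: "N \<in> null_sets lborel" "U - B \<subseteq> N"
  shows "(LINT x:U|lebesgue. f x) = (\<integral>x. indicator B x * f x \<partial>circ)"
proof -
  have fl: "f \<in> borel_measurable lebesgue" using f by (intro measurable_completion) simp
  have Bl: "B \<in> sets lebesgue" using B(1) by (intro sets_completionI_sets) simp
  have "(LINT x:U|lebesgue. f x) = (\<integral>x. indicator B x * f x \<partial>lebesgue)"
    unfolding set_lebesgue_integral_def real_scaleR_def
  proof (rule integral_cong_AE)
    show "(\<lambda>x. indicator U x * f x) \<in> borel_measurable lebesgue"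
      by (intro borel_measurable_times borel_measurable_indicator U(1) fl)
    show "(\<lambda>x. indicator B x * f x) \<in> borel_measurable lebesgue"
      by (intro borel_measurable_times borel_measurable_indicator Bl fl)
    have "N \<in> null_sets lebesgue" using N(1) by (rule null_sets_completionI)
    then show "AE x in lebesgue. indicator U x * f x = indicator B x * f x"
      by (rule AE_I') (use B(2) N(2) in \<open>auto simp: indicator_def\<close>)
  qed
  also have "\<dots> = (\<integral>x. indicator B x * f x \<partial>lborel)"
    using f B(1) by (intro integral_completion borel_measurable_times borel_measurable_indicator) auto
  also have "\<dots> = (LINT x:{- pi..pi}|lborel. indicator B x * f x)"
    unfolding set_lebesgue_integral_def
    using B(2) U(2) by (intro Bochner_Integration.integral_cong) (auto simp: indicator_def)
  finally show ?thesis by (simp add: integral_circ)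
qed

text \<open>A Lebesgue set is a Borel set up to a null set; adding \<open>{- e..e}\<close> back
  ensures that the Borel part is still a neighbourhood of 0.\<close>

lemma lebesgue_nbhd_borel_part:
  fixes U :: "real set"
  assumes U: "U \<in> sets lebesgue" and e: "{- e..e} \<subseteq> U"
  obtains B N where "B \<in> sets borel" "{- e..e} \<subseteq> B" "B \<subseteq> U" "N \<in> null_sets lborel" "U - B \<subseteq> N"
proof -
  have mp: "main_part lborel U \<in> sets lborel" using U by (rule main_part_sets)
  obtain N where N: "N \<in> null_sets lborel" "null_part lborel U \<subseteq> N" using null_part[OF U] by auto
  have un: "main_part lborel U \<union> null_part lborel U = U" using U by (rule main_part_null_part_Un)
  have "main_part lborel U \<union> {- e..e} \<in> sets borel" using mp by (intro sets.Un) auto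
  then show ?thesis
    by (rule that[of "main_part lborel U \<union> {- e..e}" N]) (use N un e in auto)
qed

lemma (in transient_pair) double_integral_eq_nbhd_integral:
  assumes H: "jump_char M H = pmf_char p" and V: "jump_char M V = pmf_char q" and T: "tail_series M V = tail_fun q"
    and r: "0 \<le> r" "r < 1"
    and U: "U \<in> sets lebesgue" "U \<subseteq> {- pi..pi}"
    and B: "B \<in> sets borel" "B \<subseteq> U" and N: "N \<in> null_sets lborel" "U - B \<subseteq> N"
  shows "double_integral M H V U r = nbhd_integral B r"
proof -
  let ?f = "\<lambda>t s. tail_fun q r s * K t s"
  have Re: "Re (complex_of_real (tail_series M V r s) / (1 - jump_char M H t * jump_char M V s)) = ?f t s" for t s
  proof -
    have "Re (complex_of_real x / z) = x * Re (1 / z)" for x z by (simp add: Re_divide)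
    then show ?thesis by (simp only: T H V pmf_char_symmetric[OF sym] green_kernel_def)
  qed
  have inner: "(LINT s:U|lebesgue. ?f t s) = (\<integral>s. indicator B s * ?f t s \<partial>circ)" for t
    by (intro set_integral_lebesgue_borel_part[OF _ U B N] borel_measurable_times measurable_tail_fun r
        measurable_green_kernel_section')
  \<comment> \<open>Replacing \<open>U\<close> by \<open>B\<close> in the outer variable requires
    the inner integral to be Borel measurable in \<open>t\<close>, which holds only after
    \<open>U\<close> has been replaced in the inner one.\<close>
  have m: "(\<lambda>t. \<integral>s. indicator B s * ?f t s \<partial>circ) \<in> borel_measurable borel"
  proof (rule sigma_finite_measure.borel_measurable_lebesgue_integral)
    show "sigma_finite_measure circ" by (rule finite_measure.sigma_finite_measure[OF finite_measure_circ])
    have snd: "(\<lambda>z. f (snd z)) \<in> borel_measurable (borel \<Otimes>\<^sub>M circ)" if "f \<in> borel_measurable borel" for f :: "real \<Rightarrow> real"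
      by (rule measurable_compose[OF measurable_snd measurable_circ[OF that]])
    have "(\<lambda>z. (fst z, snd z)) \<in> measurable (borel \<Otimes>\<^sub>M circ) (borel \<Otimes>\<^sub>M borel)"
      by (intro measurable_Pair measurable_fst measurable_compose[OF measurable_snd measurable_ident_circ])
    from measurable_compose[OF this measurable_green_kernel[of p q]]
    have Km: "(\<lambda>z. K (fst z) (snd z)) \<in> borel_measurable (borel \<Otimes>\<^sub>M circ)" by simp
    show "case_prod (\<lambda>t s. indicator B s * ?f t s) \<in> borel_measurable (borel \<Otimes>\<^sub>M circ)"
      unfolding split_beta'
      by (intro borel_measurable_times snd Km measurable_tail_fun r borel_measurable_indicator) (simp add: B(1))
  qed
  have "double_integral M H V U r = (LINT t:U|lebesgue. \<integral>s. indicator B s * ?f t s \<partial>circ)"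
    unfolding double_integral_def Re inner ..
  also have "\<dots> = (\<integral>t. indicator B t * (\<integral>s. indicator B s * ?f t s \<partial>circ) \<partial>circ)"
    by (rule set_integral_lebesgue_borel_part[OF m U B N])
  finally show ?thesis by (simp add: nbhd_integral_def integrand_def)
qed

lemma nbhds_within_arcD:
  assumes "U \<in> nbhds_within_arc \<delta>"
  obtains e where "U \<in> sets lebesgue" "0 < e" "{- e..e} \<subseteq> U" "U \<subseteq> {- \<delta><..<\<delta>}"
proof -
  have "0 \<in> interior U" using assms by (simp add: nbhds_within_arc_def)
  then obtain e where e: "e > 0" "ball 0 e \<subseteq> U" by (auto simp: mem_interior)
  have "{- (e / 2)..e / 2} \<subseteq> ball 0 e" using e(1) by (auto simp: dist_real_def)
  with e show ?thesis using assms that[of "e / 2"] by (auto simp: nbhds_within_arc_def)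
qed

lemma not_filterlim_const_at_top: "\<not> filterlim (\<lambda>_. c :: real) at_top (at_left (1::real))"
proof
  assume "filterlim (\<lambda>_. c) at_top (at_left (1::real))"
  then have "\<forall>\<^sub>F r in at_left (1::real). c + 1 \<le> c" by (simp only: filterlim_at_top)
  then show False by simp
qed

section \<open>Transfer to the given walks\<close>

lemma sets_seq_countable_pred:
  fixes X :: "(nat \<Rightarrow> 'a) \<Rightarrow> 'b::countable" and Y :: "(nat \<Rightarrow> 'a) \<Rightarrow> 'c::countable"
  assumes "X \<in> measurable seq_alg (count_space UNIV)" "Y \<in> measurable seq_alg (count_space UNIV)"
  shows "{\<omega>. P (X \<omega>) (Y \<omega>)} \<in> sets seq_alg"
  using measurable_sets[OF measurable_countable_fun2[OF assms, of P], of "{True}"]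
  by (simp add: vimage_def space_PiM)

theorem theorem2p2:
  fixes M :: "'a measure" and H V :: "nat \<Rightarrow> 'a \<Rightarrow> int"
  assumes "prob_space M"
    and "random_walk M H"
    and "random_walk M V"
    and "indep_walks M H V"
    and "symmetric_walk M V"
  shows
    "(\<P>(\<omega> in M. \<exists>\<^sub>\<infinity>n. H (n + 1) \<omega> = 0 \<and> V n \<omega> * V (n + 1) \<omega> \<le> 0) = 1
        \<longleftrightarrow>
      (\<Sum>n. ennreal (\<P>(\<omega> in M. H (n + 1) \<omega> = 0) *
                     \<P>(\<omega> in M. 0 \<le> V n \<omega> \<and> V n \<omega> \<le> V (n + 1) \<omega> - V n \<omega>))) = \<infinity>)
     \<and>
     (transient_walk M (\<lambda>n \<omega>. (H n \<omega>, V n \<omega>)) \<longrightarrow>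
        (\<exists>\<delta>>0. \<delta> \<le> pi \<and>
          (\<forall>U \<in> nbhds_within_arc \<delta>.
             (\<Sum>n. ennreal (\<P>(\<omega> in M. H (n + 1) \<omega> = 0) *
                            \<P>(\<omega> in M. 0 \<le> V n \<omega> \<and> V n \<omega> \<le> V (n + 1) \<omega> - V n \<omega>))) = \<infinity>
             \<longleftrightarrow>
             filterlim (double_integral M H V U) at_top (at_left 1))))"
proof -
  interpret prob_space M by fact
  obtain p where p: "jump_distr M H = measure_pmf p" using jump_distr_pmf[OF assms(2)] by blast
  obtain q where q: "jump_distr M V = measure_pmf q" using jump_distr_pmf[OF assms(3)] by blast
  have sym: "map_pmf uminus q = q"
    using assms(5) unfolding symmetric_walk_def q by (simp flip: map_pmf_rep_eq add: measure_pmf_inject)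
  let ?D = "pair_pmf p q" and ?Z = "\<lambda>\<omega> n. (H (Suc n) \<omega> - H n \<omega>, V (Suc n) \<omega> - V n \<omega>)"
  note Z = distr_joint_jumps[OF assms(1-4) p q]
  have transfer: "prob {\<omega> \<in> space M. ?Z \<omega> \<in> A} = measure (seq_meas ?D) A" if "A \<in> sets seq_alg" for A
    unfolding Z(2)[symmetric] using that
    by (subst measure_distr[OF Z(1)]) (auto intro!: arg_cong[where f = prob])
  have H0: "H 0 \<omega> = 0" and V0: "V 0 \<omega> = 0" if "\<omega> \<in> space M" for \<omega>
    using assms(2,3) that by (auto simp: random_walk_def)
  have psum: "(\<Sum>i<n. ?Z \<omega> i) = (H n \<omega>, V n \<omega>)" if "\<omega> \<in> space M" for \<omega> n
    by (induction n) (auto simp: H0[OF that] V0[OF that] zero_prod_def)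
  define h where "h n = pmf (walk_pmf p n) 0" for n
  have h_nonneg: "0 \<le> h n" for n by (simp add: h_def)
  have io: "prob {\<omega> \<in> space M. \<exists>\<^sub>\<infinity>n. H (n + 1) \<omega> = 0 \<and> V n \<omega> * V (n + 1) \<omega> \<le> 0} =
      measure (seq_meas ?D) {\<omega>. \<exists>\<^sub>\<infinity>n. \<omega> \<in> cross_event n}"
  proof -
    have "{\<omega> \<in> space seq_alg. \<exists>\<^sub>\<infinity>n. \<omega> \<in> cross_event n} \<in> sets seq_alg"
      unfolding INFM_nat by measurable
    then have "{\<omega>. \<exists>\<^sub>\<infinity>n. \<omega> \<in> cross_event n} \<in> sets seq_alg" by (simp add: space_PiM)
    from transfer[OF this, symmetric] show ?thesis
      by (simp only:) (intro arg_cong[where f = prob], auto simp: cross_event_def psum simp del: sum.lessThan_Suc)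
  qed
  have pH: "prob {\<omega> \<in> space M. H (n + 1) \<omega> = 0} = h (Suc n)" for n
  proof -
    have A: "{\<omega> :: nat \<Rightarrow> int \<times> int. fst (\<Sum>i<Suc n. \<omega> i) = 0} \<in> sets seq_alg"
      by (rule sets_seq_countable_pred[OF measurable_partial_sum measurable_partial_sum, where P = "\<lambda>x y. fst x = 0"])
    have "prob {\<omega> \<in> space M. H (n + 1) \<omega> = 0} = measure (seq_meas ?D) {\<omega>. fst (\<Sum>i<Suc n. \<omega> i) = 0}"
      unfolding transfer[OF A, symmetric]
      by (intro arg_cong[where f = prob]) (auto simp: psum simp del: sum.lessThan_Suc)
    also have "\<dots> = measure (walk_pmf ?D (Suc n)) {x. fst x = 0}"
      unfolding measure_def emeasure_seq_psum[where P = "\<lambda>x. fst x = 0"] ..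
    also have "\<dots> = pmf (map_pmf fst (pair_pmf (walk_pmf p (Suc n)) (walk_pmf q (Suc n)))) 0"
      unfolding walk_pmf_pair pmf_map by (simp add: vimage_def)
    finally show ?thesis unfolding map_fst_pair_pmf h_def .
  qed
  have pV: "ennreal (prob {\<omega> \<in> space M. 0 \<le> V n \<omega> \<and> V n \<omega> \<le> V (n + 1) \<omega> - V n \<omega>}) = pos_cross q n" for n
  proof -
    have A: "{\<omega> :: nat \<Rightarrow> int \<times> int. 0 \<le> snd (\<Sum>i<n. \<omega> i) \<and> snd (\<Sum>i<n. \<omega> i) \<le> snd (\<omega> n)} \<in> sets seq_alg"
      by (rule sets_seq_countable_pred[OF measurable_partial_sum measurable_seq_nth, where P = "\<lambda>x y. 0 \<le> snd x \<and> snd x \<le> snd y"])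
    have "prob {\<omega> \<in> space M. 0 \<le> V n \<omega> \<and> V n \<omega> \<le> V (n + 1) \<omega> - V n \<omega>} =
        measure (seq_meas ?D) {\<omega>. 0 \<le> snd (\<Sum>i<n. \<omega> i) \<and> snd (\<Sum>i<n. \<omega> i) \<le> snd (\<omega> n)}"
      unfolding transfer[OF A, symmetric]
      by (intro arg_cong[where f = prob]) (auto simp: psum)
    also have "ennreal \<dots> = emeasure (seq_meas ?D) {\<omega>. 0 \<le> snd (\<Sum>i<n. \<omega> i) \<and> snd (\<Sum>i<n. \<omega> i) \<le> snd (\<omega> n)}"
      by (rule finite_measure.emeasure_eq_measure[symmetric, OF prob_space.finite_measure[OF prob_space_seq_meas]])
    also have "\<dots> = emeasure (pair_pmf (walk_pmf ?D n) ?D) {(x, y). 0 \<le> snd x \<and> snd x \<le> snd y}"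
      by (rule emeasure_seq_psum_step)
    also have "\<dots> = emeasure (pair_pmf (pair_pmf (walk_pmf p n) (walk_pmf q n)) ?D) {((a, b), (x, y)). True \<and> (0 \<le> b \<and> b \<le> y)}"
      unfolding walk_pmf_pair by (intro arg_cong2[where f = emeasure]) auto
    also have "\<dots> = emeasure (pair_pmf (walk_pmf p n) p) {(a, x). True} * pos_cross q n"
      unfolding pos_cross_def by (rule emeasure_pair_pair_pmf)
    also have "\<dots> = pos_cross q n" by simp
    finally show ?thesis .
  qed
  have series: "(\<Sum>n. ennreal (prob {\<omega> \<in> space M. H (n + 1) \<omega> = 0} *
      prob {\<omega> \<in> space M. 0 \<le> V n \<omega> \<and> V n \<omega> \<le> V (n + 1) \<omega> - V n \<omega>})) = (\<Sum>n. ennreal (h (Suc n)) * pos_cross q n)"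
    by (intro suminf_cong, subst ennreal_mult) (simp_all only: measure_nonneg pH pV h_nonneg)
  have part1: "prob {\<omega> \<in> space M. \<exists>\<^sub>\<infinity>n. H (n + 1) \<omega> = 0 \<and> V n \<omega> * V (n + 1) \<omega> \<le> 0} = 1 \<longleftrightarrow>
      (\<Sum>n. ennreal (h (Suc n)) * pos_cross q n) = \<infinity>"
    unfolding io h_def by (rule cross_event_io_iff[OF sym])
  have charH: "jump_char M H = pmf_char p" and charV: "jump_char M V = pmf_char q"
    by (simp_all add: jump_char_def pmf_char_def p q)
  have tails: "two_sided_tail M V n = tail q n" for n
  proof -
    have rv: "(\<lambda>\<omega>. V 1 \<omega> - V 0 \<omega>) \<in> measurable M (count_space UNIV)"
      using assms(3) by (auto simp: random_walk_def indep_vars_def)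
    show ?thesis
      unfolding two_sided_tail_def tail_def q[symmetric] jump_distr_def
      by (subst measure_distr[OF rv]) (auto intro!: arg_cong[where f = prob] simp: V0)
  qed
  have T: "tail_series M V = tail_fun q"
    by (intro ext) (simp add: tail_series_def tail_fun_def tails)
  have part2: "\<exists>\<delta>>0. \<delta> \<le> pi \<and> (\<forall>U \<in> nbhds_within_arc \<delta>.
      (\<Sum>n. ennreal (h (Suc n)) * pos_cross q n) = \<infinity> \<longleftrightarrow> filterlim (double_integral M H V U) at_top (at_left 1))"
    if tr: "transient_walk M (\<lambda>n \<omega>. (H n \<omega>, V n \<omega>))"
  proof -
    have A: "{\<omega> :: nat \<Rightarrow> int \<times> int. \<exists>n\<ge>1. (\<Sum>i<n. \<omega> i) = 0} \<in> sets seq_alg"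
    proof -
      have "{\<omega> :: nat \<Rightarrow> int \<times> int. (\<Sum>i<n. \<omega> i) = 0} \<in> sets seq_alg" for n
        by (rule sets_seq_countable_pred[OF measurable_partial_sum measurable_partial_sum, where P = "\<lambda>x y. x = 0"])
      then have "(\<Union>n\<in>{1..}. {\<omega> :: nat \<Rightarrow> int \<times> int. (\<Sum>i<n. \<omega> i) = 0}) \<in> sets seq_alg" by (intro sets.countable_UN') auto
      moreover have "(\<Union>n\<in>{1..}. {\<omega> :: nat \<Rightarrow> int \<times> int. (\<Sum>i<n. \<omega> i) = 0}) = {\<omega>. \<exists>n\<ge>1. (\<Sum>i<n. \<omega> i) = 0}" by auto
      ultimately show ?thesis by simp
    qed
    have "measure (seq_meas ?D) {\<omega>. \<exists>n\<ge>1. (\<Sum>i<n. \<omega> i) = 0} = prob {\<omega> \<in> space M. \<exists>n\<ge>1. (H n \<omega>, V n \<omega>) = 0}"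
      unfolding transfer[OF A, symmetric] by (intro arg_cong[where f = prob]) (auto simp: psum)
    also have "\<dots> < 1" using tr by (simp add: transient_walk_def)
    finally have "(\<Sum>n. ennreal (pmf (walk_pmf ?D n) 0)) < \<infinity>" by (rule transient_green_finite)
    then have green: "(\<Sum>n. ennreal (h n) * ennreal (pmf (walk_pmf q n) 0)) < \<infinity>"
      by (simp add: walk_pmf_pair zero_prod_def pmf_pair ennreal_mult' h_def)
    show ?thesis
    proof (cases "q = return_pmf 0")
      \<comment> \<open>If \<open>V\<close> never moves, \<open>sym_char q\<close> is identically 1
        and the locale does not apply. Transience then makes the return probabilities of
        \<open>H\<close> summable, while \<open>tail_fun\<close> is identically 1 and the double
        integral constant in \<open>r\<close>: both sides of the equivalence are false.\<close>
      case True
      have "walk_pmf q n = return_pmf 0" for n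
        by (induction n) (simp_all add: True bind_return_pmf)
      then have "(\<Sum>n. ennreal (h n)) < \<infinity>" using green by simp
      moreover have "(\<Sum>n. ennreal (h (Suc n)) * pos_cross q n) \<le> (\<Sum>n. ennreal (h (Suc n)))"
      proof (intro suminf_le)
        fix n
        have "pos_cross q n \<le> 1" unfolding pos_cross_def by (rule measure_pmf.emeasure_le_1)
        from mult_left_mono[OF this, of "ennreal (h (Suc n))"]
        show "ennreal (h (Suc n)) * pos_cross q n \<le> ennreal (h (Suc n))" by simp
      qed auto
      moreover have "(\<Sum>n. ennreal (h (Suc n))) \<le> (\<Sum>n. ennreal (h n))"
        using suminf_offset[of "\<lambda>n. ennreal (h n)" 1] by simp
      ultimately have fin: "(\<Sum>n. ennreal (h (Suc n)) * pos_cross q n) \<noteq> \<infinity>"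
        by (metis infinity_ennreal_def less_top order.strict_trans1)
      have "tail q n = (if n = 0 then 1 else 0)" for n
        by (simp add: tail_def True indicator_def)
      then have "tail_fun q r s = 1" for r s
        unfolding tail_fun_def by (subst suminf_finite[of "{0}"]) auto
      then have "double_integral M H V U = (\<lambda>_. double_integral M H V U 0)" for U
        by (intro ext) (simp add: double_integral_def T)
      then have "\<not> filterlim (double_integral M H V U) at_top (at_left 1)" for U
        using not_filterlim_const_at_top by metis
      with fin show ?thesis by (intro exI[of _ pi]) auto
    next
      case False
      interpret transient_pair p q
        using sym False green by unfold_locales (simp_all add: h_def)
      have crit: "(\<Sum>n. ennreal (h (Suc n)) * pos_cross q n) = \<infinity> \<longleftrightarrow> visit_sum = \<infinity>"
        unfolding h_def suminf_half_cross_iff_cross[OF sym]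
        by (rule suminf_pos_cross_iff_cross[OF sym, of "\<lambda>n. ennreal (pmf (walk_pmf p n) 0)"]) simp
      obtain \<delta> where \<delta>: "0 < \<delta>" "\<delta> \<le> pi"
        and cond: "\<And>U e. U \<in> sets borel \<Longrightarrow> 0 < e \<Longrightarrow> {- e..e} \<subseteq> U \<Longrightarrow> U \<subseteq> {- \<delta><..<\<delta>} \<Longrightarrow>
          filterlim (nbhd_integral U) at_top (at_left 1) \<longleftrightarrow> visit_sum = \<infinity>"
        using criterion by blast
      have "(\<Sum>n. ennreal (h (Suc n)) * pos_cross q n) = \<infinity> \<longleftrightarrow> filterlim (double_integral M H V U) at_top (at_left 1)"
        if arc: "U \<in> nbhds_within_arc \<delta>" for U
      proof -
        obtain e where U: "U \<in> sets lebesgue" "0 < e" "{- e..e} \<subseteq> U" "U \<subseteq> {- \<delta><..<\<delta>}"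
          using nbhds_within_arcD[OF arc] by metis
        obtain B N where B: "B \<in> sets borel" "{- e..e} \<subseteq> B" "B \<subseteq> U" and N: "N \<in> null_sets lborel" "U - B \<subseteq> N"
          using lebesgue_nbhd_borel_part[OF U(1,3)] by metis
        have Upi: "U \<subseteq> {- pi..pi}" using U(4) \<delta>(2) by fastforce
        have "\<forall>\<^sub>F r in at_left (1::real). r \<in> {0<..<1}" by (rule eventually_at_left_real) simp
        then have "\<forall>\<^sub>F r in at_left 1. double_integral M H V U r = nbhd_integral B r"
          by eventually_elim
             (intro double_integral_eq_nbhd_integral[OF charH charV T _ _ U(1) Upi B(1,3) N]; simp)
        then have "filterlim (double_integral M H V U) at_top (at_left 1) \<longleftrightarrow> filterlim (nbhd_integral B) at_top (at_left 1)"
          by (intro filterlim_cong refl)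
        also have "\<dots> \<longleftrightarrow> visit_sum = \<infinity>"
          using B U by (intro cond[of B e]) auto
        finally show ?thesis using crit by simp
      qed
      then show ?thesis using \<delta> by blast
    qed
  qed
  show ?thesis
    unfolding series using part1 part2 by blast
qed

end
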